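(* Let $E$ be a compact metric space, let $\{S(t)\}_{t\ge0}$ be the strongly continuous transition semigroup on $C(E)$ of a time-homogeneous Markov process with càdlàg paths, with generator $(A,\mathcal{D}(A))$, and let $(D,\tau_D)$ satisfy the core conditions (1)–(8) of the context. Then for all $t\ge0$, $h\in C(E)$ and $\mu\in\mathcal{P}(E)$, $$\mathbf{V}(t)[h](\mu)\ge\langle V(t)h,\mu\rangle,$$ where $V(t)h=\log S(t)e^h$, $[h](\mu)=\langle h,\mu\rangle$ and $$\mathbf{V}(t)G(\mu)=\sup_{\nu\in\mathcal{AC}_\mu}\Big\{G(\nu(t))-\int_0^t\mathcal{L}(\nu(s),\dot\nu(s))\,ds\Big\}.$$
   Context: $\|\cdot\|$ is the sup norm; $\mathcal{P}(E)$ carries the weak topology; $\langle f,\mu\rangle=\int f\,d\mu$; $\mathbb{R}^+=[0,\infty)$. For $f\in D$, $Hf=e^{-f}Ae^f$. Core conditions for $(D,\tau_D)$, $D\subseteq\mathcal{D}(A)$: (1) $D$ is dense in $C(E)$ and for every $f\in\mathcal{D}(A)$ there are $f_n\in D$ with $f_n\to f$, $Af_n\to Af$ in sup norm; (2) $f,g\in D$ implies $fg\in D$; (3) if $f\in D$ and $\phi:\mathbb{R}\to\mathbb{R}$ is smooth on the range of $f$, then $\phi\circ f\in D$; (4) $(D,\tau_D)$ is a separable barrelled locally convex Hausdorff space; (5) $\tau_D$ is finer than the sup norm topology on $D$; (6) if $\phi:[a,b]\to\mathbb{R}$ is smooth with $\phi(0)=0$, then $f\mapsto\phi\circ f$, from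 $\{f\in D:f(E)\subseteq[a,b]\}$ to $D$, is $\tau_D$-to-$\tau_D$ continuous; (7) $A:(D,\tau_D)\to(C(E),\|\cdot\|)$ is continuous; (8) there is a barrel $\mathcal{N}\subseteq(D,\tau_D)$ (closed, convex, balanced, absorbing set) with $\sup_{f\in c\mathcal{N}}\|Hf\|<\infty$ for every $c>0$. $D'$ is the continuous dual of $(D,\tau_D)$ with the weak* topology, and $\mathcal{L}(\mu,u)=\sup_{f\in D}\{\langle f,u\rangle-\langle Hf,\mu\rangle\}\in[0,\infty]$ for $\mu\in\mathcal{P}(E)$, $u\in D'$. $\mathcal{AC}_\mu$ is the set of continuous paths $\nu:\mathbb{R}^+\to\mathcal{P}(E)$ with $\nu(0)=\mu$ for which there is a weak*-measurable curve $s\mapsto u(s)\in D'$ with $\int_0^t|\langle f,u(s)\rangle|ds<\infty$ and $\langle f,\nu(t)\rangle-\langle f,\nu(0)\rangle=\int_0^t\langle f,u(s)\rangle ds$ for all $f\in D$, $t\ge0$; then $\dot\nu(s):=u(s)$. *)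

theory Defs
  imports "HOL-Probability.Probability"
begin

text \<open>
  For a compact metric space \<open>E\<close>, represented by a type \<open>'a::metric_space\<close> with
  \<open>compact UNIV\<close>, the Banach space \<open>C(E)\<close> is the library type \<open>'a \<Rightarrow>\<^sub>C real\<close> of (bounded)
  continuous functions with the sup norm, and the Borel probability measures on \<open>E\<close> are
  \<open>space (prob_algebra borel)\<close>. Time is \<open>real\<close>; values at negative times are irrelevant
  throughout.
\<close>

section \<open>Operations on continuous functions\<close>

definition bmult :: "('a::topological_space \<Rightarrow>\<^sub>C real) \<Rightarrow> ('a \<Rightarrow>\<^sub>C real) \<Rightarrow> ('a \<Rightarrow>\<^sub>C real)"
  where "bmult f g = Bcontfun (\<lambda>x. f x * g x)"

lemma bmult_apply: "bmult f g x = f x * g x"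
proof -
  have "norm (f x * g x) \<le> norm f * norm g" for x
    by (simp only: norm_mult) (intro mult_mono norm_bounded norm_ge_zero)
  then have "(\<lambda>x. f x * g x) \<in> bcontfun"
    by (auto simp: bcontfun_def bounded_iff intro!: continuous_on_mult)
  then show ?thesis
    by (simp add: bmult_def Bcontfun_inverse)
qed

text \<open>
  Used only if \<open>E\<close> is compact and \<open>\<phi>\<close> is continuous on the range of \<open>f\<close>, so that the composition
  is indeed bounded and continuous.
\<close>
definition bcomp :: "(real \<Rightarrow> real) \<Rightarrow> ('a::topological_space \<Rightarrow>\<^sub>C real) \<Rightarrow> ('a \<Rightarrow>\<^sub>C real)"
  where "bcomp \<phi> f = Bcontfun (\<lambda>x. \<phi> (f x))"

lemma bcomp_apply:
  fixes f :: "'a::topological_space \<Rightarrow>\<^sub>C real"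
  assumes "compact (UNIV :: 'a set)" and "continuous_on (range (apply_bcontfun f)) \<phi>"
  shows "bcomp \<phi> f x = \<phi> (f x)"
proof -
  have "continuous_on UNIV (\<lambda>x. \<phi> (f x))"
    by (rule continuous_on_compose2[OF assms(2)]) auto
  moreover from this have "bounded (range (\<lambda>x. \<phi> (f x)))"
    using assms(1) by (intro compact_imp_bounded compact_continuous_image)
  ultimately have "(\<lambda>x. \<phi> (f x)) \<in> bcontfun"
    by (simp add: bcontfun_def)
  then show ?thesis
    by (simp add: bcomp_def Bcontfun_inverse)
qed

text \<open>
  Smoothness on an arbitrary subset \<open>T\<close> of the line: \<open>\<phi>\<close> agrees on \<open>T\<close> with an infinitely
  differentiable function on an open neighbourhood of \<open>T\<close>; \<open>d n\<close> is its \<open>n\<close>-th derivative.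
\<close>
definition smooth_on :: "real set \<Rightarrow> (real \<Rightarrow> real) \<Rightarrow> bool"
  where "smooth_on T \<phi> \<longleftrightarrow>
    (\<exists>U d. open U \<and> T \<subseteq> U \<and> (\<forall>x\<in>T. d 0 x = \<phi> x) \<and>
       (\<forall>n::nat. \<forall>x\<in>U. (d n has_real_derivative d (Suc n) x) (at x)))"

section \<open>Markov processes, semigroups and generators\<close>

definition cadlag :: "(real \<Rightarrow> 'a::topological_space) \<Rightarrow> bool"
  where "cadlag p \<longleftrightarrow>
    (\<forall>t\<ge>0. (p \<longlongrightarrow> p t) (at_right t)) \<and> (\<forall>t>0. \<exists>l. (p \<longlongrightarrow> l) (at_left t))"

definition natural_filtration ::
    "'w measure \<Rightarrow> (real \<Rightarrow> 'w \<Rightarrow> 'a::topological_space) \<Rightarrow> real \<Rightarrow> 'w measure"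
  where "natural_filtration M X s =
    sigma (space M) {X r -` B \<inter> space M | r B. 0 \<le> r \<and> r \<le> s \<and> B \<in> sets borel}"

text \<open>
  A time-homogeneous Markov process with cadlag paths: \<open>P x\<close> is the law under which the process
  starts at \<open>x\<close>, and \<open>distr (P x) borel (X t)\<close> is the transition probability \<open>p\<^sub>t(x, \<cdot>)\<close>.
\<close>
definition markov_process ::
    "'w measure \<Rightarrow> ('a::metric_space \<Rightarrow> 'w measure) \<Rightarrow> (real \<Rightarrow> 'w \<Rightarrow> 'a) \<Rightarrow> bool"
  where "markov_process M P X \<longleftrightarrow>
    (\<forall>x. P x \<in> space (prob_algebra M)) \<and>
    (\<forall>t\<ge>0. X t \<in> M \<rightarrow>\<^sub>M borel) \<and>
    (\<forall>\<omega>\<in>space M. cadlag (\<lambda>t. X t \<omega>)) \<and>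
    (\<forall>x. AE \<omega> in P x. X 0 \<omega> = x) \<and>
    (\<forall>t\<ge>0. (\<lambda>x. distr (P x) borel (X t)) \<in> borel \<rightarrow>\<^sub>M prob_algebra borel) \<and>
    (\<forall>x. \<forall>s\<ge>0. \<forall>t\<ge>0. \<forall>B\<in>sets borel. AE \<omega> in P x.
       real_cond_exp (P x) (natural_filtration M X s)
         (indicator (X (s + t) -` B \<inter> space M)) \<omega>
       = measure (distr (P (X s \<omega>)) borel (X t)) B)"

text \<open>The process induces \<open>S\<close>; in particular the integrals on the right belong to \<open>C(E)\<close>.\<close>
definition transition_semigroup ::
    "('a::metric_space \<Rightarrow> 'w measure) \<Rightarrow> (real \<Rightarrow> 'w \<Rightarrow> 'a)
      \<Rightarrow> (real \<Rightarrow> ('a \<Rightarrow>\<^sub>C real) \<Rightarrow> ('a \<Rightarrow>\<^sub>C real)) \<Rightarrow> bool"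
  where "transition_semigroup P X S \<longleftrightarrow>
    (\<forall>t\<ge>0. \<forall>f x. S t f x = (\<integral>\<omega>. f (X t \<omega>) \<partial>P x))"

definition strongly_continuous_semigroup ::
    "(real \<Rightarrow> 'b::real_normed_vector \<Rightarrow> 'b) \<Rightarrow> bool"
  where "strongly_continuous_semigroup S \<longleftrightarrow>
    (\<forall>t\<ge>0. bounded_linear (S t)) \<and> (\<forall>f. S 0 f = f) \<and>
    (\<forall>s\<ge>0. \<forall>t\<ge>0. \<forall>f. S (s + t) f = S s (S t f)) \<and>
    (\<forall>f. ((\<lambda>t. S t f) \<longlongrightarrow> f) (at_right 0))"

definition generator_domain :: "(real \<Rightarrow> 'b::real_normed_vector \<Rightarrow> 'b) \<Rightarrow> 'b set"
  where "generator_domain S = {f. \<exists>g. ((\<lambda>t. (S t f - f) /\<^sub>R t) \<longlongrightarrow> g) (at_right 0)}"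

definition generator :: "(real \<Rightarrow> 'b::real_normed_vector \<Rightarrow> 'b) \<Rightarrow> 'b \<Rightarrow> 'b"
  where "generator S f = Lim (at_right 0) (\<lambda>t. (S t f - f) /\<^sub>R t)"

text \<open>\<open>Hf = e\<^sup>-\<^sup>f A e\<^sup>f\<close>\<close>
definition hamiltonian ::
    "(real \<Rightarrow> ('a::topological_space \<Rightarrow>\<^sub>C real) \<Rightarrow> ('a \<Rightarrow>\<^sub>C real))
      \<Rightarrow> ('a \<Rightarrow>\<^sub>C real) \<Rightarrow> ('a \<Rightarrow>\<^sub>C real)"
  where "hamiltonian S f = bmult (bcomp exp (- f)) (generator S (bcomp exp f))"

text \<open>\<open>V(t)h = log S(t)e\<^sup>h\<close>\<close>
definition log_semigroup ::
    "(real \<Rightarrow> ('a::topological_space \<Rightarrow>\<^sub>C real) \<Rightarrow> ('a \<Rightarrow>\<^sub>C real))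
      \<Rightarrow> real \<Rightarrow> ('a \<Rightarrow>\<^sub>C real) \<Rightarrow> ('a \<Rightarrow>\<^sub>C real)"
  where "log_semigroup S t h = bcomp ln (S t (bcomp exp h))"

section \<open>Barrelled locally convex spaces\<close>

text \<open>
  A vector space topology here lives on a linear subspace \<open>D = topspace \<tau>\<close> of the ambient type
  and is unrelated to the topology of that type.
\<close>
definition locally_convex_space :: "'b::real_vector set \<Rightarrow> 'b topology \<Rightarrow> bool"
  where "locally_convex_space D \<tau> \<longleftrightarrow>
    subspace D \<and> topspace \<tau> = D \<and>
    continuous_map (prod_topology \<tau> \<tau>) \<tau> (\<lambda>(f, g). f + g) \<and>
    continuous_map (prod_topology euclideanreal \<tau>) \<tau> (\<lambda>(c, f). c *\<^sub>R f) \<and>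
    (\<forall>U. openin \<tau> U \<and> 0 \<in> U \<longrightarrow> (\<exists>W. openin \<tau> W \<and> 0 \<in> W \<and> convex W \<and> W \<subseteq> U))"

definition barrel :: "'b::real_vector set \<Rightarrow> 'b topology \<Rightarrow> 'b set \<Rightarrow> bool"
  where "barrel D \<tau> N \<longleftrightarrow>
    closedin \<tau> N \<and> convex N \<and>
    (\<forall>c f. \<bar>c\<bar> \<le> 1 \<and> f \<in> N \<longrightarrow> c *\<^sub>R f \<in> N) \<and>
    (\<forall>f\<in>D. \<exists>r>0. \<forall>c. \<bar>c\<bar> \<le> r \<longrightarrow> c *\<^sub>R f \<in> N)"

definition barrelled_space :: "'b::real_vector set \<Rightarrow> 'b topology \<Rightarrow> bool"
  where "barrelled_space D \<tau> \<longleftrightarrow>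
    (\<forall>N. barrel D \<tau> N \<longrightarrow> (\<exists>U. openin \<tau> U \<and> 0 \<in> U \<and> U \<subseteq> N))"

text \<open>
  Elements of the dual are functions on the whole type made unique by the convention
  \<open>extensional\<close>; only their values on \<open>D\<close> carry information.
\<close>
definition dual_space :: "'b::real_vector set \<Rightarrow> 'b topology \<Rightarrow> ('b \<Rightarrow> real) set"
  where "dual_space D \<tau> = {u \<in> extensional D.
    (\<forall>f\<in>D. \<forall>g\<in>D. u (f + g) = u f + u g) \<and>
    (\<forall>c. \<forall>f\<in>D. u (c *\<^sub>R f) = c * u f) \<and>
    continuous_map \<tau> euclideanreal u}"

section \<open>The core conditions\<close>

definition core_conditions ::
    "(real \<Rightarrow> ('a::topological_space \<Rightarrow>\<^sub>C real) \<Rightarrow> ('a \<Rightarrow>\<^sub>C real))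
      \<Rightarrow> ('a \<Rightarrow>\<^sub>C real) set \<Rightarrow> ('a \<Rightarrow>\<^sub>C real) topology \<Rightarrow> bool"
  where "core_conditions S D \<tau> \<longleftrightarrow>
    D \<subseteq> generator_domain S \<and>
    closure D = UNIV \<and>
    (\<forall>f\<in>generator_domain S. \<exists>F. (\<forall>n. F n \<in> D) \<and> F \<longlonglongrightarrow> f \<and>
       (\<lambda>n. generator S (F n)) \<longlonglongrightarrow> generator S f) \<and>
    (\<forall>f\<in>D. \<forall>g\<in>D. bmult f g \<in> D) \<and>
    (\<forall>f\<in>D. \<forall>\<phi>. smooth_on (range (apply_bcontfun f)) \<phi> \<longrightarrow> bcomp \<phi> f \<in> D) \<and>
    locally_convex_space D \<tau> \<and> Hausdorff_space \<tau> \<and> separable_space \<tau> \<and> barrelled_space D \<tau> \<and>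
    (\<forall>U. openin (top_of_set D) U \<longrightarrow> openin \<tau> U) \<and>
    (\<forall>a b \<phi>. a \<le> 0 \<and> 0 \<le> b \<and> smooth_on {a..b} \<phi> \<and> \<phi> 0 = 0 \<longrightarrow>
       continuous_map (subtopology \<tau> {f \<in> D. range (apply_bcontfun f) \<subseteq> {a..b}}) \<tau> (bcomp \<phi>)) \<and>
    continuous_map \<tau> euclidean (generator S) \<and>
    (\<exists>N. barrel D \<tau> N \<and>
       (\<forall>c>0. bdd_above ((\<lambda>f. norm (hamiltonian S f)) ` ((\<lambda>f. c *\<^sub>R f) ` N))))"

section \<open>Paths of measures and the variational semigroup\<close>

definition weak_topology :: "'a::topological_space measure topology"
  where "weak_topology = topology_generated_by
    {{\<mu> \<in> space (prob_algebra borel). (\<integral>x. f x \<partial>\<mu>) \<in> U} | (f :: 'a \<Rightarrow>\<^sub>C real) U. open U}"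

text \<open>The supremum is nonnegative when \<open>S\<close> and \<open>D\<close> are as in the theorem, since \<open>H0 = 0\<close>.\<close>
definition lagrangian ::
    "(real \<Rightarrow> ('a::topological_space \<Rightarrow>\<^sub>C real) \<Rightarrow> ('a \<Rightarrow>\<^sub>C real)) \<Rightarrow> ('a \<Rightarrow>\<^sub>C real) set
      \<Rightarrow> 'a measure \<Rightarrow> (('a \<Rightarrow>\<^sub>C real) \<Rightarrow> real) \<Rightarrow> ereal"
  where "lagrangian S D \<mu> u = (SUP f\<in>D. ereal (u f - (\<integral>x. hamiltonian S f x \<partial>\<mu>)))"

text \<open>
  \<open>u\<close> is a derivative of the path \<open>\<nu>\<close>. Weak* measurability means Borel measurability of all the
  pairings \<open>s \<mapsto> \<langle>f, u(s)\<rangle>\<close>, \<open>f \<in> D\<close>.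
\<close>
definition has_path_derivative ::
    "('a::topological_space \<Rightarrow>\<^sub>C real) set \<Rightarrow> ('a \<Rightarrow>\<^sub>C real) topology \<Rightarrow> (real \<Rightarrow> 'a measure)
      \<Rightarrow> (real \<Rightarrow> ('a \<Rightarrow>\<^sub>C real) \<Rightarrow> real) \<Rightarrow> bool"
  where "has_path_derivative D \<tau> \<nu> u \<longleftrightarrow>
    (\<forall>s\<ge>0. u s \<in> dual_space D \<tau>) \<and>
    (\<forall>f\<in>D. (\<lambda>s. u s f) \<in> borel_measurable (restrict_space borel {0..})) \<and>
    (\<forall>f\<in>D. \<forall>t\<ge>0.
       (\<integral>\<^sup>+s\<in>{0..t}. ennreal \<bar>u s f\<bar> \<partial>lborel) < \<infinity> \<and>
       (\<integral>x. f x \<partial>\<nu> t) - (\<integral>x. f x \<partial>\<nu> 0) = (LINT s:{0..t}|lborel. u s f))"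

definition AC_paths ::
    "('a::topological_space \<Rightarrow>\<^sub>C real) set \<Rightarrow> ('a \<Rightarrow>\<^sub>C real) topology \<Rightarrow> 'a measure
      \<Rightarrow> (real \<Rightarrow> 'a measure) set"
  where "AC_paths D \<tau> \<mu> = {\<nu>. continuous_map (top_of_set {0..}) weak_topology \<nu> \<and> \<nu> 0 = \<mu> \<and>
    (\<exists>u. has_path_derivative D \<tau> \<nu> u)}"

text \<open>
  If \<open>\<tau>\<close> is separable, then the derivative is unique up to a Lebesgue null set of times, so the
  choice does not affect integrals over time.
\<close>
definition path_derivative ::
    "('a::topological_space \<Rightarrow>\<^sub>C real) set \<Rightarrow> ('a \<Rightarrow>\<^sub>C real) topology \<Rightarrow> (real \<Rightarrow> 'a measure)
      \<Rightarrow> real \<Rightarrow> ('a \<Rightarrow>\<^sub>C real) \<Rightarrow> real"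
  where "path_derivative D \<tau> \<nu> = (SOME u. has_path_derivative D \<tau> \<nu> u)"

definition variational_semigroup ::
    "(real \<Rightarrow> ('a::topological_space \<Rightarrow>\<^sub>C real) \<Rightarrow> ('a \<Rightarrow>\<^sub>C real)) \<Rightarrow> ('a \<Rightarrow>\<^sub>C real) set
      \<Rightarrow> ('a \<Rightarrow>\<^sub>C real) topology \<Rightarrow> real \<Rightarrow> ('a measure \<Rightarrow> real) \<Rightarrow> 'a measure \<Rightarrow> ereal"
  where "variational_semigroup S D \<tau> t G \<mu> =
    (SUP \<nu>\<in>AC_paths D \<tau> \<mu>. ereal (G (\<nu> t)) -
       enn2ereal (\<integral>\<^sup>+s\<in>{0..t}. e2ennreal (lagrangian S D (\<nu> s) (path_derivative D \<tau> \<nu> s)) \<partial>lborel))"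

end

theory Submission
  imports Defs
begin

text \<open>
  It suffices to find, for every \<open>\<epsilon> > 0\<close>, one path \<open>\<nu>\<close> that is optimal up to \<open>\<epsilon>\<close>. Formally this is the
  Doob transform of the process by \<open>G\<^sub>s = S(t-s)e\<^sup>h\<close>, whose control is \<open>ln G\<^sub>s\<close>; but \<open>ln G\<^sub>s\<close> need not
  lie in \<open>D\<close>. So \<open>G\<close> is replaced by a finite combination of elements of \<open>D\<close> with differentiable
  coefficients, a supersolution with \<open>0 \<le> -(AG + G') \<le> \<beta> G\<close> and small \<open>\<beta>\<close>. With
  \<open>B = -(AG + G')/G\<close>, let \<open>\<Lambda>\<^sub>s\<close> be the evolution of functionals generated by \<open>A + B\<close> from
  \<open>\<Lambda>\<^sub>0 v = \<integral> v/G\<^sub>0 d\<mu>\<close>. Then \<open>\<nu>\<^sub>s(v) = \<Lambda>\<^sub>s(G\<^sub>s v)\<close> is a path of probability measures with derivative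
  \<open>f \<mapsto> \<Lambda>\<^sub>s(A(G\<^sub>s f) - f AG\<^sub>s)\<close>, and the positive minimum principle bounds its Lagrangian by
  \<open>\<Lambda>\<^sub>s(A(G\<^sub>s ln G\<^sub>s) - ln G\<^sub>s AG\<^sub>s - AG\<^sub>s)\<close>, which up to \<open>\<beta>\<close> is the time derivative of
  \<open>\<langle>ln G\<^sub>s, \<nu>\<^sub>s\<rangle>\<close>.
\<close>

text \<open>The potential B is dictated by mass: along the perturbed evolution the derivative of
  \<Lambda>_s(G_s) is \<Lambda>_s(AG + G' + BG), which vanishes exactly for this choice. Its sign
  keeps \<Lambda> positive and comes cheaply: if H >= c0 > 0 solves AH + H' = 0 up to an error
  \<delta>, then G_s = exp(-\<theta> s) H_s with \<theta> = \<delta> / c0 is a supersolution with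
  \<beta> = 2 \<theta>. Combinations of finitely many fixed elements of D are used because every
  continuity in time, in particular that of A(G_s f) and of A(G_s ln G_s), then reduces to scalar
  coefficients and to continuity in the topology of D. The evolution acts on functionals on all of
  C(E): B is bounded there, so a Dyson series around S suffices and no evolution family with a
  time-dependent generator on D has to be built. Positivity together with domination by the law of
  the original process turns the functionals back into measures. Since a generator is a limit from
  the right, all differentiation of orbits in time is one-sided.\<close>

section \<open>Calculus and approximation\<close>

text \<open>Continuous induction: for every e > 0, the set of times up to which the increment from
  \<open>a\<close> grows at most with slope e is closed and can be prolonged to the right. This
  replaces the mean value theorem, which asks for a two-sided derivative.\<close>

lemma right_derivative_zero_imp_eq:
  fixes H :: "real \<Rightarrow> 'b::real_normed_vector"
  assumes "a \<le> b" and cont: "continuous_on {a..b} H"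
    and deriv: "\<And>s. a \<le> s \<Longrightarrow> s < b \<Longrightarrow> (H has_vector_derivative 0) (at s within {s..b})"
  shows "H b = H a"
proof -
  have bound: "norm (H b - H a) \<le> e * (b - a)" if "e > 0" for e :: real
  proof -
    define K where "K = {r \<in> {a..b}. norm (H r - H a) \<le> e * (r - a)}"
    have "closed K"
      unfolding K_def by (intro continuous_on_closed_Collect_le continuous_intros cont)
    define A where "A = {s \<in> {a..b}. {a..s} \<subseteq> K}"
    define c where "c = Sup A"
    have "a \<in> A" using \<open>a \<le> b\<close> by (auto simp: A_def K_def)
    have bdd: "bdd_above A" by (auto simp: A_def intro!: bdd_aboveI[of _ b])
    have ac: "a \<le> c" using \<open>a \<in> A\<close> bdd by (simp add: c_def cSup_upper)
    have cb: "c \<le> b" unfolding c_def using \<open>a \<in> A\<close> by (intro cSup_least) (auto simp: A_def)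
    have below: "{a..<c} \<subseteq> K"
    proof
      fix r assume r: "r \<in> {a..<c}"
      then obtain s where "s \<in> A" "r < s"
        using less_cSup_iff[OF _ bdd, of r] \<open>a \<in> A\<close> by (auto simp: c_def)
      then show "r \<in> K" using r by (auto simp: A_def)
    qed
    have "{a..c} \<subseteq> K"
    proof (cases "a = c")
      case True then show ?thesis using \<open>a \<in> A\<close> by (auto simp: A_def)
    next
      case False
      then have "closure {a..<c} = {a..c}" using ac by (intro closure_atLeastLessThan) auto
      then show ?thesis using closure_minimal[OF below \<open>closed K\<close>] by simp
    qed
    have "c = b"
    proof (rule ccontr)
      assume "c \<noteq> b"
      then have "c < b" using cb by simp
      \<comment> \<open>The vanishing right derivative at \<open>c\<close> gives slope at most
        \<open>e\<close> a little beyond \<open>c\<close>, against the choice of \<open>c\<close> as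
        supremum.\<close>
      from deriv[OF ac this] obtain d where d: "d > 0"
        "\<And>y. y \<in> {c..b} \<Longrightarrow> norm (y - c) < d \<Longrightarrow> norm (H y - H c) \<le> e * norm (y - c)"
        using \<open>e > 0\<close> unfolding has_vector_derivative_def has_derivative_within_alt by auto
      define c' where "c' = min b (c + d / 2)"
      have c': "c < c'" "c' \<le> b" "c' < c + d" using \<open>c < b\<close> d(1) by (auto simp: c'_def)
      have "c' \<in> A"
      proof -
        have "r \<in> K" if r: "r \<in> {a..c'}" for r
        proof (cases "r \<le> c")
          case True then show ?thesis using \<open>{a..c} \<subseteq> K\<close> r by auto
        next
          case False
          have "norm (H r - H c) \<le> e * (r - c)" using d(2)[of r] False r c' by auto
          moreover have "norm (H c - H a) \<le> e * (c - a)" using \<open>{a..c} \<subseteq> K\<close> ac by (auto simp: K_def)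
          moreover have "norm (H r - H a) \<le> norm (H r - H c) + norm (H c - H a)"
            using norm_triangle_ineq[of "H r - H c" "H c - H a"] by simp
          ultimately show ?thesis using r c' False by (auto simp: K_def algebra_simps)
        qed
        then show ?thesis using c' ac by (auto simp: A_def)
      qed
      then have "c' \<le> c" using bdd by (simp add: c_def cSup_upper)
      then show False using c' by simp
    qed
    then show ?thesis using \<open>{a..c} \<subseteq> K\<close> \<open>a \<le> b\<close> by (auto simp: K_def)
  qed
  have "norm (H b - H a) \<le> 0 + d" if "d > 0" for d
  proof -
    \<comment> \<open>The summand 1 keeps the divisor positive when \<open>a = b\<close>.\<close>
    have "norm (H b - H a) \<le> (d / (b - a + 1)) * (b - a)"
      using bound[of "d / (b - a + 1)"] \<open>d > 0\<close> \<open>a \<le> b\<close> by simp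
    also have "\<dots> \<le> d" using \<open>d > 0\<close> \<open>a \<le> b\<close> by (simp add: field_simps)
    finally show ?thesis by simp
  qed
  then have "norm (H b - H a) \<le> 0" by (rule field_le_epsilon)
  then show ?thesis by simp
qed

lemma right_derivative_integral:
  fixes F \<phi> :: "real \<Rightarrow> 'b::banach"
  assumes "a \<le> b" and "continuous_on {a..b} F" and \<phi>: "continuous_on {a..b} \<phi>"
    and deriv: "\<And>s. a \<le> s \<Longrightarrow> s < b \<Longrightarrow> (F has_vector_derivative \<phi> s) (at s within {s..b})"
  shows "F b - F a = integral {a..b} \<phi>"
proof -
  define H where "H s = F s - integral {a..s} \<phi>" for s
  have "H b = H a"
  proof (rule right_derivative_zero_imp_eq[OF \<open>a \<le> b\<close>])
    show "continuous_on {a..b} H" unfolding H_def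
      by (intro continuous_intros assms indefinite_integral_continuous_1 integrable_continuous_real)
    fix s assume s: "a \<le> s" "s < b"
    have "((\<lambda>u. integral {a..u} \<phi>) has_vector_derivative \<phi> s) (at s within {s..b})"
      by (rule has_vector_derivative_within_subset[OF integral_has_vector_derivative[OF \<phi>]])
        (use s in auto)
    from has_vector_derivative_diff[OF deriv[OF s] this]
    show "(H has_vector_derivative 0) (at s within {s..b})" by (simp add: H_def[abs_def])
  qed
  then show ?thesis by (simp add: H_def algebra_simps)
qed

text \<open>Bernstein's probabilistic proof: the weights are a binomial law with mean x and variance
  x(1-x)/N, so nodes near x are handled by uniform continuity and distant ones by Chebyshev's
  inequality. Vector values allow approximating a curve in C(E) together with its image under the
  generator.\<close>

lemma Bernstein_uniform_approximation:
  fixes y :: "real \<Rightarrow> 'b::real_normed_vector"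
  assumes cont: "continuous_on {0..1} y" and "0 < e"
  shows "\<exists>N. 0 < N \<and> (\<forall>x\<in>{0..1}. norm (y x - (\<Sum>k\<le>N. Bernstein N k x *\<^sub>R y (k / N))) < e)"
proof -
  have "compact (y ` {0..1})" by (intro compact_continuous_image cont) auto
  then obtain M where M: "\<And>x. x \<in> {0..1} \<Longrightarrow> norm (y x) \<le> M" "M > 0"
    by (metis bounded_pos compact_imp_bounded imageI)
  have "uniformly_continuous_on {0..1} y"
    by (intro compact_uniformly_continuous cont) auto
  then obtain d where d: "d > 0"
    "\<And>x x'. x \<in> {0..1} \<Longrightarrow> x' \<in> {0..1} \<Longrightarrow> dist x' x < d \<Longrightarrow> dist (y x') (y x) < e / 2"
    unfolding uniformly_continuous_on_def using \<open>e > 0\<close> by (metis half_gt_zero)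
  obtain N :: nat where N: "real N > 4 * M / (d\<^sup>2 * e)" using reals_Archimedean2 by blast
  have "4 * M / (d\<^sup>2 * e) > 0" using M d \<open>e > 0\<close> by simp
  with N have "N > 0" by (metis of_nat_0_less_iff order.strict_trans)
  have "norm (y x - (\<Sum>k\<le>N. Bernstein N k x *\<^sub>R y (k / N))) < e" if x: "x \<in> {0..1}" for x
  proof -
    have variance: "(\<Sum>k\<le>N. Bernstein N k x * (x - k / N)\<^sup>2) = x * (1 - x) / N"
    proof -
      define i where "i = 1 / real N"
      have i: "real N * i = 1" "real k / N = k * i" "z / N = z * i" for k z
        using \<open>N > 0\<close> by (simp_all add: i_def)
      have eq: "Bernstein N k x * (x - k / N)\<^sup>2 = x\<^sup>2 * Bernstein N k x
          + (i - 2 * x) * i * (k * Bernstein N k x)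
          + i\<^sup>2 * (real k * (real k - 1) * Bernstein N k x)" for k
        unfolding i(2) by algebra
      have "(\<Sum>k\<le>N. Bernstein N k x * (x - k / N)\<^sup>2)
          = x\<^sup>2 + (i - 2 * x) * i * (N * x) + i\<^sup>2 * (real N * (real N - 1) * x\<^sup>2)"
        unfolding eq sum.distrib sum_distrib_left[symmetric] by simp
      also have "\<dots> = x * (1 - x) / N" unfolding i(3) using i(1) by algebra
      finally show ?thesis .
    qed
    \<comment> \<open>For a node at distance at least \<open>d\<close> the quadratic term alone
      exceeds \<open>2 * M\<close>, the trivial bound; averaging it produces the variance.\<close>
    have each: "norm (y x - y (k / N)) \<le> e / 2 + 2 * M / d\<^sup>2 * (x - k / N)\<^sup>2" if "k \<le> N" for k
    proof -
      have kN: "k / N \<in> {0..1}" using that \<open>N > 0\<close> by auto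
      show ?thesis
      proof (cases "\<bar>x - k / N\<bar> < d")
        case True
        then have "norm (y x - y (k / N)) < e / 2"
          using d(2)[OF kN x] by (simp add: dist_norm)
        moreover have "0 \<le> 2 * M / d\<^sup>2 * (x - k / N)\<^sup>2" using M(2) by simp
        ultimately show ?thesis by linarith
      next
        case False
        then have "d\<^sup>2 \<le> (x - k / N)\<^sup>2" using d(1) by (simp add: power2_le_iff_abs_le abs_le_square_iff[symmetric])
        then have "2 * M \<le> 2 * M / d\<^sup>2 * (x - k / N)\<^sup>2" using M(2) d(1) by (simp add: field_simps)
        moreover have "norm (y x - y (k / N)) \<le> M + M"
          using norm_triangle_ineq4[of "y x" "y (k/N)"] M(1)[OF x] M(1)[OF kN] by linarith
        ultimately show ?thesis using \<open>e > 0\<close> by simp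
      qed
    qed
    have "y x - (\<Sum>k\<le>N. Bernstein N k x *\<^sub>R y (k / N)) = (\<Sum>k\<le>N. Bernstein N k x *\<^sub>R (y x - y (k / N)))"
      by (simp add: scaleR_diff_right sum_subtractf scaleR_left.sum[symmetric])
    also have "norm \<dots> \<le> (\<Sum>k\<le>N. Bernstein N k x * (e / 2 + 2 * M / d\<^sup>2 * (x - k / N)\<^sup>2))"
      by (rule sum_norm_le) (use each x in \<open>auto simp: Bernstein_nonneg intro!: mult_left_mono\<close>)
    also have "\<dots> = (e / 2) * (\<Sum>k\<le>N. Bernstein N k x)
        + 2 * M / d\<^sup>2 * (\<Sum>k\<le>N. Bernstein N k x * (x - k / N)\<^sup>2)"
      by (simp only: sum_distrib_left sum.distrib[symmetric] distrib_left mult.left_commute[of "2 * M / d\<^sup>2"] mult.commute[of _ "e / 2"])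
    also have "\<dots> = e / 2 + 2 * M / d\<^sup>2 * (x * (1 - x) / N)" by (simp only: variance sum_Bernstein mult_1_right)
    also have "\<dots> \<le> e / 2 + 2 * M / d\<^sup>2 * (1 / N)"
      using x M(2) by (intro add_left_mono mult_left_mono divide_right_mono mult_le_one) auto
    also have "2 * M / d\<^sup>2 * (1 / N) < e / 2"
    proof -
      have "4 * M < N * (d\<^sup>2 * e)" using N d(1) \<open>e > 0\<close> by (simp add: pos_divide_less_eq)
      moreover have "0 < d\<^sup>2 * N" using d(1) \<open>N > 0\<close> by simp
      ultimately show ?thesis by (simp add: pos_divide_less_eq mult.commute mult.left_commute)
    qed
    finally show ?thesis by simp
  qed
  with \<open>N > 0\<close> show ?thesis by blast
qed

text \<open>Split \<Lambda>_q(w_q) as \<Lambda>_q(w_q - w_p) + \<Lambda>_q(w_p): the common bound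
  \<open>K\<close> controls the first summand, and continuity for a fixed argument controls the
  second.\<close>

lemma continuous_on_pairing:
  fixes \<Lambda> :: "'i::metric_space \<Rightarrow> 'b::real_normed_vector \<Rightarrow> real"
  assumes add: "\<And>q v w. q \<in> I \<Longrightarrow> \<Lambda> q (v - w) = \<Lambda> q v - \<Lambda> q w"
    and bound: "\<And>q v. q \<in> I \<Longrightarrow> \<bar>\<Lambda> q v\<bar> \<le> K * norm v"
    and cont: "\<And>v. continuous_on I (\<lambda>q. \<Lambda> q v)"
    and w: "continuous_on I w"
  shows "continuous_on I (\<lambda>q. \<Lambda> q (w q))"
  unfolding continuous_on_def
proof
  fix p assume p: "p \<in> I"
  have 1: "((\<lambda>q. K * norm (w q - w p)) \<longlongrightarrow> 0) (at p within I)"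
    using w p unfolding continuous_on_def by (auto intro!: tendsto_eq_intros)
  have "((\<lambda>q. \<Lambda> q (w q - w p)) \<longlongrightarrow> 0) (at p within I)"
    by (rule Lim_null_comparison[OF _ 1])
      (auto simp: eventually_at_filter bound)
  moreover have "((\<lambda>q. \<Lambda> q (w p)) \<longlongrightarrow> \<Lambda> p (w p)) (at p within I)"
    using cont p by (auto simp: continuous_on_def)
  ultimately have "((\<lambda>q. \<Lambda> q (w q - w p) + \<Lambda> q (w p)) \<longlongrightarrow> 0 + \<Lambda> p (w p)) (at p within I)"
    by (rule tendsto_add)
  moreover have "\<forall>\<^sub>F q in at p within I. \<Lambda> q (w q - w p) + \<Lambda> q (w p) = \<Lambda> q (w q)"
    by (auto simp: eventually_at_filter add)
  ultimately show "((\<lambda>q. \<Lambda> q (w q)) \<longlongrightarrow> \<Lambda> p (w p)) (at p within I)"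
    by (simp add: Lim_transform_eventually)
qed

text \<open>Half-lines form an intersection-stable generator, so by Dynkin's argument the difference
  integrates to zero over every Borel set and is a vanishing density.\<close>

lemma AE_eq_of_integrals_eq:
  fixes f g :: "real \<Rightarrow> real"
  assumes f: "set_integrable lborel {0..t} f" and g: "set_integrable lborel {0..t} g"
    and eq: "\<And>s. 0 \<le> s \<Longrightarrow> s \<le> t \<Longrightarrow> (LINT q:{0..s}|lborel. f q) = (LINT q:{0..s}|lborel. g q)"
  shows "AE q in lborel. q \<in> {0..t} \<longrightarrow> f q = g q"
proof -
  \<comment> \<open>The cut-off makes the difference integrable on the whole line, so that
    complements in the Dynkin argument have finite integrals.\<close>
  define w where "w q = indicator {0..t} q * (f q - g q)" for q
  have int: "integrable lborel w"
    using set_integral_diff(1)[OF f g] by (simp add: w_def[abs_def] set_integrable_def)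
  have below: "(LINT q:{..a}|lborel. w q) = 0" for a
  proof (cases "0 \<le> a \<and> 0 \<le> t")
    case True
    define s where "s = min a t"
    have s: "0 \<le> s" "s \<le> t" using True by (auto simp: s_def)
    have sub: "set_integrable lborel {0..s} f" "set_integrable lborel {0..s} g"
      by (rule set_integrable_subset[OF f] set_integrable_subset[OF g]; use s in simp)+
    have "(LINT q:{..a}|lborel. w q) = (LINT q:{0..s}|lborel. f q - g q)"
      unfolding set_lebesgue_integral_def w_def s_def
      by (intro Bochner_Integration.integral_cong) (auto simp: indicator_def)
    then show ?thesis using set_integral_diff(2)[OF sub] eq[OF s] by simp
  next
    case False
    then have "(\<lambda>q. indicator {..a} q *\<^sub>R w q) = (\<lambda>q. 0)"
      by (auto simp: w_def indicator_def fun_eq_iff)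
    then show ?thesis by (simp add: set_lebesgue_integral_def)
  qed
  have w_sub: "set_integrable lborel A w" if "A \<in> sets lborel" for A
    using integrable_mult_indicator[OF that int] by (simp add: set_integrable_def)
  have total: "(LINT q:UNIV|lborel. w q) = 0"
  proof -
    have "(LINT q:UNIV|lborel. w q) = (LINT q:{..t}|lborel. w q)"
      unfolding set_lebesgue_integral_def w_def
      by (intro Bochner_Integration.integral_cong) (auto simp: indicator_def)
    then show ?thesis using below by simp
  qed
  have zero: "(LINT q:A|lborel. w q) = 0" if "A \<in> sets lborel" for A
  proof -
    have Int: "Int_stable (range (\<lambda>a::real. {..a}))"
      by (auto simp: Int_stable_def)
    have Pow: "range (\<lambda>a::real. {..a}) \<subseteq> Pow UNIV" by simp
    have "A \<in> sigma_sets UNIV (range (\<lambda>a::real. {..a}))"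
      using that by (simp add: borel_eq_atMost)
    with Int Pow show ?thesis
    proof (induction rule: sigma_sets_induct_disjoint)
      case (basic A) then show ?case using below by auto
    next
      case empty show ?case by (simp add: set_lebesgue_integral_def)
    next
      case (compl A)
      then have A: "A \<in> sets lborel" by (simp add: borel_eq_atMost)
      have "(LINT q:A \<union> (UNIV - A)|lborel. w q) = (LINT q:A|lborel. w q) + (LINT q:UNIV - A|lborel. w q)"
        using A by (intro set_integral_Un w_sub) auto
      then show ?case using total compl.IH by (simp add: Un_absorb1)
    next
      case (union A)
      then have A: "A i \<in> sets lborel" for i by (auto simp: borel_eq_atMost)
      have "(LINT q:(\<Union>i. A i)|lborel. w q) = (\<Sum>i. LINT q:A i|lborel. w q)"
        using A union(1) by (intro lebesgue_integral_countable_add w_sub) (auto simp: disjoint_family_on_def)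
      then show ?case using union by simp
    qed
  qed
  have "AE q in lborel. w q = 0"
    by (rule density_unique_real[OF int integrable_zero])
      (simp only: zero, simp add: set_lebesgue_integral_def)
  then show ?thesis by eventually_elim (auto simp: w_def)
qed

section \<open>Functionals dominated by a measure\<close>

type_synonym 'a cfun = "'a \<Rightarrow>\<^sub>C real"

lemma bcontfun_of_continuous_bounded:
  fixes f :: "'a::topological_space \<Rightarrow> real"
  assumes "continuous_on UNIV f" "\<And>x. \<bar>f x\<bar> \<le> b"
  obtains v :: "'a cfun" where "\<And>x. v x = f x"
  using bcontfunE[OF bcontfun_normI[OF assms(1), of b]] assms(2) by (metis real_norm_def)

lemma borel_measurable_bcontfun [measurable]:
  fixes v :: "'a::topological_space \<Rightarrow>\<^sub>C real"
  shows "apply_bcontfun v \<in> borel_measurable borel"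
  by (intro borel_measurable_continuous_onI) simp

lemma integrable_bcontfun:
  fixes v :: "'a::topological_space \<Rightarrow>\<^sub>C real"
  assumes "finite_measure m" "sets m = sets borel"
  shows "integrable m v"
proof -
  interpret finite_measure m by fact
  have [measurable_cong]: "sets m = sets borel" by fact
  show ?thesis
    by (rule integrable_const_bound[of _ "norm v"]) (use norm_bounded[of v] in auto)
qed

text \<open>
  A positive functional dominated by integration against \<open>m\<close> is Lipschitz in \<open>L\<^sup>1(m)\<close>, hence
  extends to indicators; this gives the representing measure without the Riesz theorem.
\<close>
locale dominated_functional =
  fixes m :: "'a::metric_space measure" and \<phi> :: "'a cfun \<Rightarrow> real" and C :: real
  assumes finite_m: "finite_measure m" and sets_m [measurable_cong]: "sets m = sets borel"
    and add: "\<And>v w. \<phi> (v + w) = \<phi> v + \<phi> w"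
    and scale: "\<And>c v. \<phi> (c *\<^sub>R v) = c * \<phi> v"
    and pos: "\<And>v :: 'a cfun. (\<forall>x. 0 \<le> apply_bcontfun v x) \<Longrightarrow> 0 \<le> \<phi> v"
    and dom: "\<And>v :: 'a cfun. (\<forall>x. 0 \<le> apply_bcontfun v x) \<Longrightarrow> \<phi> v \<le> C * (\<integral>x. apply_bcontfun v x \<partial>m)"
    and C_nonneg: "0 \<le> C"
begin

interpretation finite_measure m by (rule finite_m)

lemma space_m [simp]: "space m = UNIV"
  using sets_eq_imp_space_eq[OF sets_m] by simp

lemmas int_v [simp, intro] = integrable_bcontfun[OF finite_m sets_m]

lemma diff: "\<phi> (v - w) = \<phi> v - \<phi> w"
  using add[of "v - w" w] by simp

lemma zero: "\<phi> 0 = 0"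
  using scale[of 0 0] by simp

section \<open>Extension of the functional to the closure of C(E) in L^1(m)\<close>

abbreviation l1_dist :: "('a \<Rightarrow> real) \<Rightarrow> ('a \<Rightarrow> real) \<Rightarrow> real"
  where "l1_dist f g \<equiv> (\<integral>x. \<bar>f x - g x\<bar> \<partial>m)"

text \<open>Positivity is applied to |v| - v and |v| + v, domination to |v|.\<close>

lemma abs_bound: "\<bar>\<phi> v\<bar> \<le> C * (\<integral>x. \<bar>v x\<bar> \<partial>m)"
proof -
  obtain w :: "'a cfun" where w: "\<And>x. w x = \<bar>v x\<bar>"
    by (rule bcontfun_of_continuous_bounded[of "\<lambda>x. \<bar>v x\<bar>" "norm v"])
      (use norm_bounded[of v] in \<open>auto intro!: continuous_intros\<close>)
  have "0 \<le> \<phi> (w - v)" by (rule pos) (auto simp: w)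
  moreover have "0 \<le> \<phi> (w + v)" by (rule pos) (auto simp: w abs_if)
  moreover have "\<phi> w \<le> C * (\<integral>x. \<bar>v x\<bar> \<partial>m)" using dom[of w] by (simp add: w)
  ultimately show ?thesis by (simp add: add diff)
qed

text \<open>A relation instead of a limit: \<open>a\<close> is the value at \<open>f\<close> of the
  Lipschitz extension, singled out by its distance to all values on continuous functions. For
  approximable \<open>f\<close> it is unique, by \<open>extends_to_close\<close> with
  \<open>g = f\<close>.\<close>

definition extends_to :: "('a \<Rightarrow> real) \<Rightarrow> real \<Rightarrow> bool"
  where "extends_to f a \<longleftrightarrow> (\<forall>v :: 'a cfun. \<bar>a - \<phi> v\<bar> \<le> C * l1_dist f v)"

definition approximable :: "('a \<Rightarrow> real) \<Rightarrow> bool"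
  where "approximable f \<longleftrightarrow> integrable m f \<and>
    (\<forall>e>0. \<exists>v :: 'a cfun. l1_dist f v < e)"

lemma approximable_bcontfun: "approximable (apply_bcontfun v)"
  by (auto simp: approximable_def intro!: exI[of _ v])

lemma approximable_add:
  assumes "approximable f" "approximable g" shows "approximable (\<lambda>x. f x + g x)"
  unfolding approximable_def
proof safe
  show "integrable m (\<lambda>x. f x + g x)" using assms by (auto simp: approximable_def)
  fix e :: real assume "e > 0"
  then obtain v w :: "'a cfun"
    where vw: "l1_dist f v < e / 2" "l1_dist g w < e / 2"
    using assms unfolding approximable_def by (meson half_gt_zero)
  have "l1_dist (\<lambda>x. f x + g x) ((v + w)) \<le> (\<integral>x. \<bar>f x - v x\<bar> + \<bar>g x - w x\<bar> \<partial>m)"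
    using assms by (intro integral_mono) (auto simp: approximable_def)
  also have "\<dots> < e"
    using vw assms by (subst Bochner_Integration.integral_add) (auto simp: approximable_def)
  finally show "\<exists>v :: 'a cfun. l1_dist (\<lambda>x. f x + g x) v < e" by blast
qed

lemma approximable_scale:
  assumes "approximable f" shows "approximable (\<lambda>x. c * f x)"
  unfolding approximable_def
proof safe
  show "integrable m (\<lambda>x. c * f x)" using assms by (auto simp: approximable_def)
  fix e :: real assume "e > 0"
  then have "e / (\<bar>c\<bar> + 1) > 0" by (simp add: add_nonneg_pos)
  then obtain v :: "'a cfun" where v: "l1_dist f v < e / (\<bar>c\<bar> + 1)"
    using assms unfolding approximable_def by meson
  have "l1_dist (\<lambda>x. c * f x) ((c *\<^sub>R v)) = \<bar>c\<bar> * l1_dist f v"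
    by (simp flip: right_diff_distrib add: abs_mult)
  also have "\<dots> \<le> (\<bar>c\<bar> + 1) * l1_dist f v" by (intro mult_right_mono) auto
  also have "\<dots> < e" using v by (simp add: pos_less_divide_eq add_nonneg_pos mult.commute)
  finally show "\<exists>v :: 'a cfun. l1_dist (\<lambda>x. c * f x) v < e" by blast
qed

lemma approximable_sum:
  assumes "finite I" "\<And>i. i \<in> I \<Longrightarrow> approximable (f i)"
  shows "approximable (\<lambda>x. \<Sum>i\<in>I. f i x)"
  using assms
proof (induction I rule: finite_induct)
  case empty show ?case using approximable_bcontfun[of 0] by (simp add: zero_bcontfun.rep_eq cong: if_cong)
next
  case (insert i I) then show ?case by (simp add: approximable_add)
qed

lemma approximable_limit:
  assumes int: "integrable m f"
    and lim: "\<And>e. e > 0 \<Longrightarrow> \<exists>g. approximable g \<and> l1_dist f g < e"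
  shows "approximable f"
  unfolding approximable_def
proof safe
  show "integrable m f" by fact
  fix e :: real assume "e > 0"
  then obtain g where g: "approximable g" "l1_dist f g < e / 2"
    using lim[of "e / 2"] by auto
  then obtain v :: "'a cfun" where v: "l1_dist g v < e / 2"
    using \<open>e > 0\<close> unfolding approximable_def by (meson half_gt_zero)
  have ig: "integrable m g" using g by (simp add: approximable_def)
  have "l1_dist f v \<le> (\<integral>x. \<bar>f x - g x\<bar> + \<bar>g x - v x\<bar> \<partial>m)"
    using int ig by (intro integral_mono) auto
  also have "\<dots> < e" using g v int ig by (subst Bochner_Integration.integral_add) auto
  finally show "\<exists>v :: 'a cfun. l1_dist f v < e" by blast
qed

text \<open>Dominated convergence with majorant 1. It serves twice: for the approximability of
  disjoint unions and for the countable additivity of the representing measure.\<close>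

lemma integral_disjoint_tail:
  fixes A :: "nat \<Rightarrow> 'a set"
  assumes A: "\<And>i. A i \<in> sets borel" "disjoint_family A"
  shows "(\<lambda>n. \<integral>x. \<bar>indicator (\<Union>i. A i) x - (\<Sum>i<n. indicator (A i) x :: real)\<bar> \<partial>m) \<longlonglongrightarrow> 0"
proof -
  have sums: "(\<lambda>i. indicator (A i) x) sums (indicator (\<Union>i. A i) x :: real)" for x
    by (rule indicator_sums) (use A(2) in \<open>auto simp: disjoint_family_on_def\<close>)
  have partial: "0 \<le> (\<Sum>i<n. indicator (A i) x :: real)" "(\<Sum>i<n. indicator (A i) x) \<le> (1 :: real)" for n :: nat and x
  proof -
    show "0 \<le> (\<Sum>i<n. indicator (A i) x :: real)" by (simp add: sum_nonneg)
    have "(\<Sum>i<n. indicator (A i) x) \<le> (\<Sum>i. indicator (A i) x :: real)"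
      using sums by (intro sum_le_suminf) (auto simp: sums_iff)
    also have "\<dots> \<le> 1" using sums[of x] by (simp add: sums_iff indicator_def)
    finally show "(\<Sum>i<n. indicator (A i) x) \<le> (1 :: real)" .
  qed
  have "(\<lambda>n. \<integral>x. \<bar>indicator (\<Union>i. A i) x - (\<Sum>i<n. indicator (A i) x :: real)\<bar> \<partial>m)
      \<longlonglongrightarrow> (\<integral>x. 0 \<partial>m)"
  proof (rule integral_dominated_convergence[where w = "\<lambda>_. 1"])
    show "AE x in m. (\<lambda>n. \<bar>indicator (\<Union>i. A i) x - (\<Sum>i<n. indicator (A i) x :: real)\<bar>) \<longlonglongrightarrow> 0"
    proof (rule AE_I2)
      fix x
      show "(\<lambda>n. \<bar>indicator (\<Union>i. A i) x - (\<Sum>i<n. indicator (A i) x :: real)\<bar>) \<longlonglongrightarrow> 0"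
        using sums[of x] unfolding sums_def
        by (intro tendsto_rabs_zero) (auto intro!: tendsto_eq_intros)
    qed
    show "AE x in m. norm \<bar>indicator (\<Union>i. A i) x - (\<Sum>i<n. indicator (A i) x :: real)\<bar> \<le> 1" for n
    proof (rule AE_I2)
      fix x
      show "norm \<bar>indicator (\<Union>i. A i) x - (\<Sum>i<n. indicator (A i) x :: real)\<bar> \<le> 1"
        using partial[of x n] by (simp add: indicator_def)
    qed
  qed (use A in measurable)
  then show ?thesis by simp
qed

text \<open>Dynkin induction from the closed sets F, whose indicators are limits of the continuous
  functions \<open>max 0 (1 - n * infdist x F)\<close>.\<close>

lemma approximable_indicator:
  assumes "B \<in> sets borel" shows "approximable (indicator B)"
proof -
  have Int: "Int_stable (Collect closed :: 'a set set)" by (auto simp: Int_stable_def)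
  have Pow: "Collect closed \<subseteq> Pow (UNIV :: 'a set)" by simp
  have sets: "sigma_sets UNIV (Collect closed) = sets (borel :: 'a measure)"
    by (simp add: borel_eq_closed)
  have "B \<in> sigma_sets UNIV (Collect closed)" using assms sets by simp
  with Int Pow show ?thesis
  proof (induction rule: sigma_sets_induct_disjoint)
    case (basic F)
    show ?case
    \<comment> \<open>By convention \<open>infdist x {}\<close> is 0, so the cut-off functions would
      be constantly 1 for the empty set.\<close>
    proof (cases "F = {}")
      case True then show ?thesis using approximable_sum[of "{}"] by (simp add: indicator_def[abs_def])
    next
      case False
      have "closed F" using basic by simp
      define v where "v n x = max 0 (1 - real n * infdist x F)" for n x
      have v: "\<exists>w :: 'a cfun. \<forall>x. w x = v n x" for n
        by (rule bcontfun_of_continuous_bounded[of "v n" 1])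
          (auto simp: v_def infdist_nonneg intro!: continuous_intros)
      have "(\<lambda>n. \<integral>x. \<bar>indicator F x - v n x\<bar> \<partial>m) \<longlonglongrightarrow> (\<integral>x. 0 \<partial>m)"
      proof (rule integral_dominated_convergence[where w = "\<lambda>_. 1"])
        show "AE x in m. (\<lambda>n. \<bar>indicator F x - v n x\<bar>) \<longlonglongrightarrow> 0"
        proof (rule AE_I2)
          fix x
          show "(\<lambda>n. \<bar>indicator F x - v n x\<bar>) \<longlonglongrightarrow> 0"
          proof (cases "x \<in> F")
            case True then show ?thesis by (simp add: v_def)
          next
            case False
            then have d: "infdist x F > 0"
              using \<open>closed F\<close> \<open>F \<noteq> {}\<close> in_closed_iff_infdist_zero[of F x] infdist_nonneg[of x F]
              by force
            obtain N :: nat where N: "real N > 1 / infdist x F" using reals_Archimedean2 by blast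
            have "\<bar>indicator F x - v n x\<bar> = 0" if "n \<ge> N" for n
            proof -
              have "real n > 1 / infdist x F" using N that by linarith
              then have "1 < real n * infdist x F" using d by (simp add: pos_divide_less_eq)
              then show ?thesis using False by (simp add: v_def)
            qed
            then show ?thesis by (intro tendsto_eventually eventually_sequentiallyI[of N]) auto
          qed
        qed
        show "AE x in m. norm \<bar>indicator F x - v n x\<bar> \<le> 1" for n
          by (rule AE_I2) (auto simp: v_def indicator_def infdist_nonneg)
        show "(\<lambda>x. \<bar>indicator F x - v n x\<bar>) \<in> borel_measurable m" for n
        proof -
          have "F \<in> sets borel" using \<open>closed F\<close> by simp
          moreover have "v n \<in> borel_measurable borel"
            unfolding v_def by (intro borel_measurable_continuous_onI continuous_intros)
          ultimately show ?thesis by measurable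
        qed
      qed auto
      then have lim: "(\<lambda>n. \<integral>x. \<bar>indicator F x - v n x\<bar> \<partial>m) \<longlonglongrightarrow> 0" by simp
      show ?thesis unfolding approximable_def
      proof safe
        show "integrable m (indicator F :: 'a \<Rightarrow> real)"
          using \<open>closed F\<close> by (intro integrable_real_indicator) (auto simp: sets_m less_top[symmetric])
        fix e :: real assume "e > 0"
        then obtain n where "l1_dist (indicator F) (v n) < e"
          using eventually_happens'[OF sequentially_bot order_tendstoD(2)[OF lim]] by auto
        moreover obtain w :: "'a cfun" where "\<And>x. w x = v n x" using v[of n] by blast
        ultimately have "l1_dist (indicator F) w < e" by simp
        then show "\<exists>v :: 'a cfun. l1_dist (indicator F) v < e" ..
      qed
    qed
  next
    case empty
    then show ?case using approximable_sum[of "{}"] by (simp add: indicator_def[abs_def])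
  next
    case (compl A)
    have "indicator (UNIV - A) = (\<lambda>x. const_bcontfun 1 x + (- 1) * indicator A x :: real)"
      by (auto simp: fun_eq_iff indicator_def)
    then show ?case
      using approximable_add[OF approximable_bcontfun approximable_scale[OF compl.IH]] by metis
  next
    case (union A)
    have A: "A i \<in> sets borel" for i using union sets by auto
    show ?case
    proof (rule approximable_limit)
      show "integrable m (indicator (\<Union>i. A i) :: 'a \<Rightarrow> real)"
        using A by (intro integrable_real_indicator) (auto simp: sets_m less_top[symmetric])
      fix e :: real assume "e > 0"
      then obtain n where
        "l1_dist (indicator (\<Union>i. A i)) (\<lambda>x. \<Sum>i<n. indicator (A i) x) < e"
        using eventually_happens'[OF sequentially_bot
            order_tendstoD(2)[OF integral_disjoint_tail[OF A union(1)]]] by auto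
      then show "\<exists>g. approximable g \<and> l1_dist (indicator (\<Union>i. A i)) g < e"
        using approximable_sum[of "{..<n}" "\<lambda>i. indicator (A i)"] union by blast
    qed
  qed
qed

text \<open>Both values are compared with \<phi> at one continuous \<open>w\<close> close to
  \<open>g\<close>; the detour costs at most \<open>2 * C * l1_dist g w\<close>.\<close>

lemma extends_to_close:
  assumes f: "extends_to f a" "integrable m f" and g: "extends_to g b" "approximable g"
  shows "\<bar>a - b\<bar> \<le> C * l1_dist f g"
proof -
  have ig: "integrable m g" using g by (simp add: approximable_def)
  have "\<bar>a - b\<bar> \<le> C * l1_dist f g + e" if "e > 0" for e
  proof -
    \<comment> \<open>The summand 1 covers the case \<open>C = 0\<close>.\<close>
    have "e / (2 * C + 1) > 0" using that C_nonneg by simp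
    then obtain w :: "'a cfun" where w: "l1_dist g w < e / (2 * C + 1)"
      using g(2) unfolding approximable_def by meson
    have "l1_dist f w \<le> (\<integral>x. \<bar>f x - g x\<bar> + \<bar>g x - w x\<bar> \<partial>m)"
      using f ig by (intro integral_mono) auto
    also have "\<dots> = l1_dist f g + l1_dist g w"
      using f ig by (intro Bochner_Integration.integral_add) auto
    finally have "\<bar>a - \<phi> w\<bar> \<le> C * (l1_dist f g + l1_dist g w)"
      using f(1) C_nonneg unfolding extends_to_def by (meson mult_left_mono order_trans)
    moreover have "\<bar>b - \<phi> w\<bar> \<le> C * l1_dist g w"
      using g(1) unfolding extends_to_def by blast
    moreover have "2 * C * l1_dist g w \<le> e"
    proof -
      have "2 * C * l1_dist g w \<le> (2 * C + 1) * l1_dist g w"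
        by (intro mult_right_mono) auto
      also have "\<dots> \<le> e" using w C_nonneg by (simp add: pos_less_divide_eq mult.commute)
      finally show ?thesis .
    qed
    ultimately show ?thesis by (simp add: algebra_simps)
  qed
  then show ?thesis by (rule field_le_epsilon)
qed

text \<open>Moving one summand to the side of the test function reduces additivity to
  \<open>extends_to_close\<close>: \<phi> v - a belongs to v - f, and its distance to b is bounded
  by the distance of v - f to g.\<close>

lemma extends_to_add:
  assumes f: "extends_to f a" "integrable m f" and g: "extends_to g b" "approximable g"
  shows "extends_to (\<lambda>x. f x + g x) (a + b)"
  unfolding extends_to_def
proof
  fix v :: "'a cfun"
  have ig: "integrable m g" using g by (simp add: approximable_def)
  have "extends_to (\<lambda>x. v x - f x) (\<phi> v - a)"
    unfolding extends_to_def
  proof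
    fix w :: "'a cfun"
    have "\<bar>a - \<phi> (v - w)\<bar> \<le> C * (\<integral>x. \<bar>f x - (v - w) x\<bar> \<partial>m)"
      using f(1) unfolding extends_to_def by blast
    also have "(\<integral>x. \<bar>f x - (v - w) x\<bar> \<partial>m) = (\<integral>x. \<bar>v x - f x - w x\<bar> \<partial>m)"
      by (intro Bochner_Integration.integral_cong) auto
    finally show "\<bar>\<phi> v - a - \<phi> w\<bar> \<le> C * (\<integral>x. \<bar>v x - f x - w x\<bar> \<partial>m)" by (simp add: diff abs_minus_commute)
  qed
  from extends_to_close[OF this _ g] f(2)
  have "\<bar>\<phi> v - a - b\<bar> \<le> C * (\<integral>x. \<bar>v x - f x - g x\<bar> \<partial>m)" by auto
  also have "(\<integral>x. \<bar>v x - f x - g x\<bar> \<partial>m) = l1_dist (\<lambda>x. f x + g x) v"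
    by (intro Bochner_Integration.integral_cong) auto
  finally show "\<bar>a + b - \<phi> v\<bar> \<le> C * l1_dist (\<lambda>x. f x + g x) v" by simp
qed

lemma extends_to_scale:
  assumes f: "extends_to f a" shows "extends_to (\<lambda>x. c * f x) (c * a)"
  unfolding extends_to_def
proof
  fix v :: "'a cfun"
  show "\<bar>c * a - \<phi> v\<bar> \<le> C * l1_dist (\<lambda>x. c * f x) v"
  proof (cases "c = 0")
    case True then show ?thesis using abs_bound[of v] by simp
  next
    case False
    have "c * a - \<phi> v = c * (a - \<phi> ((1 / c) *\<^sub>R v))" using False by (simp add: scale right_diff_distrib)
    then have "\<bar>c * a - \<phi> v\<bar> = \<bar>c\<bar> * \<bar>a - \<phi> ((1 / c) *\<^sub>R v)\<bar>" by (simp add: abs_mult)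
    also have "\<dots> \<le> \<bar>c\<bar> * (C * l1_dist f (((1 / c) *\<^sub>R v)))"
      by (intro mult_left_mono f[unfolded extends_to_def, rule_format]) auto
    also have "\<dots> = C * (\<integral>x. \<bar>c\<bar> * \<bar>f x - ((1 / c) *\<^sub>R v) x\<bar> \<partial>m)" by simp
    also have "(\<integral>x. \<bar>c\<bar> * \<bar>f x - ((1 / c) *\<^sub>R v) x\<bar> \<partial>m) = l1_dist (\<lambda>x. c * f x) v"
      using False by (intro Bochner_Integration.integral_cong) (auto simp: abs_mult[symmetric] right_diff_distrib)
    finally show ?thesis .
  qed
qed

lemma extends_to_sum:
  assumes "finite I" "\<And>i. i \<in> I \<Longrightarrow> extends_to (f i) (a i)" "\<And>i. i \<in> I \<Longrightarrow> approximable (f i)"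
  shows "extends_to (\<lambda>x. \<Sum>i\<in>I. f i x) (\<Sum>i\<in>I. a i)"
  using assms
proof (induction I rule: finite_induct)
  case empty show ?case using abs_bound by (simp add: extends_to_def)
next
  case (insert i I)
  then have "approximable (\<lambda>x. \<Sum>i\<in>I. f i x)" by (auto intro!: approximable_sum)
  moreover have "integrable m (f i)" using insert.prems(2)[of i] by (simp add: approximable_def)
  ultimately show ?case using insert by (simp add: extends_to_add)
qed

text \<open>The value is the limit of \<phi> along continuous approximants of \<open>f\<close>. The
  single estimate \<open>tri\<close> yields both the Cauchy property and, in the limit, the defining
  inequality.\<close>

lemma extends_to_exists:
  assumes "approximable f" shows "\<exists>a. extends_to f a"
proof -
  have f: "integrable m f" using assms by (simp add: approximable_def)
  have "\<exists>v :: 'a cfun. l1_dist f v < 1 / real (Suc n)" for n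
    using assms by (simp add: approximable_def)
  then obtain V :: "nat \<Rightarrow> 'a cfun" where V: "\<And>n. l1_dist f (V n) < 1 / real (Suc n)"
    by metis
  have tri: "\<bar>\<phi> (V n) - \<phi> v\<bar> \<le> C * (1 / real (Suc n) + l1_dist f v)" for n v
  proof -
    have "\<bar>\<phi> (V n) - \<phi> v\<bar> \<le> C * (\<integral>x. \<bar>(V n - v) x\<bar> \<partial>m)" using abs_bound[of "V n - v"] by (simp add: diff)
    also have "(\<integral>x. \<bar>(V n - v) x\<bar> \<partial>m) \<le> (\<integral>x. \<bar>f x - V n x\<bar> + \<bar>f x - v x\<bar> \<partial>m)"
      using f by (intro integral_mono) auto
    also have "\<dots> = l1_dist f (V n) + l1_dist f v"
      using f by (intro Bochner_Integration.integral_add) auto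
    also have "\<dots> \<le> 1 / real (Suc n) + l1_dist f v" using V[of n] by simp
    finally show ?thesis using C_nonneg by (simp add: mult_left_mono)
  qed
  have "Cauchy (\<lambda>n. \<phi> (V n))"
  proof (rule metric_CauchyI)
    fix e :: real assume "e > 0"
    obtain N :: nat where N: "real N > 2 * C / e" using reals_Archimedean2 by blast
    have "dist (\<phi> (V n)) (\<phi> (V k)) < e" if "n \<ge> N" "k \<ge> N" for n k
    proof -
      have "dist (\<phi> (V n)) (\<phi> (V k)) \<le> C * (1 / real (Suc n) + l1_dist f (V k))"
        using tri[of n "V k"] by (simp add: dist_real_def)
      also have "\<dots> \<le> C * (1 / real (Suc N) + 1 / real (Suc N))"
      proof (intro mult_left_mono add_mono C_nonneg)
        show "1 / real (Suc n) \<le> 1 / real (Suc N)" using that by (simp add: frac_le)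
        have "1 / real (Suc k) \<le> 1 / real (Suc N)" using that by (simp add: frac_le)
        then show "l1_dist f (V k) \<le> 1 / real (Suc N)" using V[of k] by linarith
      qed
      also have "\<dots> = 2 * C / Suc N" by simp
      also have "\<dots> < e"
      proof -
        have "2 * C < e * N" using N \<open>e > 0\<close> by (simp add: pos_divide_less_eq mult.commute)
        also have "\<dots> \<le> e * Suc N" using \<open>e > 0\<close> by simp
        finally show ?thesis by (simp add: pos_divide_less_eq del: of_nat_Suc)
      qed
      finally show ?thesis .
    qed
    then show "\<exists>M. \<forall>m\<ge>M. \<forall>n\<ge>M. dist (\<phi> (V m)) (\<phi> (V n)) < e" by blast
  qed
  then obtain a where a: "(\<lambda>n. \<phi> (V n)) \<longlonglongrightarrow> a" using Cauchy_convergent convergent_def by blast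
  have "extends_to f a"
    unfolding extends_to_def
  proof
    fix v :: "'a cfun"
    have "(\<lambda>n. \<bar>\<phi> (V n) - \<phi> v\<bar>) \<longlonglongrightarrow> \<bar>a - \<phi> v\<bar>" by (intro tendsto_intros a)
    moreover have "(\<lambda>n. C * (1 / real (Suc n) + l1_dist f v)) \<longlonglongrightarrow> C * (0 + l1_dist f v)"
      by (intro tendsto_intros LIMSEQ_Suc[OF lim_1_over_n])
    ultimately show "\<bar>a - \<phi> v\<bar> \<le> C * l1_dist f v"
      using tri[of _ v] by (intro LIMSEQ_le[where X = "\<lambda>n. \<bar>\<phi> (V n) - \<phi> v\<bar>"]) auto
  qed
  then show ?thesis by blast
qed

text \<open>The extended values on indicators form a measure: partial sums over a disjoint family
  are Lipschitz-close to the value of the union, which gives countable additivity. Agreement with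
  \<phi> is checked on step functions uniformly close to v.\<close>

theorem representation:
  "\<exists>\<nu>. sets \<nu> = sets borel \<and> finite_measure \<nu> \<and> (\<forall>v. (\<integral>x. apply_bcontfun v x \<partial>\<nu>) = \<phi> v)"
proof -
  have "\<forall>B\<in>sets borel. \<exists>a. extends_to (indicator B) a"
    using approximable_indicator extends_to_exists by blast
  then obtain l where l: "\<And>B. B \<in> sets borel \<Longrightarrow> extends_to (indicator B) (l B)" by metis
  have int_B: "integrable m (indicator B :: 'a \<Rightarrow> real)" if "B \<in> sets borel" for B
    using approximable_indicator[OF that] by (simp add: approximable_def)
  have l_pos: "0 \<le> l B" if B: "B \<in> sets borel" for B
  proof -
    have "0 \<le> l B + e" if "e > 0" for e
    proof -
      have "e / (C + 1) > 0" using that C_nonneg by simp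
      then obtain v :: "'a cfun" where v: "l1_dist (indicator B) v < e / (C + 1)"
        using approximable_indicator[OF B] unfolding approximable_def by meson
      \<comment> \<open>Since an indicator is nonnegative, the positive part of v approximates it at
        least as well, and \<phi> is nonnegative there.\<close>
      obtain w :: "'a cfun" where w: "\<And>x. w x = max 0 (v x)"
        by (rule bcontfun_of_continuous_bounded[of "\<lambda>x. max 0 (v x)" "norm v"])
          (use norm_bounded[of v] norm_ge_zero[of v] in \<open>auto intro!: continuous_intros simp: abs_le_iff\<close>)
      have "\<bar>l B - \<phi> w\<bar> \<le> C * l1_dist (indicator B) w"
        using l[OF B] unfolding extends_to_def by blast
      also have "\<dots> \<le> C * l1_dist (indicator B) v"
      proof (intro mult_left_mono integral_mono C_nonneg integrable_abs
          Bochner_Integration.integrable_diff int_B B int_v)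
        show "\<bar>indicator B x - w x\<bar> \<le> \<bar>indicator B x - v x\<bar>" for x
          by (auto simp: w indicator_def)
      qed
      also have "\<dots> \<le> (C + 1) * l1_dist (indicator B) v"
        by (intro mult_right_mono) auto
      also have "\<dots> < e" using v C_nonneg by (simp add: pos_less_divide_eq mult.commute)
      finally have "\<bar>l B - \<phi> w\<bar> < e" .
      moreover have "0 \<le> \<phi> w" by (rule pos) (simp add: w)
      ultimately show ?thesis by linarith
    qed
    then show ?thesis by (rule field_le_epsilon)
  qed
  have l_sums: "(\<lambda>i. l (A i)) sums l (\<Union>i. A i)"
    if A: "\<And>i. A i \<in> sets borel" "disjoint_family A" for A :: "nat \<Rightarrow> 'a set"
  proof -
    have U: "(\<Union>i. A i) \<in> sets borel" using A by auto
    have bound: "norm (l (\<Union>i. A i) - (\<Sum>i<n. l (A i)))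
        \<le> C * l1_dist (indicator (\<Union>i. A i)) (\<lambda>x. \<Sum>i<n. indicator (A i) x)" for n
      unfolding real_norm_def
      by (intro extends_to_close l U int_B extends_to_sum approximable_sum approximable_indicator A) auto
    have "(\<lambda>n. C * l1_dist (indicator (\<Union>i. A i)) (\<lambda>x. \<Sum>i<n. indicator (A i) x))
        \<longlonglongrightarrow> 0"
      using tendsto_mult_left[OF integral_disjoint_tail[OF A], of C] by simp
    then have "(\<lambda>n. l (\<Union>i. A i) - (\<Sum>i<n. l (A i))) \<longlonglongrightarrow> 0"
      by (rule Lim_null_comparison[rotated]) (rule always_eventually, rule allI, rule bound)
    from tendsto_diff[OF tendsto_const[of "l (\<Union>i. A i)"] this] show ?thesis
      unfolding sums_def by (simp only: diff_diff_eq2 add_diff_cancel_left' diff_0_right)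
  qed
  have l_empty: "l {} = 0"
    using l[of "{}", unfolded extends_to_def, rule_format, of 0] by (simp add: zero)
  define \<nu> where "\<nu> = measure_of UNIV (sets (borel :: 'a measure)) (\<lambda>B. ennreal (l B))"
  have sets_\<nu>: "sets \<nu> = sets borel"
    using sets.sigma_sets_eq[of "borel :: 'a measure"] by (simp add: \<nu>_def)
  have em: "emeasure \<nu> B = ennreal (l B)" if "B \<in> sets borel" for B
  proof (rule emeasure_measure_of[OF \<nu>_def])
    show "positive (sets \<nu>) (\<lambda>B. ennreal (l B))" by (simp add: positive_def l_empty)
    show "countably_additive (sets \<nu>) (\<lambda>B. ennreal (l B))"
    proof (rule countably_additiveI)
      fix A :: "nat \<Rightarrow> 'a set" assume A: "range A \<subseteq> sets \<nu>" "disjoint_family A"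
      then have "A i \<in> sets borel" for i by (auto simp: sets_\<nu>)
      then have s: "(\<lambda>i. l (A i)) sums l (\<Union>i. A i)" using A(2) by (rule l_sums)
      have nn: "0 \<le> l (A i)" for i using A by (intro l_pos) (auto simp: sets_\<nu>)
      show "(\<Sum>i. ennreal (l (A i))) = ennreal (l (\<Union> (range A)))"
        unfolding suminf_ennreal2[OF nn sums_summable[OF s]] sums_unique[OF s] ..
    qed
  qed (use that sets_\<nu> in auto)
  have fin: "finite_measure \<nu>"
    by (rule finite_measureI) (use em[of UNIV] sets_eq_imp_space_eq[OF sets_\<nu>] in simp)
  have meas: "measure \<nu> B = l B" if "B \<in> sets borel" for B
    using em[OF that] l_pos[OF that] by (simp add: measure_def)
  interpret \<nu>: finite_measure \<nu> by (rule fin)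
  have [simp]: "space \<nu> = UNIV" using sets_eq_imp_space_eq[OF sets_\<nu>] by simp
  have "(\<integral>x. v x \<partial>\<nu>) = \<phi> v" for v :: "'a cfun"
  proof -
    have [simp]: "integrable \<nu> v" by (rule integrable_bcontfun[OF fin sets_\<nu>])
    have close: "\<bar>(\<integral>x. v x \<partial>\<nu>) - \<phi> v\<bar> \<le> (measure \<nu> UNIV + C * measure m UNIV) * (1 / real (Suc N))" for N
    proof -
      \<comment> \<open>\<open>f\<close> below rounds v down to the grid of width 1/(N+1), and the
        finite range \<open>J\<close> contains every level that occurs.\<close>
      define J where "J = {- \<lceil>real (Suc N) * norm v\<rceil> - 1 .. \<lceil>real (Suc N) * norm v\<rceil> + 1}"
      define B where "B j = {x. \<lfloor>real (Suc N) * v x\<rfloor> = j}" for j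
      define f where "f x = (\<Sum>j\<in>J. (of_int j / Suc N) * indicator (B j) x)" for x
      have B: "B j \<in> sets borel" for j
      proof -
        have "{x \<in> space borel. \<lfloor>real (Suc N) * v x\<rfloor> = j} \<in> sets borel" by measurable
        then show ?thesis by (simp add: B_def)
      qed
      have f: "f x = of_int \<lfloor>real (Suc N) * v x\<rfloor> / real (Suc N)" for x
      proof -
        have "\<bar>real (Suc N) * v x\<bar> \<le> real (Suc N) * norm v"
          using norm_bounded[of v x] by (simp add: abs_mult mult_left_mono)
        then have "\<lfloor>real (Suc N) * v x\<rfloor> \<in> J" unfolding J_def by (auto; linarith)
        moreover have "finite J" by (simp add: J_def)
        moreover have "f x = (\<Sum>j\<in>J. if j = \<lfloor>real (Suc N) * v x\<rfloor> then of_int j / real (Suc N) else 0)"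
          unfolding f_def B_def by (intro sum.cong) (auto simp: indicator_def)
        ultimately show ?thesis by (simp del: of_nat_Suc)
      qed
      have fv: "\<bar>f x - v x\<bar> \<le> 1 / real (Suc N)" for x
      proof -
        have "\<bar>of_int \<lfloor>real (Suc N) * v x\<rfloor> - real (Suc N) * v x\<bar> \<le> 1" by linarith
        moreover have "f x - v x = (of_int \<lfloor>real (Suc N) * v x\<rfloor> - real (Suc N) * v x) / real (Suc N)"
          by (simp add: f diff_divide_distrib del: of_nat_Suc)
        ultimately show ?thesis by (simp add: divide_right_mono del: of_nat_Suc)
      qed
      have "extends_to f (\<Sum>j\<in>J. (of_int j / Suc N) * l (B j))"
        unfolding f_def[abs_def] J_def
        by (intro extends_to_sum extends_to_scale l B approximable_scale approximable_indicator) auto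
      moreover have "(\<integral>x. f x \<partial>\<nu>) = (\<Sum>j\<in>J. (of_int j / Suc N) * l (B j))"
        unfolding f_def using B by (subst Bochner_Integration.integral_sum)
          (auto simp: meas sets_\<nu> less_top[symmetric] intro!: integrable_real_indicator)
      ultimately have 1: "\<bar>(\<integral>x. f x \<partial>\<nu>) - \<phi> v\<bar> \<le> C * l1_dist f v"
        unfolding extends_to_def by simp
      have intf: "integrable \<nu> f"
        unfolding f_def using B by (auto simp: sets_\<nu> less_top[symmetric] intro!: integrable_real_indicator)
      have intfm: "integrable m f"
        unfolding f_def by (intro Bochner_Integration.integrable_sum integrable_mult_right int_B B)
      have 2: "l1_dist f v \<le> (\<integral>x. 1 / real (Suc N) \<partial>m)"
        using intfm fv by (intro integral_mono) auto
      have "\<bar>(\<integral>x. v x \<partial>\<nu>) - (\<integral>x. f x \<partial>\<nu>)\<bar> \<le> (\<integral>x. \<bar>v x - f x\<bar> \<partial>\<nu>)"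
        using intf integral_abs_bound[of \<nu> "\<lambda>x. v x - f x"] by simp
      also have "\<dots> \<le> (\<integral>x. 1 / real (Suc N) \<partial>\<nu>)"
        using intf fv by (intro integral_mono) (auto simp: abs_minus_commute)
      finally have 3: "\<bar>(\<integral>x. v x \<partial>\<nu>) - (\<integral>x. f x \<partial>\<nu>)\<bar> \<le> measure \<nu> UNIV * (1 / real (Suc N))" by simp
      have "C * (\<integral>x. \<bar>f x - v x\<bar> \<partial>m) \<le> C * (measure m UNIV * (1 / real (Suc N)))"
        using 2 C_nonneg by (intro mult_left_mono) auto
      with 1 3 have "\<bar>(\<integral>x. v x \<partial>\<nu>) - \<phi> v\<bar>
          \<le> measure \<nu> UNIV * (1 / real (Suc N)) + C * (measure m UNIV * (1 / real (Suc N)))"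
        by linarith
      then show ?thesis by (simp only: distrib_right mult.assoc)
    qed
    have "(\<lambda>N. (measure \<nu> UNIV + C * measure m UNIV) * (1 / real (Suc N)))
        \<longlonglongrightarrow> (measure \<nu> UNIV + C * measure m UNIV) * 0"
      by (intro tendsto_intros LIMSEQ_Suc[OF lim_1_over_n])
    from LIMSEQ_le_const[OF this] have "\<bar>(\<integral>x. v x \<partial>\<nu>) - \<phi> v\<bar> \<le> 0"
      using close by (metis mult_zero_right)
    then show ?thesis by simp
  qed
  with sets_\<nu> fin show ?thesis by blast
qed

end

section \<open>Markov semigroups\<close>

instance bcontfun :: (metric_space, banach) banach ..

lemma has_vector_derivative_right:
  fixes F :: "real \<Rightarrow> 'b::real_normed_vector"
  assumes "((\<lambda>r. (F (s + r) - F s) /\<^sub>R r) \<longlongrightarrow> D) (at_right 0)"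
  shows "(F has_vector_derivative D) (at s within {s..b})"
  unfolding has_vector_derivative_def has_derivative_within_alt
proof (intro conjI allI impI)
  show "bounded_linear (\<lambda>x. x *\<^sub>R D)" by (rule bounded_linear_scaleR_left)
  fix e :: real assume "e > 0"
  with tendstoD[OF assms, of e] obtain d where d: "d > 0"
    "\<And>r. 0 < r \<Longrightarrow> r < d \<Longrightarrow> dist ((F (s + r) - F s) /\<^sub>R r) D < e"
    by (auto simp: eventually_at_right)
  have "norm (F y - F s - (y - s) *\<^sub>R D) \<le> e * norm (y - s)"
    if y: "y \<in> {s..b}" "norm (y - s) < d" for y
  proof (cases "y = s")
    case True then show ?thesis by simp
  next
    case False
    define r where "r = y - s"
    have r: "0 < r" "r < d" "y = s + r" using False y by (auto simp: r_def)
    have "F y - F s - r *\<^sub>R D = r *\<^sub>R ((F (s + r) - F s) /\<^sub>R r - D)"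
      using r by (simp add: scaleR_diff_right)
    then have "norm (F y - F s - r *\<^sub>R D) = r * dist ((F (s + r) - F s) /\<^sub>R r) D"
      using r by (simp add: dist_norm)
    also have "\<dots> \<le> r * e" using d(2)[OF r(1,2)] r by (intro mult_left_mono) auto
    finally show ?thesis using r by (simp add: mult.commute)
  qed
  then show "\<exists>d>0. \<forall>y\<in>{s..b}. norm (y - s) < d \<longrightarrow> norm (F y - F s - (y - s) *\<^sub>R D) \<le> e * norm (y - s)"
    using d(1) by blast
qed

lemma filterlim_shift_at_right:
  fixes s :: real
  assumes "0 < b" "{s<..<s + b} \<subseteq> J"
  shows "filterlim ((+) s) (at s within J) (at_right 0)"
  unfolding filterlim_at
proof
  show "((+) s \<longlongrightarrow> s) (at_right 0)" by (auto intro!: tendsto_eq_intros)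
  show "\<forall>\<^sub>F r in at_right 0. s + r \<in> J \<and> s + r \<noteq> s"
    using eventually_at_right_real[OF assms(1)] assms(2) by (auto elim!: eventually_mono)
qed

lemma right_quotient_of_derivative:
  fixes F :: "real \<Rightarrow> real"
  assumes "(F has_real_derivative D) (at s within {0..T})" "0 \<le> s" "s < T"
  shows "((\<lambda>r. (F (s + r) - F s) / r) \<longlongrightarrow> D) (at_right 0)"
proof -
  have "((\<lambda>y. (F y - F s) / (y - s)) \<longlongrightarrow> D) (at s within {0..T})"
    using assms(1) by (simp add: has_field_derivative_iff)
  moreover have "filterlim ((+) s) (at s within {0..T}) (at_right 0)"
    by (rule filterlim_shift_at_right[of "T - s"]) (use assms in auto)
  ultimately have "((\<lambda>r. (F (s + r) - F s) / (s + r - s)) \<longlongrightarrow> D) (at_right 0)"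
    by (rule filterlim_compose)
  then show ?thesis by simp
qed

text \<open>A modulus depending only on the length b - a turns information at time 0+ into two-sided
  continuity. Semigroup orbits have one, since S_b v - S_a v is S_a applied to S_(b-a) v -
  v.\<close>

lemma continuous_on_of_modulus:
  fixes F :: "real \<Rightarrow> 'b::real_normed_vector"
  assumes "\<And>T. 0 \<le> T \<Longrightarrow> \<exists>\<omega>. (\<omega> \<longlongrightarrow> 0) (at_right (0::real)) \<and>
    (\<forall>a b. 0 \<le> a \<longrightarrow> a \<le> b \<longrightarrow> b \<le> T \<longrightarrow> norm (F b - F a) \<le> \<omega> (b - a))"
  shows "continuous_on {0..} F"
  unfolding continuous_on_def
proof
  fix p :: real assume p: "p \<in> {0..}"
  then obtain \<omega> where \<omega>: "(\<omega> \<longlongrightarrow> 0) (at_right 0)"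
    "\<And>a b. 0 \<le> a \<Longrightarrow> a \<le> b \<Longrightarrow> b \<le> p + 1 \<Longrightarrow> norm (F b - F a) \<le> \<omega> (b - a)"
    using assms[of "p + 1"] by auto
  have lim: "filterlim (\<lambda>q. \<bar>q - p\<bar>) (at_right 0) (at p within {0..})"
    unfolding filterlim_at
    by (auto intro!: tendsto_eq_intros simp: eventually_at_filter)
  have "((\<lambda>q. F q - F p) \<longlongrightarrow> 0) (at p within {0..})"
  proof (rule Lim_null_comparison[OF _ filterlim_compose[OF \<omega>(1) lim]])
    have "norm (F q - F p) \<le> \<omega> \<bar>q - p\<bar>" if "q \<in> {0..}" "dist q p < 1" for q
    proof (cases "q \<le> p")
      case True then show ?thesis using \<omega>(2)[of q p] that by (simp add: norm_minus_commute)
    next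
      case False then show ?thesis using \<omega>(2)[of p q] that p by (simp add: dist_real_def)
    qed
    then show "\<forall>\<^sub>F q in at p within {0..}. norm (F q - F p) \<le> \<omega> \<bar>q - p\<bar>"
      unfolding eventually_at by (intro exI[of _ 1]) auto
  qed
  then show "(F \<longlongrightarrow> F p) (at p within {0..})" by (rule LIM_zero_cancel)
qed

section \<open>Evaluation, products and positive functionals on C(E)\<close>

lemma bounded_linear_apply: "bounded_linear (\<lambda>v :: 'a::topological_space \<Rightarrow>\<^sub>C real. v x)"
proof (rule bounded_linear_intro[of _ 1])
  show "norm (v x) \<le> norm v * 1" for v :: "'a cfun" using norm_bounded[of v x] by simp
qed auto

lemma norm_bmult_le: "norm (bmult v w) \<le> norm v * norm w"
proof (rule norm_bound)
  fix x show "norm (bmult v w x) \<le> norm v * norm w"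
    unfolding bmult_apply norm_mult by (intro mult_mono norm_bounded norm_ge_zero)
qed

lemma bounded_bilinear_bmult:
  "bounded_bilinear (bmult :: ('a::topological_space \<Rightarrow>\<^sub>C real) \<Rightarrow> _)"
proof
  fix v w u :: "'a cfun" and c :: real
  show "bmult (v + w) u = bmult v u + bmult w u" "bmult u (v + w) = bmult u v + bmult u w"
    "bmult (c *\<^sub>R v) w = c *\<^sub>R bmult v w" "bmult v (c *\<^sub>R w) = c *\<^sub>R bmult v w"
    by (auto intro!: bcontfun_eqI simp: bmult_apply algebra_simps)
  show "\<exists>K. \<forall>v w :: 'a cfun. norm (bmult v w) \<le> norm v * norm w * K"
    by (intro exI[of _ 1]) (simp add: norm_bmult_le)
qed

lemmas bmult_add_left = bounded_bilinear.add_left[OF bounded_bilinear_bmult]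
  and bmult_add_right = bounded_bilinear.add_right[OF bounded_bilinear_bmult]
  and bmult_diff_left = bounded_bilinear.diff_left[OF bounded_bilinear_bmult]
  and bmult_diff_right = bounded_bilinear.diff_right[OF bounded_bilinear_bmult]
  and bmult_scale_left = bounded_bilinear.scaleR_left[OF bounded_bilinear_bmult]
  and bmult_scale_right = bounded_bilinear.scaleR_right[OF bounded_bilinear_bmult]
  and bmult_sum_left = bounded_bilinear.sum_left[OF bounded_bilinear_bmult]
  and continuous_on_bmult = bounded_bilinear.continuous_on[OF bounded_bilinear_bmult]

lemma norm_bcontfun_le_nonneg:
  fixes v :: "'a::topological_space \<Rightarrow>\<^sub>C real"
  assumes "\<And>x. 0 \<le> v x" "\<And>x. v x \<le> b" shows "norm v \<le> b"
  by (rule norm_bound) (use assms in auto)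

text \<open>Both functions norm v + v and norm v - v are nonnegative.\<close>

lemma positive_functional_bound:
  fixes L :: "('a::topological_space \<Rightarrow>\<^sub>C real) \<Rightarrow> real"
  assumes add: "\<And>v w. L (v + w) = L v + L w" and scale: "\<And>c v. L (c *\<^sub>R v) = c * L v"
    and pos: "\<And>v. (\<forall>x. 0 \<le> apply_bcontfun v x) \<Longrightarrow> 0 \<le> L v"
  shows "\<bar>L v\<bar> \<le> L (const_bcontfun 1) * norm v"
proof -
  have diff: "L (v - w) = L v - L w" for v w using add[of "v - w" w] by simp
  have v: "\<bar>v x\<bar> \<le> norm v" for x using norm_bounded[of v x] by simp
  have "0 \<le> L (norm v *\<^sub>R const_bcontfun 1 - v)"
    by (rule pos) (use v in \<open>auto simp: abs_le_iff\<close>)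
  moreover have "0 \<le> L (norm v *\<^sub>R const_bcontfun 1 + v)"
  proof (rule pos, rule allI)
    fix x show "0 \<le> (norm v *\<^sub>R const_bcontfun 1 + v) x" using v[of x] by (simp add: abs_le_iff)
  qed
  ultimately show ?thesis by (simp add: add diff scale mult.commute)
qed

text \<open>Positivity, conservation of constants and strong continuity carry the analytic part; the
  process itself returns only through \<open>propagates\<close>.\<close>

locale markov_semigroup =
  fixes S :: "real \<Rightarrow> 'a::metric_space cfun \<Rightarrow> 'a cfun"
  assumes semigroup: "strongly_continuous_semigroup S"
    and S_pos: "\<And>t v x. 0 \<le> t \<Longrightarrow> (\<forall>x. 0 \<le> apply_bcontfun v x) \<Longrightarrow> 0 \<le> S t v x"
    and S_one: "\<And>t. 0 \<le> t \<Longrightarrow> S t (const_bcontfun 1) = const_bcontfun 1"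
begin

abbreviation "A \<equiv> generator S"
abbreviation "gdom \<equiv> generator_domain S"

lemma S_linear: "0 \<le> t \<Longrightarrow> bounded_linear (S t)"
  and S_0 [simp]: "S 0 v = v"
  and S_S: "0 \<le> s \<Longrightarrow> 0 \<le> t \<Longrightarrow> S s (S t v) = S (s + t) v"
  and S_tendsto_0: "((\<lambda>t. S t v) \<longlongrightarrow> v) (at_right 0)"
  using semigroup by (auto simp: strongly_continuous_semigroup_def)

lemma S_add: "0 \<le> t \<Longrightarrow> S t (v + w) = S t v + S t w"
  and S_diff: "0 \<le> t \<Longrightarrow> S t (v - w) = S t v - S t w"
  and S_scale: "0 \<le> t \<Longrightarrow> S t (c *\<^sub>R v) = c *\<^sub>R S t v"
  using S_linear by (simp_all add: linear_simps)

lemma S_mono: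
  assumes "0 \<le> t" "\<And>x. apply_bcontfun v x \<le> apply_bcontfun w x" shows "S t v x \<le> S t w x"
  using S_pos[of t "w - v" x] assms by (simp add: S_diff)

lemma S_contraction: assumes "0 \<le> t" shows "norm (S t v) \<le> norm v"
proof (rule norm_bound)
  fix x
  have "\<bar>S t v x\<bar> \<le> S t (const_bcontfun 1) x * norm v"
    by (rule positive_functional_bound[of "\<lambda>v. S t v x"])
      (use assms S_pos in \<open>auto simp: S_add S_scale\<close>)
  then show "norm (S t v x) \<le> norm v" using S_one[OF assms] by simp
qed

lemma S_modulus:
  assumes "0 \<le> a" "a \<le> b" shows "norm (S b v - S a v) \<le> norm (S (b - a) v - v)"
proof -
  have "S b v - S a v = S a (S (b - a) v - v)" using assms by (simp add: S_S S_diff)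
  then show ?thesis using S_contraction[OF assms(1)] by metis
qed

lemma S_continuous: "continuous_on {0..} (\<lambda>t. S t v)"
proof (rule continuous_on_of_modulus)
  fix T :: real
  have "((\<lambda>r. norm (S r v - v)) \<longlongrightarrow> 0) (at_right 0)"
    using S_tendsto_0 by (auto intro!: tendsto_eq_intros)
  then show "\<exists>\<omega>. (\<omega> \<longlongrightarrow> 0) (at_right 0) \<and>
      (\<forall>a b. 0 \<le> a \<longrightarrow> a \<le> b \<longrightarrow> b \<le> T \<longrightarrow> norm (S b v - S a v) \<le> \<omega> (b - a))"
    using S_modulus by (intro exI[of _ "\<lambda>r. norm (S r v - v)"]) auto
qed

lemma S_continuous_comp [continuous_intros]:
  assumes "continuous_on I f" "\<And>q. q \<in> I \<Longrightarrow> 0 \<le> f q"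
  shows "continuous_on I (\<lambda>q. S (f q) v)"
  by (rule continuous_on_compose2[OF S_continuous assms(1)]) (use assms(2) in auto)

abbreviation quot :: "'a cfun \<Rightarrow> real \<Rightarrow> 'a cfun"
  where "quot f r \<equiv> (S r f - f) /\<^sub>R r"

lemma generator_tendsto:
  assumes "f \<in> gdom" shows "((\<lambda>r. quot f r) \<longlongrightarrow> A f) (at_right 0)"
  using assms unfolding generator_domain_def generator_def
  by (auto simp: tendsto_Lim[OF trivial_limit_at_right_real])

lemma generatorI:
  assumes "((\<lambda>r. quot f r) \<longlongrightarrow> g) (at_right 0)"
  shows "f \<in> gdom" "A f = g"
  using assms unfolding generator_domain_def generator_def
  by (auto simp: tendsto_Lim[OF trivial_limit_at_right_real])

lemma eventually_right_0_nonneg: "(\<And>r. 0 < r \<Longrightarrow> P r) \<Longrightarrow> eventually P (at_right (0::real))"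
  using eventually_at_right_real[of 0 1] by (auto elim!: eventually_mono)

lemma
  assumes "f \<in> gdom" "g \<in> gdom"
  shows dom_add: "f + g \<in> gdom" and generator_add: "A (f + g) = A f + A g"
proof -
  have "((\<lambda>r. quot f r + quot g r) \<longlongrightarrow> A f + A g) (at_right 0)"
    by (intro tendsto_add generator_tendsto assms)
  moreover have "\<forall>\<^sub>F r in at_right 0. quot f r + quot g r = quot (f + g) r"
    by (rule eventually_right_0_nonneg) (simp add: S_add flip: scaleR_add_right)
  ultimately have "((\<lambda>r. quot (f + g) r) \<longlongrightarrow> A f + A g) (at_right 0)"
    by (rule Lim_transform_eventually)
  then show "f + g \<in> gdom" "A (f + g) = A f + A g" by (rule generatorI)+
qed

lemma
  assumes "f \<in> gdom"
  shows dom_scale: "c *\<^sub>R f \<in> gdom" and generator_scale: "A (c *\<^sub>R f) = c *\<^sub>R A f"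
proof -
  have "((\<lambda>r. c *\<^sub>R (quot f r)) \<longlongrightarrow> c *\<^sub>R A f) (at_right 0)"
    by (intro tendsto_intros generator_tendsto assms)
  moreover have "\<forall>\<^sub>F r in at_right 0. c *\<^sub>R (quot f r) = quot (c *\<^sub>R f) r"
    by (rule eventually_right_0_nonneg) (simp add: S_scale scaleR_diff_right mult.commute)
  ultimately have "((\<lambda>r. quot (c *\<^sub>R f) r) \<longlongrightarrow> c *\<^sub>R A f) (at_right 0)"
    by (rule Lim_transform_eventually)
  then show "c *\<^sub>R f \<in> gdom" "A (c *\<^sub>R f) = c *\<^sub>R A f" by (rule generatorI)+
qed

lemma
  shows dom_zero: "0 \<in> gdom" and generator_zero: "A 0 = 0"
proof -
  have "\<forall>\<^sub>F r in at_right 0. 0 = quot 0 r"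
    by (rule eventually_right_0_nonneg) (use S_scale[of _ 0 0] in simp)
  then have "((\<lambda>r. quot 0 r) \<longlongrightarrow> 0) (at_right 0)"
    by (rule Lim_transform_eventually[OF tendsto_const])
  then show "0 \<in> gdom" "A 0 = 0" by (rule generatorI)+
qed

lemma
  assumes "f \<in> gdom" "g \<in> gdom"
  shows dom_diff: "f - g \<in> gdom" and generator_diff: "A (f - g) = A f - A g"
  using dom_add[OF assms(1) dom_scale[OF assms(2), of "-1"]]
    generator_add[OF assms(1) dom_scale[OF assms(2), of "-1"]] generator_scale[OF assms(2), of "-1"]
  by simp_all

lemma dom_sum:
  assumes "\<And>i. i \<in> I \<Longrightarrow> f i \<in> gdom"
  shows "(\<Sum>i\<in>I. f i) \<in> gdom \<and> A (\<Sum>i\<in>I. f i) = (\<Sum>i\<in>I. A (f i))"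
  using assms
proof (induction I rule: infinite_finite_induct)
  case (insert i I) then show ?case by (simp add: dom_add generator_add)
qed (simp_all add: dom_zero generator_zero)

lemma
  assumes "f \<in> gdom" "0 \<le> t"
  shows dom_S: "S t f \<in> gdom" and generator_S: "A (S t f) = S t (A f)"
proof -
  have "((\<lambda>r. S t (quot f r)) \<longlongrightarrow> S t (A f)) (at_right 0)"
    by (intro bounded_linear.tendsto[OF S_linear] generator_tendsto assms)
  moreover have "\<forall>\<^sub>F r in at_right 0. S t (quot f r) = quot (S t f) r"
    by (rule eventually_right_0_nonneg) (use assms in \<open>simp add: S_scale S_diff S_S add.commute\<close>)
  ultimately have "((\<lambda>r. quot (S t f) r) \<longlongrightarrow> S t (A f)) (at_right 0)"
    by (rule Lim_transform_eventually)
  then show "S t f \<in> gdom" "A (S t f) = S t (A f)" by (rule generatorI)+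
qed

lemma S_integral:
  assumes "f \<in> gdom" "0 \<le> t"
  shows "S t f - f = integral {0..t} (\<lambda>r. S r (A f))"
proof -
  have "S t f - S 0 f = integral {0..t} (\<lambda>r. S r (A f))"
  proof (rule right_derivative_integral[OF assms(2)])
    fix s :: real assume s: "0 \<le> s" "s < t"
    have "((\<lambda>r. quot (S s f) r) \<longlongrightarrow> S s (A f)) (at_right 0)"
      using generator_tendsto[OF dom_S[OF assms(1) s(1)]] generator_S[OF assms(1) s(1)] by simp
    moreover have "\<forall>\<^sub>F r in at_right 0. quot (S s f) r = (S (s + r) f - S s f) /\<^sub>R r"
      by (rule eventually_right_0_nonneg) (use s in \<open>simp add: S_S add.commute\<close>)
    ultimately have "((\<lambda>r. (S (s + r) f - S s f) /\<^sub>R r) \<longlongrightarrow> S s (A f)) (at_right 0)"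
      by (rule Lim_transform_eventually)
    then show "((\<lambda>t. S t f) has_vector_derivative S s (A f)) (at s within {s..t})"
      by (rule has_vector_derivative_right)
  qed (auto intro!: continuous_intros)
  then show ?thesis by simp
qed

lemma norm_S_diff_le:
  assumes "f \<in> gdom" "0 \<le> t" shows "norm (S t f - f) \<le> t * norm (A f)"
proof -
  have "norm (integral {0..t} (\<lambda>r. S r (A f))) \<le> norm (A f) * (t - 0)"
    by (rule integral_bound) (use assms S_contraction in \<open>auto intro!: continuous_intros\<close>)
  then show ?thesis by (simp add: S_integral[OF assms] mult.commute)
qed

text \<open>S_r commutes with the S_q, so the difference quotient of the integral is the integral of
  S_q applied to that of f; it converges because the S_q are contractions. These integrals are the
  smoothing behind \<open>twice_differentiable_dense\<close>.\<close>

lemma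
  assumes f: "f \<in> gdom" and "0 \<le> t"
  shows dom_integral: "integral {0..t} (\<lambda>q. S q f) \<in> gdom"
    and generator_integral: "A (integral {0..t} (\<lambda>q. S q f)) = S t f - f"
proof -
  let ?g = "integral {0..t} (\<lambda>q. S q f)"
  have int: "(\<lambda>q. S q v) integrable_on {0..t}" for v
    by (intro integrable_continuous_real continuous_intros) auto
  have eq: "quot ?g r = integral {0..t} (\<lambda>q. S q (quot f r))" if "0 < r" for r
  proof -
    have "S r ?g = integral {0..t} (\<lambda>q. S r (S q f))"
      using integral_linear[OF int S_linear[of r]] that by (simp add: o_def)
    also have "\<dots> = integral {0..t} (\<lambda>q. S q (S r f))"
      using that by (intro integral_cong) (simp add: S_S add.commute)
    finally have "S r ?g - ?g = integral {0..t} (\<lambda>q. S q (S r f) - S q f)"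
      by (simp add: integral_diff int)
    then show ?thesis
      using that by (simp flip: integral_cmul) (intro integral_cong, simp add: S_scale S_diff)
  qed
  have "((\<lambda>r. integral {0..t} (\<lambda>q. S q (quot f r)) - integral {0..t} (\<lambda>q. S q (A f)))
      \<longlongrightarrow> 0) (at_right 0)"
  proof (rule Lim_null_comparison)
    have "norm (integral {0..t} (\<lambda>q. S q v) - integral {0..t} (\<lambda>q. S q w)) \<le> norm (v - w) * t" for v w
    proof -
      have "norm (integral {0..t} (\<lambda>q. S q (v - w))) \<le> norm (v - w) * (t - 0)"
        by (rule integral_bound) (use assms S_contraction in \<open>auto intro!: continuous_intros\<close>)
      moreover have "integral {0..t} (\<lambda>q. S q (v - w)) = integral {0..t} (\<lambda>q. S q v - S q w)"
        by (intro integral_cong) (simp add: S_diff)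
      ultimately show ?thesis by (simp add: integral_diff int)
    qed
    then show "\<forall>\<^sub>F r in at_right 0. norm (integral {0..t} (\<lambda>q. S q (quot f r))
        - integral {0..t} (\<lambda>q. S q (A f))) \<le> norm (quot f r - A f) * t"
      by (intro always_eventually) blast
    show "((\<lambda>r. norm (quot f r - A f) * t) \<longlongrightarrow> 0) (at_right 0)"
      by (intro tendsto_mult_left_zero tendsto_norm_zero LIM_zero generator_tendsto f)
  qed
  then have "((\<lambda>r. integral {0..t} (\<lambda>q. S q (quot f r))) \<longlongrightarrow> S t f - f) (at_right 0)"
    using S_integral[OF assms] by (auto dest: LIM_zero_cancel)
  moreover have "\<forall>\<^sub>F r in at_right 0. integral {0..t} (\<lambda>q. S q (quot f r)) = quot ?g r"
    by (rule eventually_right_0_nonneg) (simp add: eq)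
  ultimately have "((\<lambda>r. quot ?g r) \<longlongrightarrow> S t f - f) (at_right 0)"
    by (rule Lim_transform_eventually)
  then show "?g \<in> gdom" "A ?g = S t f - f" by (rule generatorI)+
qed

text \<open>\<open>m\<close> plays the law at time \<open>s\<close> of the process started in \<mu>,
  seen only through integrals of continuous functions. It will dominate the tilted functional in
  \<open>path_measure_exists\<close>.\<close>

definition propagates :: "'a measure \<Rightarrow> real \<Rightarrow> 'a measure \<Rightarrow> bool"
  where "propagates \<mu> s m \<longleftrightarrow> sets m = sets borel \<and> finite_measure m \<and>
    (\<forall>v. (\<integral>x. apply_bcontfun v x \<partial>m) = (\<integral>x. apply_bcontfun (S s v) x \<partial>\<mu>))"

text \<open>The positive minimum principle: at a zero of f the difference quotient is S_r f(x) / r,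
  which is nonnegative.\<close>

lemma generator_at_minimum:
  assumes "f \<in> gdom" "\<And>y. 0 \<le> apply_bcontfun f y" "f x = 0"
  shows "0 \<le> A f x"
proof (rule tendsto_lowerbound)
  show "((\<lambda>r. ((S r f - f) /\<^sub>R r) x) \<longlongrightarrow> A f x) (at_right 0)"
    by (rule bounded_linear.tendsto[OF bounded_linear_apply generator_tendsto[OF assms(1)]])
  show "\<forall>\<^sub>F r in at_right 0. 0 \<le> ((S r f - f) /\<^sub>R r) x"
    by (rule eventually_right_0_nonneg) (use assms in \<open>simp add: S_pos\<close>)
qed simp

end

section \<open>Perturbation by a nonnegative potential\<close>

text \<open>
  The perturbed evolution \<open>\<Lambda>\<^sub>s\<close> solves the Duhamel equation
  \<open>\<Lambda>\<^sub>s v = \<Lambda>\<^sub>0 (S s v) + \<integral>\<^sub>0\<^sup>s \<Lambda>\<^sub>q (B\<^sub>q S(s-q) v) dq\<close>; with \<open>B \<ge> 0\<close> all terms of its Dyson series are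
  positive.
\<close>
locale perturbed_semigroup = markov_semigroup S
  for S :: "real \<Rightarrow> 'a::metric_space cfun \<Rightarrow> 'a cfun" +
  fixes B :: "real \<Rightarrow> 'a cfun" and \<beta> :: real and \<Lambda>0 :: "'a cfun \<Rightarrow> real"
  assumes B_cont: "continuous_on {0..} B"
    and B_nonneg: "\<And>s x. 0 \<le> s \<Longrightarrow> 0 \<le> apply_bcontfun (B s) x"
    and B_le: "\<And>s x. 0 \<le> s \<Longrightarrow> apply_bcontfun (B s) x \<le> \<beta>"
    and \<Lambda>0_add: "\<And>v w. \<Lambda>0 (v + w) = \<Lambda>0 v + \<Lambda>0 w"
    and \<Lambda>0_scale: "\<And>c v. \<Lambda>0 (c *\<^sub>R v) = c * \<Lambda>0 v"
    and \<Lambda>0_pos: "\<And>v. (\<forall>x. 0 \<le> apply_bcontfun v x) \<Longrightarrow> 0 \<le> \<Lambda>0 v"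
begin

abbreviation one :: "'a cfun" where "one \<equiv> const_bcontfun 1"

lemma \<beta>_nonneg: "0 \<le> \<beta>"
  using order_trans[OF B_nonneg[of 0] B_le[of 0]] by simp

lemma \<Lambda>0_diff: "\<Lambda>0 (v - w) = \<Lambda>0 v - \<Lambda>0 w"
  using \<Lambda>0_add[of "v - w" w] by simp

lemma \<Lambda>0_mono:
  assumes "\<And>x. apply_bcontfun v x \<le> apply_bcontfun w x" shows "\<Lambda>0 v \<le> \<Lambda>0 w"
  using \<Lambda>0_pos[of "w - v"] assms by (simp add: \<Lambda>0_diff)

lemma \<Lambda>0_one_nonneg: "0 \<le> \<Lambda>0 one"
  by (rule \<Lambda>0_pos) simp

lemma \<Lambda>0_bound: "\<bar>\<Lambda>0 v\<bar> \<le> \<Lambda>0 one * norm v"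
  by (rule positive_functional_bound[OF \<Lambda>0_add \<Lambda>0_scale \<Lambda>0_pos])

lemma norm_B: "0 \<le> s \<Longrightarrow> norm (B s) \<le> \<beta>"
  by (rule norm_bcontfun_le_nonneg) (auto simp: B_nonneg B_le)

abbreviation source :: "real \<Rightarrow> 'a cfun \<Rightarrow> real \<Rightarrow> 'a cfun"
  where "source s v q \<equiv> bmult (B q) (S (s - q) v)"

text \<open>The term with n insertions of B; in the recursion q is the time of the last insertion,
  after which S runs undisturbed.\<close>

primrec dyson :: "nat \<Rightarrow> real \<Rightarrow> 'a cfun \<Rightarrow> real" where
  "dyson 0 s v = \<Lambda>0 (S s v)"
| "dyson (Suc n) s v = integral {0..s} (\<lambda>q. dyson n q (source s v q))"

text \<open>The invariant carried through the Dyson recursion and on to its sum. The bound is by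
  \<open>\<Lambda>0 (S s v)\<close> and not merely by the norm of v, because it must later produce a
  dominating measure.\<close>

definition evolution_bound :: "(real \<Rightarrow> 'a cfun \<Rightarrow> real) \<Rightarrow> (real \<Rightarrow> real) \<Rightarrow> bool"
  where "evolution_bound L c \<longleftrightarrow>
    (\<forall>s\<ge>0. \<forall>v w. L s (v + w) = L s v + L s w) \<and>
    (\<forall>s\<ge>0. \<forall>a v. L s (a *\<^sub>R v) = a * L s v) \<and>
    (\<forall>s\<ge>0. \<forall>v. (\<forall>x. 0 \<le> apply_bcontfun v x) \<longrightarrow> 0 \<le> L s v \<and> L s v \<le> c s * \<Lambda>0 (S s v)) \<and>
    (\<forall>v. continuous_on {0..} (\<lambda>s. L s v))"

lemma evolution_boundD:
  assumes "evolution_bound L c"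
  shows "0 \<le> s \<Longrightarrow> L s (v + w) = L s v + L s w"
    and "0 \<le> s \<Longrightarrow> L s (a *\<^sub>R v) = a * L s v"
    and "0 \<le> s \<Longrightarrow> (\<And>x. 0 \<le> apply_bcontfun v x) \<Longrightarrow> 0 \<le> L s v"
    and "0 \<le> s \<Longrightarrow> (\<And>x. 0 \<le> apply_bcontfun v x) \<Longrightarrow> L s v \<le> c s * \<Lambda>0 (S s v)"
    and "continuous_on {0..} (\<lambda>s. L s v)"
  using assms unfolding evolution_bound_def by blast+

lemma evolution_bound_diff:
  assumes "evolution_bound L c" "0 \<le> s" shows "L s (v - w) = L s v - L s w"
  using evolution_boundD(1)[OF assms, of "v - w" w] by simp

lemma evolution_bound_abs:
  assumes "evolution_bound L c" "0 \<le> s" shows "\<bar>L s v\<bar> \<le> c s * \<Lambda>0 one * norm v"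
proof -
  have "\<bar>L s v\<bar> \<le> L s one * norm v"
    by (rule positive_functional_bound) (use evolution_boundD[OF assms(1)] assms(2) in auto)
  also have "\<dots> \<le> c s * \<Lambda>0 one * norm v"
    using evolution_boundD(4)[OF assms, of one] S_one[OF assms(2)] by (intro mult_right_mono) auto
  finally show ?thesis .
qed

lemma evolution_bound_continuous:
  assumes L: "evolution_bound L c" and c: "mono_on {0..} c" and I: "I \<subseteq> {0..T}"
    and w: "continuous_on I w"
  shows "continuous_on I (\<lambda>q. L q (w q))"
proof (rule continuous_on_pairing[OF _ _ _ w])
  fix q assume "q \<in> I"
  then have q: "0 \<le> q" "q \<le> T" using I by auto
  show "L q (v - w) = L q v - L q w" for v w by (rule evolution_bound_diff[OF L q(1)])
  have "c q \<le> c T" using q by (intro mono_onD[OF c]) auto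
  then show "\<bar>L q v\<bar> \<le> (c T * \<Lambda>0 one) * norm v" for v
    using order_trans[OF evolution_bound_abs[OF L q(1)] mult_right_mono[OF mult_right_mono]]
      \<Lambda>0_one_nonneg by simp
next
  show "continuous_on I (\<lambda>q. L q v)" for v
    by (rule continuous_on_subset[OF evolution_boundD(5)[OF L]]) (use I in auto)
qed

lemma continuous_on_integrand:
  assumes L: "evolution_bound L c" "mono_on {0..} c" and "0 \<le> a" "b \<le> s"
  shows "continuous_on {a..b} (\<lambda>q. L q (source s v q))"
proof (rule evolution_bound_continuous[OF L])
  show "{a..b} \<subseteq> {0..b}" using assms by auto
  show "continuous_on {a..b} (\<lambda>q. source s v q)"
    by (intro continuous_on_bmult continuous_on_subset[OF B_cont] continuous_intros)
      (use assms in auto)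
qed

lemma integrable_integrand:
  assumes "evolution_bound L c" "mono_on {0..} c" "0 \<le> a" "b \<le> s"
  shows "(\<lambda>q. L q (source s v q)) integrable_on {a..b}"
  by (intro integrable_continuous_real continuous_on_integrand[OF assms])

text \<open>From B \<le> \<beta> and S_q S_(s-q) = S_s the integrand is at most \<beta> c(q) times
  \<open>\<Lambda>0 (S s v)\<close>, whence the equation between \<open>c\<close> and
  \<open>c'\<close>.\<close>

lemma evolution_bound_Suc:
  assumes L: "evolution_bound L c" "mono_on {0..} c" and c_nonneg: "\<And>s. 0 \<le> s \<Longrightarrow> 0 \<le> c s"
    and c': "\<And>s. 0 \<le> s \<Longrightarrow> ((\<lambda>q. \<beta> * c q) has_integral c' s) {0..s}"
    and c'_mono: "mono_on {0..} c'"
  shows "evolution_bound (\<lambda>s v. integral {0..s} (\<lambda>q. L q (source s v q))) c'"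
proof -
  define F where "F s v = integral {0..s} (\<lambda>q. L q (source s v q))" for s v
  note int = integrable_integrand[OF L]
  have add: "F s (v + w) = F s v + F s w" if "0 \<le> s" for s v w
  proof -
    have "F s (v + w) = integral {0..s} (\<lambda>q. L q (source s v q) + L q (source s w q))"
      unfolding F_def
      by (intro integral_cong) (simp add: S_add bmult_add_right evolution_boundD(1)[OF L(1)])
    then show ?thesis using int by (simp add: F_def integral_add)
  qed
  have scale: "F s (a *\<^sub>R v) = a * F s v" if "0 \<le> s" for s a v
  proof -
    have "F s (a *\<^sub>R v) = integral {0..s} (\<lambda>q. a * L q (source s v q))"
      unfolding F_def
      by (intro integral_cong) (simp add: S_scale bmult_scale_right evolution_boundD(2)[OF L(1)])
    then show ?thesis by (simp add: F_def)
  qed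
  have pos: "0 \<le> F s v \<and> F s v \<le> c' s * \<Lambda>0 (S s v)"
    if s: "0 \<le> s" and v: "\<And>x. 0 \<le> apply_bcontfun v x" for s v
  proof
    have w: "0 \<le> source s v q x" if "q \<in> {0..s}" for q x
      using that v by (simp add: bmult_apply B_nonneg S_pos)
    show "0 \<le> F s v" unfolding F_def
      by (intro integral_nonneg int order_refl) (auto intro!: evolution_boundD(3)[OF L(1)] w)
    have hi: "((\<lambda>q. \<beta> * c q * \<Lambda>0 (S s v)) has_integral c' s * \<Lambda>0 (S s v)) {0..s}"
      by (rule has_integral_mult_left[OF c'[OF s]])
    have "F s v \<le> integral {0..s} (\<lambda>q. \<beta> * c q * \<Lambda>0 (S s v))"
      unfolding F_def
    proof (rule integral_le)
      fix q assume q: "q \<in> {0..s}"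
      have "L q (source s v q) \<le> c q * \<Lambda>0 (S q (source s v q))"
        by (rule evolution_boundD(4)[OF L(1)]) (use q w in auto)
      also have "\<Lambda>0 (S q (source s v q)) \<le> \<Lambda>0 (S q (\<beta> *\<^sub>R S (s - q) v))"
        using q v by (intro \<Lambda>0_mono S_mono) (auto simp: bmult_apply B_le S_pos intro!: mult_right_mono)
      also have "\<Lambda>0 (S q (\<beta> *\<^sub>R S (s - q) v)) = \<beta> * \<Lambda>0 (S s v)"
        using q by (simp add: S_scale S_S \<Lambda>0_scale)
      finally show "L q (source s v q) \<le> \<beta> * c q * \<Lambda>0 (S s v)"
        using c_nonneg[of q] q by (simp add: mult_left_mono mult.assoc mult.left_commute)
    qed (use int s hi in \<open>auto simp: has_integral_iff\<close>)
    then show "F s v \<le> c' s * \<Lambda>0 (S s v)" by (simp only: integral_unique[OF hi])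
  qed
  have abs: "\<bar>F s v\<bar> \<le> c' s * \<Lambda>0 one * norm v" if s: "0 \<le> s" for s v
  proof -
    have "\<bar>F s v\<bar> \<le> F s one * norm v"
      by (rule positive_functional_bound) (use add scale pos s in auto)
    also have "\<dots> \<le> c' s * \<Lambda>0 one * norm v"
      using pos[OF s, of one] S_one[OF s] by (intro mult_right_mono) auto
    finally show ?thesis .
  qed
  have cont: "continuous_on {0..} (\<lambda>s. F s v)" for v
  proof (rule continuous_on_of_modulus)
    fix T :: real assume T: "0 \<le> T"
    define K K' where "K = c' T * \<Lambda>0 one" and "K' = c T * \<Lambda>0 one * (\<beta> * norm v)"
    \<comment> \<open>Between times a and b the integral changes in two ways: on {0..a} the argument
      v becomes S_(b-a) v, and the interval {a..b} is added.\<close>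
    define \<omega> where "\<omega> r = K * norm (S r v - v) + K' * r" for r
    have "((\<lambda>r. K * norm (S r v - v) + K' * r) \<longlongrightarrow> K * norm (v - v) + K' * 0) (at_right 0)"
      by (intro tendsto_intros S_tendsto_0)
    then have lim: "(\<omega> \<longlongrightarrow> 0) (at_right 0)" by (simp add: \<omega>_def[abs_def])
    have "norm (F b v - F a v) \<le> \<omega> (b - a)" if ab: "0 \<le> a" "a \<le> b" "b \<le> T" for a b
    proof -
      have "F b v = integral {0..a} (\<lambda>q. L q (source b v q))
          + integral {a..b} (\<lambda>q. L q (source b v q))"
        unfolding F_def
        by (rule Henstock_Kurzweil_Integration.integral_combine[symmetric]) (use ab int in auto)
      moreover have "integral {0..a} (\<lambda>q. L q (source b v q)) = F a (S (b - a) v)"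
        unfolding F_def using ab by (intro integral_cong) (simp add: S_S)
      ultimately have eq: "F b v - F a v = F a (S (b - a) v - v)
          + integral {a..b} (\<lambda>q. L q (source b v q))"
        using add[OF ab(1), of "S (b - a) v - v" v] by simp
      have "\<bar>F a (S (b - a) v - v)\<bar> \<le> c' a * \<Lambda>0 one * norm (S (b - a) v - v)" by (rule abs[OF ab(1)])
      also have "\<dots> \<le> K * norm (S (b - a) v - v)"
        unfolding K_def using ab \<Lambda>0_one_nonneg
        by (intro mult_right_mono mono_onD[OF c'_mono]) auto
      finally have 1: "\<bar>F a (S (b - a) v - v)\<bar> \<le> K * norm (S (b - a) v - v)" .
      have "norm (integral {a..b} (\<lambda>q. L q (source b v q))) \<le> K' * (b - a)"
      proof (rule integral_bound[OF ab(2)])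
        show "continuous_on {a..b} (\<lambda>q. L q (source b v q))"
          by (rule continuous_on_integrand[OF L ab(1)]) simp
        fix q assume q: "q \<in> {a..b}"
        then have q0: "0 \<le> q" "q \<le> T" using ab by auto
        have "\<bar>L q (source b v q)\<bar> \<le> c q * \<Lambda>0 one * norm (source b v q)"
          by (rule evolution_bound_abs[OF L(1) q0(1)])
        also have "\<dots> \<le> c T * \<Lambda>0 one * (\<beta> * norm v)"
        proof (intro mult_mono)
          show "c q \<le> c T" using q0 by (intro mono_onD[OF L(2)]) auto
          show "norm (source b v q) \<le> \<beta> * norm v"
            using norm_B[OF q0(1)] S_contraction[of "b - q" v] q \<beta>_nonneg
            by (intro order_trans[OF norm_bmult_le] mult_mono) auto
        qed (use \<Lambda>0_one_nonneg \<beta>_nonneg c_nonneg T q0 in auto)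
        finally show "norm (L q (source b v q)) \<le> K'" by (simp add: K'_def)
      qed
      with 1 show ?thesis unfolding eq \<omega>_def real_norm_def by linarith
    qed
    with lim show "\<exists>\<omega>. (\<omega> \<longlongrightarrow> 0) (at_right 0) \<and>
        (\<forall>a b. 0 \<le> a \<longrightarrow> a \<le> b \<longrightarrow> b \<le> T \<longrightarrow> norm (F b v - F a v) \<le> \<omega> (b - a))" by blast
  qed
  show ?thesis
    unfolding evolution_bound_def F_def[symmetric] using add scale pos cont by blast
qed

text \<open>Iterated integrals of \<beta>, starting from 1; they sum to exp(\<beta> s).\<close>

definition coef :: "nat \<Rightarrow> real \<Rightarrow> real" where "coef n s = (\<beta> * s) ^ n / fact n"

lemma coef_nonneg: "0 \<le> s \<Longrightarrow> 0 \<le> coef n s"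
  by (simp add: coef_def \<beta>_nonneg)

lemma coef_mono: "mono_on {0..} (coef n)"
  unfolding coef_def by (intro mono_onI divide_right_mono power_mono mult_left_mono) (auto simp: \<beta>_nonneg)

lemma dyson_bound: "evolution_bound (dyson n) (coef n)"
proof (induction n)
  case 0
  show ?case
    unfolding evolution_bound_def
  proof (intro conjI allI impI)
    show "continuous_on {0..} (\<lambda>s. dyson 0 s v)" for v
      unfolding dyson.simps
      by (rule continuous_on_pairing[where I = "{0..}", OF _ _ _ S_continuous])
        (auto simp: \<Lambda>0_diff intro!: \<Lambda>0_bound)
  qed (auto simp: S_add S_scale \<Lambda>0_add \<Lambda>0_scale S_pos coef_def intro!: \<Lambda>0_pos)
next
  case (Suc n)
  have "((\<lambda>q. \<beta> * coef n q) has_integral coef (Suc n) s) {0..s}" if "0 \<le> s" for s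
  proof -
    have "((\<lambda>q. \<beta> * coef n q) has_integral coef (Suc n) s - coef (Suc n) 0) {0..s}"
    proof (rule fundamental_theorem_of_calculus[OF that])
      fix q
      have "((\<lambda>q. (\<beta> * q) ^ Suc n / fact (Suc n)) has_real_derivative
          real (Suc n) * (\<beta> * q) ^ n * \<beta> / fact (Suc n)) (at q within {0..s})"
        by (rule DERIV_cdivide, (rule derivative_eq_intros refl)+) (simp del: of_nat_Suc)
      also have "real (Suc n) * (\<beta> * q) ^ n * \<beta> / fact (Suc n) = \<beta> * coef n q"
        by (simp add: coef_def del: of_nat_Suc)
      finally show "(coef (Suc n) has_vector_derivative \<beta> * coef n q) (at q within {0..s})"
        by (simp only: has_real_derivative_iff_has_vector_derivative coef_def[abs_def])
    qed
    then show ?thesis by (simp add: coef_def)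
  qed
  then show ?case unfolding dyson.simps
    by (intro evolution_bound_Suc[OF Suc coef_mono] coef_mono) (simp_all add: coef_nonneg)
qed

definition \<Lambda> :: "real \<Rightarrow> 'a cfun \<Rightarrow> real"
  where "\<Lambda> s v = (\<Sum>n. dyson n s v)"

lemma coef_sums: "(\<lambda>n. coef n s) sums exp (\<beta> * s)"
  using exp_converges[of "\<beta> * s"] by (simp add: coef_def divide_inverse mult.commute)

lemma dyson_abs:
  assumes "0 \<le> s" "s \<le> T" shows "norm (dyson n s v) \<le> coef n T * (\<Lambda>0 one * norm v)"
proof -
  have "coef n s \<le> coef n T" using assms by (intro mono_onD[OF coef_mono]) auto
  then have "coef n s * (\<Lambda>0 one * norm v) \<le> coef n T * (\<Lambda>0 one * norm v)"
    using \<Lambda>0_one_nonneg by (intro mult_right_mono) auto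
  then show ?thesis using evolution_bound_abs[OF dyson_bound assms(1), of n v] by (simp add: mult.assoc)
qed

lemma dyson_summable: "0 \<le> s \<Longrightarrow> summable (\<lambda>n. dyson n s v)"
  by (rule summable_comparison_test'[of "\<lambda>n. coef n s * (\<Lambda>0 one * norm v)" 0])
    (auto intro!: summable_mult2 sums_summable[OF coef_sums] dyson_abs simp del: real_norm_def)

lemma \<Lambda>_evolution_bound: "evolution_bound \<Lambda> (\<lambda>s. exp (\<beta> * s))"
  unfolding evolution_bound_def
proof (intro conjI allI impI)
  fix s :: real and v w :: "'a cfun" and a :: real assume s: "0 \<le> s"
  show "\<Lambda> s (v + w) = \<Lambda> s v + \<Lambda> s w"
    unfolding \<Lambda>_def
    by (simp add: evolution_boundD(1)[OF dyson_bound s] suminf_add[symmetric] dyson_summable s del: dyson.simps)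
  show "\<Lambda> s (a *\<^sub>R v) = a * \<Lambda> s v"
    unfolding \<Lambda>_def
    by (simp add: evolution_boundD(2)[OF dyson_bound s] suminf_mult dyson_summable s del: dyson.simps)
  assume v: "\<forall>x. 0 \<le> apply_bcontfun v x"
  show "0 \<le> \<Lambda> s v"
    unfolding \<Lambda>_def
    by (rule suminf_nonneg) (use v in \<open>auto intro!: dyson_summable s evolution_boundD(3)[OF dyson_bound s] simp del: dyson.simps\<close>)
  have "(\<lambda>n. coef n s * \<Lambda>0 (S s v)) sums (exp (\<beta> * s) * \<Lambda>0 (S s v))"
    by (intro sums_mult2 coef_sums)
  moreover have "dyson n s v \<le> coef n s * \<Lambda>0 (S s v)" for n
    by (rule evolution_boundD(4)[OF dyson_bound s]) (use v in blast)
  ultimately show "\<Lambda> s v \<le> exp (\<beta> * s) * \<Lambda>0 (S s v)"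
    unfolding \<Lambda>_def by (intro sums_le[OF _ summable_sums[OF dyson_summable[OF s]]])
next
  fix v :: "'a cfun"
  \<comment> \<open>The series converges uniformly only on bounded times. The half-open interval
    {0..<p+1} is a neighbourhood of p relative to {0..}, which lets continuity pass to the
    half-line.\<close>
  have "continuous_on {0..<T} (\<lambda>s. \<Lambda> s v)" for T :: real
  proof (rule uniform_limit_theorem[of _ "\<lambda>N s. \<Sum>n<N. dyson n s v" sequentially])
    show "\<forall>\<^sub>F N in sequentially. continuous_on {0..<T} (\<lambda>s. \<Sum>n<N. dyson n s v)"
      by (intro always_eventually allI continuous_on_sum continuous_on_subset[OF evolution_boundD(5)[OF dyson_bound]]) auto
    show "uniform_limit {0..<T} (\<lambda>N s. \<Sum>n<N. dyson n s v) (\<lambda>s. \<Lambda> s v) sequentially"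
      unfolding \<Lambda>_def
      by (rule Weierstrass_m_test[of _ _ "\<lambda>n. coef n T * (\<Lambda>0 one * norm v)"])
        (auto intro!: dyson_abs summable_mult2 sums_summable[OF coef_sums] simp del: dyson.simps real_norm_def)
  qed simp
  then show "continuous_on {0..} (\<lambda>s. \<Lambda> s v)"
    unfolding continuous_on_eq_continuous_within
  proof (intro ballI)
    fix p :: real assume *: "\<And>T. \<forall>x\<in>{0..<T}. continuous (at x within {0..<T}) (\<lambda>s. \<Lambda> s v)" and p: "p \<in> {0..}"
    have "at p within {0..<p + 1} = at p within {0..}"
      using p by (intro at_within_nhd[of _ "{p - 1<..<p + 1}"]) auto
    moreover have "continuous (at p within {0..<p + 1}) (\<lambda>s. \<Lambda> s v)" using * p by simp
    ultimately show "continuous (at p within {0..}) (\<lambda>s. \<Lambda> s v)" by (simp only:)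
  qed
qed

lemma exp_mono: "mono_on {0..} (\<lambda>s. exp (\<beta> * s))"
  by (intro mono_onI) (auto intro!: mult_left_mono \<beta>_nonneg)

lemmas \<Lambda>_add = evolution_boundD(1)[OF \<Lambda>_evolution_bound]
  and \<Lambda>_scale = evolution_boundD(2)[OF \<Lambda>_evolution_bound]
  and \<Lambda>_pos = evolution_boundD(3)[OF \<Lambda>_evolution_bound]
  and \<Lambda>_le = evolution_boundD(4)[OF \<Lambda>_evolution_bound]
  and \<Lambda>_cont = evolution_boundD(5)[OF \<Lambda>_evolution_bound]
  and \<Lambda>_diff = evolution_bound_diff[OF \<Lambda>_evolution_bound]
  and \<Lambda>_continuous = evolution_bound_continuous[OF \<Lambda>_evolution_bound exp_mono]
  and \<Lambda>_integrable = integrable_integrand[OF \<Lambda>_evolution_bound exp_mono]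

section \<open>The Duhamel equation and the forward equation\<close>

lemma \<Lambda>_abs:
  assumes "0 \<le> s" "s \<le> T" shows "\<bar>\<Lambda> s v\<bar> \<le> exp (\<beta> * T) * \<Lambda>0 one * norm v"
  using evolution_bound_abs[OF \<Lambda>_evolution_bound assms(1), of v] assms \<beta>_nonneg \<Lambda>0_one_nonneg
  by (elim order_trans) (auto intro!: mult_right_mono mult_left_mono)

lemma \<Lambda>_0: "\<Lambda> 0 v = \<Lambda>0 v"
proof -
  have "dyson n 0 v = 0" if "n \<noteq> 0" for n using that by (cases n) auto
  then have "(\<Sum>n. dyson n 0 v) = (\<Sum>n\<in>{0}. dyson n 0 v)" by (intro suminf_finite) auto
  then show ?thesis by (simp add: \<Lambda>_def)
qed

text \<open>On {0..s} the Dyson series of the integrand converges uniformly and may be integrated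
  term by term; each integration raises the index by one, so only the term of index 0 is left
  over.\<close>

lemma duhamel:
  assumes s: "0 \<le> s"
  shows "\<Lambda> s v = \<Lambda>0 (S s v) + integral {0..s} (\<lambda>q. \<Lambda> q (source s v q))"
proof -
  let ?w = "\<lambda>q. source s v q"
  have unif: "uniform_limit {0..s} (\<lambda>N q. \<Sum>n<N. dyson n q (?w q)) (\<lambda>q. \<Lambda> q (?w q)) sequentially"
    unfolding \<Lambda>_def
  proof (rule Weierstrass_m_test[of _ _ "\<lambda>n. coef n s * (\<Lambda>0 one * (\<beta> * norm v))"])
    fix n q assume q: "q \<in> {0..s}"
    have "norm (?w q) \<le> \<beta> * norm v"
      using norm_B[of q] S_contraction[of "s - q" v] q \<beta>_nonneg
      by (intro order_trans[OF norm_bmult_le] mult_mono) auto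
    then have "coef n s * (\<Lambda>0 one * norm (?w q)) \<le> coef n s * (\<Lambda>0 one * (\<beta> * norm v))"
      using \<Lambda>0_one_nonneg coef_nonneg[OF s] by (intro mult_left_mono) auto
    with dyson_abs[of q s n "?w q"] q show "norm (dyson n q (?w q)) \<le> coef n s * (\<Lambda>0 one * (\<beta> * norm v))"
      by auto
  qed (auto intro!: summable_mult2 sums_summable[OF coef_sums])
  have cont: "continuous_on {0..s} (\<lambda>q. dyson n q (?w q))" for n
    by (rule continuous_on_integrand[OF dyson_bound coef_mono]) auto
  obtain I J where IJ: "\<And>N. ((\<lambda>q. \<Sum>n<N. dyson n q (?w q)) has_integral I N) {0..s}"
    "((\<lambda>q. \<Lambda> q (?w q)) has_integral J) {0..s}" "I \<longlonglongrightarrow> J"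
    by (rule uniform_limit_integral[OF unif]) (auto intro!: continuous_on_sum cont)
  have "I N = (\<Sum>n<N. dyson (Suc n) s v)" for N
    using IJ(1)[of N] cont
    by (auto simp: has_integral_iff integral_sum integrable_continuous_real)
  then have "I = (\<lambda>N. \<Sum>n<N. dyson (Suc n) s v)" by blast
  then have "(\<lambda>n. dyson (Suc n) s v) sums J" using IJ(3) unfolding sums_def by (simp only:)
  then have "(\<lambda>n. dyson n s v) sums (J + dyson 0 s v)" by (rule sums_Suc)
  then have "\<Lambda> s v = J + dyson 0 s v" by (simp only: \<Lambda>_def sums_iff)
  then show ?thesis using IJ(2) by (simp add: has_integral_iff)
qed

text \<open>Duhamel restarted at time s: the part of the integral before s is the one occurring in
  \<Lambda>_s(S_r v), since S_(s+r-q) v = S_(s-q) S_r v there. Only an integral over {s..s+r}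
  remains for the difference quotient.\<close>

lemma cocycle:
  assumes s: "0 \<le> s" and r: "0 \<le> r"
  shows "\<Lambda> (s + r) v = \<Lambda> s (S r v) + integral {s..s + r} (\<lambda>q. \<Lambda> q (source (s + r) v q))"
proof -
  have "integral {0..s + r} (\<lambda>q. \<Lambda> q (source (s + r) v q))
      = integral {0..s} (\<lambda>q. \<Lambda> q (source (s + r) v q))
        + integral {s..s + r} (\<lambda>q. \<Lambda> q (source (s + r) v q))"
    by (rule Henstock_Kurzweil_Integration.integral_combine[symmetric]) (use s r \<Lambda>_integrable in auto)
  moreover have "integral {0..s} (\<lambda>q. \<Lambda> q (source (s + r) v q))
      = integral {0..s} (\<lambda>q. \<Lambda> q (source s (S r v) q))"
    using s r by (intro integral_cong) (simp add: S_S algebra_simps)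
  ultimately show ?thesis
    using duhamel[of "s + r" v] duhamel[of s "S r v"] s r by (simp add: S_S)
qed

text \<open>By \<open>cocycle\<close> the quotient has three parts: \<Lambda>_s of the quotient of
  S_r v, the mean \<open>J r / r\<close> of \<Lambda>_q(B_q v), and the remainder
  \<open>R r / r\<close>. On {s..s+r} the remainder contains S_(s+r-q) v - v, of norm at most r
  times that of Av, so \<open>R r\<close> is of order r^2.\<close>

lemma \<Lambda>_right_derivative_const:
  assumes v: "v \<in> gdom" and s: "0 \<le> s"
  shows "((\<lambda>r. (\<Lambda> (s + r) v - \<Lambda> s v) / r) \<longlongrightarrow> \<Lambda> s (A v + bmult (B s) v)) (at_right 0)"
proof -
  define K where "K = exp (\<beta> * (s + 1)) * \<Lambda>0 one * (\<beta> * norm (A v))"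
  define J where "J r = integral {s..s + r} (\<lambda>q. \<Lambda> q (bmult (B q) v))" for r
  define R where "R r = integral {s..s + r} (\<lambda>q. \<Lambda> q (bmult (B q) (S (s + r - q) v - v)))" for r
  have contB: "continuous_on {s..s + r} (\<lambda>q. \<Lambda> q (bmult (B q) v))" for r
    by (rule \<Lambda>_continuous[where T = "s + r"])
      (use s in \<open>auto intro!: continuous_on_bmult continuous_on_subset[OF B_cont] continuous_intros\<close>)
  have 1: "((\<lambda>r. \<Lambda> s ((S r v - v) /\<^sub>R r)) \<longlongrightarrow> \<Lambda> s (A v)) (at_right 0)"
  proof (rule bounded_linear.tendsto[OF _ generator_tendsto[OF v]])
    show "bounded_linear (\<Lambda> s)"
      by (rule bounded_linear_intro[of _ "exp (\<beta> * s) * \<Lambda>0 one"])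
        (use \<Lambda>_abs[OF s order_refl] in \<open>auto simp: \<Lambda>_add \<Lambda>_scale s mult.commute\<close>)
  qed
  have 2: "((\<lambda>r. J r / r) \<longlongrightarrow> \<Lambda> s (bmult (B s) v)) (at_right 0)"
  proof -
    have "((\<lambda>u. integral {s..u} (\<lambda>q. \<Lambda> q (bmult (B q) v))) has_real_derivative \<Lambda> s (bmult (B s) v))
        (at s within {s..s + 1})"
      by (rule integral_has_real_derivative[OF contB]) auto
    then have "((\<lambda>y. (integral {s..y} (\<lambda>q. \<Lambda> q (bmult (B q) v))) / (y - s)) \<longlongrightarrow> \<Lambda> s (bmult (B s) v))
        (at s within {s..s + 1})"
      by (simp add: has_field_derivative_iff)
    moreover have "filterlim ((+) s) (at s within {s..s + 1}) (at_right 0)"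
      by (rule filterlim_shift_at_right[of "1"]) (use s in auto)
    ultimately have "((\<lambda>r. integral {s..s + r} (\<lambda>q. \<Lambda> q (bmult (B q) v)) / (s + r - s))
        \<longlongrightarrow> \<Lambda> s (bmult (B s) v)) (at_right 0)"
      by (rule filterlim_compose)
    then show ?thesis by (simp add: J_def)
  qed
  have R_bound: "norm (R r / r) \<le> K * r" if r: "0 < r" "r < 1" for r
  proof -
    have "norm (R r) \<le> (K * r) * (s + r - s)"
      unfolding R_def
    proof (rule integral_bound)
      show "continuous_on {s..s + r} (\<lambda>q. \<Lambda> q (bmult (B q) (S (s + r - q) v - v)))"
        by (rule \<Lambda>_continuous[where T = "s + r"])
          (use s in \<open>auto intro!: continuous_on_bmult continuous_on_subset[OF B_cont] continuous_intros\<close>)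
      fix q assume q: "q \<in> {s..s + r}"
      have "\<bar>\<Lambda> q (bmult (B q) (S (s + r - q) v - v))\<bar>
          \<le> exp (\<beta> * (s + 1)) * \<Lambda>0 one * norm (bmult (B q) (S (s + r - q) v - v))"
        by (rule \<Lambda>_abs) (use q s r in auto)
      also have "\<dots> \<le> exp (\<beta> * (s + 1)) * \<Lambda>0 one * (\<beta> * (r * norm (A v)))"
      proof (intro mult_left_mono order_trans[OF norm_bmult_le] mult_mono norm_B \<beta>_nonneg norm_ge_zero)
        have "norm (S (s + r - q) v - v) \<le> (s + r - q) * norm (A v)"
          by (rule norm_S_diff_le[OF v]) (use q in auto)
        also have "\<dots> \<le> r * norm (A v)" using q by (intro mult_right_mono) auto
        finally show "norm (S (s + r - q) v - v) \<le> r * norm (A v)" .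
      qed (use q s \<Lambda>0_one_nonneg in auto)
      finally show "norm (\<Lambda> q (bmult (B q) (S (s + r - q) v - v))) \<le> K * r"
        by (simp add: K_def mult_ac)
    qed (use r in auto)
    then show ?thesis using r by (simp add: pos_divide_le_eq)
  qed
  have 3: "((\<lambda>r. R r / r) \<longlongrightarrow> 0) (at_right 0)"
  proof (rule Lim_null_comparison)
    show "\<forall>\<^sub>F r in at_right 0. norm (R r / r) \<le> K * r"
      using eventually_at_right_real[of 0 1] R_bound by (auto elim!: eventually_mono)
    show "((\<lambda>r. K * r) \<longlongrightarrow> 0) (at_right 0)" by (auto intro!: tendsto_eq_intros)
  qed
  have "((\<lambda>r. \<Lambda> s ((S r v - v) /\<^sub>R r) + J r / r + R r / r) \<longlongrightarrow> \<Lambda> s (A v) + \<Lambda> s (bmult (B s) v) + 0) (at_right 0)"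
    by (intro tendsto_add 1 2 3)
  moreover have "\<forall>\<^sub>F r in at_right 0. \<Lambda> s ((S r v - v) /\<^sub>R r) + J r / r + R r / r = (\<Lambda> (s + r) v - \<Lambda> s v) / r"
  proof (rule eventually_right_0_nonneg)
    fix r :: real assume r: "0 < r"
    have int: "(\<lambda>q. \<Lambda> q (bmult (B q) v)) integrable_on {s..s + r}"
      by (intro integrable_continuous_real contB)
    have "R r = integral {s..s + r} (\<lambda>q. \<Lambda> q (source (s + r) v q) - \<Lambda> q (bmult (B q) v))"
      unfolding R_def using s by (intro integral_cong) (simp add: bmult_diff_right \<Lambda>_diff)
    then have "R r + J r = integral {s..s + r} (\<lambda>q. \<Lambda> q (source (s + r) v q))"
      using int \<Lambda>_integrable[OF s order_refl] by (simp add: J_def integral_diff)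
    then have "\<Lambda> (s + r) v = \<Lambda> s (S r v) + (R r + J r)" using cocycle[OF s, of r v] r by simp
    then show "\<Lambda> s ((S r v - v) /\<^sub>R r) + J r / r + R r / r = (\<Lambda> (s + r) v - \<Lambda> s v) / r"
      using r by (simp add: \<Lambda>_scale \<Lambda>_diff s field_simps)
  qed
  ultimately have "((\<lambda>r. (\<Lambda> (s + r) v - \<Lambda> s v) / r) \<longlongrightarrow> \<Lambda> s (A v) + \<Lambda> s (bmult (B s) v) + 0) (at_right 0)"
    by (rule Lim_transform_eventually)
  then show ?thesis by (simp add: \<Lambda>_add s)
qed

text \<open>A product rule for a moving functional and a moving argument, integrated. The increment
  of w is paired with the functional at the later time s + r, where the uniform bound on \<Lambda>
  and its pointwise continuity suffice.\<close>

theorem forward_equation: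
  assumes "0 \<le> T" and w_dom: "\<And>s. s \<in> {0..T} \<Longrightarrow> w s \<in> gdom"
    and w: "continuous_on {0..T} w" and Aw: "continuous_on {0..T} (\<lambda>s. A (w s))"
    and w': "continuous_on {0..T} w'"
    and deriv: "\<And>s. 0 \<le> s \<Longrightarrow> s < T \<Longrightarrow> ((\<lambda>r. (w (s + r) - w s) /\<^sub>R r) \<longlongrightarrow> w' s) (at_right 0)"
  shows "\<Lambda> T (w T) - \<Lambda> 0 (w 0) = integral {0..T} (\<lambda>s. \<Lambda> s (A (w s) + w' s + bmult (B s) (w s)))"
proof (rule right_derivative_integral[OF assms(1)])
  show "continuous_on {0..T} (\<lambda>s. \<Lambda> s (w s))" by (rule \<Lambda>_continuous[OF order_refl w])
  show "continuous_on {0..T} (\<lambda>s. \<Lambda> s (A (w s) + w' s + bmult (B s) (w s)))"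
    by (rule \<Lambda>_continuous[OF order_refl])
      (auto intro!: continuous_on_add Aw w' w continuous_on_bmult continuous_on_subset[OF B_cont])
  fix s assume s: "0 \<le> s" "s < T"
  define K where "K = exp (\<beta> * T) * \<Lambda>0 one"
  have shift: "((\<lambda>r. \<Lambda> (s + r) (w' s)) \<longlongrightarrow> \<Lambda> s (w' s)) (at_right 0)"
  proof -
    have "((\<lambda>u. \<Lambda> u (w' s)) \<longlongrightarrow> \<Lambda> s (w' s)) (at s within {0..})"
      using \<Lambda>_cont[of "w' s"] s by (auto simp: continuous_on_def)
    moreover have "filterlim ((+) s) (at s within {0..}) (at_right 0)"
      by (rule filterlim_shift_at_right[of "1"]) (use s in auto)
    ultimately show ?thesis by (rule filterlim_compose)
  qed
  have rest: "((\<lambda>r. \<Lambda> (s + r) ((w (s + r) - w s) /\<^sub>R r - w' s)) \<longlongrightarrow> 0) (at_right 0)"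
  proof (rule Lim_null_comparison)
    show "\<forall>\<^sub>F r in at_right 0. norm (\<Lambda> (s + r) ((w (s + r) - w s) /\<^sub>R r - w' s))
        \<le> K * norm ((w (s + r) - w s) /\<^sub>R r - w' s)"
      using eventually_at_right_real[of 0 "T - s"] s
      by (auto elim!: eventually_mono intro!: \<Lambda>_abs simp: K_def)
    show "((\<lambda>r. K * norm ((w (s + r) - w s) /\<^sub>R r - w' s)) \<longlongrightarrow> 0) (at_right 0)"
      by (intro tendsto_mult_right_zero tendsto_norm_zero LIM_zero deriv s)
  qed
  have "((\<lambda>r. \<Lambda> (s + r) ((w (s + r) - w s) /\<^sub>R r - w' s) + \<Lambda> (s + r) (w' s) + (\<Lambda> (s + r) (w s) - \<Lambda> s (w s)) / r)
      \<longlongrightarrow> 0 + \<Lambda> s (w' s) + \<Lambda> s (A (w s) + bmult (B s) (w s))) (at_right 0)"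
    by (intro tendsto_add rest shift \<Lambda>_right_derivative_const w_dom) (use s in auto)
  moreover have "\<forall>\<^sub>F r in at_right 0. \<Lambda> (s + r) ((w (s + r) - w s) /\<^sub>R r - w' s) + \<Lambda> (s + r) (w' s)
      + (\<Lambda> (s + r) (w s) - \<Lambda> s (w s)) / r = (\<Lambda> (s + r) (w (s + r)) - \<Lambda> s (w s)) /\<^sub>R r"
    by (rule eventually_right_0_nonneg)
      (use s in \<open>simp add: \<Lambda>_diff \<Lambda>_scale divide_inverse algebra_simps del: scaleR_right_diff_distrib\<close>)
  ultimately have "((\<lambda>r. (\<Lambda> (s + r) (w (s + r)) - \<Lambda> s (w s)) /\<^sub>R r)
      \<longlongrightarrow> 0 + \<Lambda> s (w' s) + \<Lambda> s (A (w s) + bmult (B s) (w s))) (at_right 0)"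
    by (rule Lim_transform_eventually)
  then have "((\<lambda>r. (\<Lambda> (s + r) (w (s + r)) - \<Lambda> s (w s)) /\<^sub>R r)
      \<longlongrightarrow> \<Lambda> s (A (w s) + w' s + bmult (B s) (w s))) (at_right 0)"
    using s by (simp add: \<Lambda>_add algebra_simps)
  then show "((\<lambda>s. \<Lambda> s (w s)) has_vector_derivative \<Lambda> s (A (w s) + w' s + bmult (B s) (w s)))
      (at s within {s..T})"
    by (rule has_vector_derivative_right)
qed

end

section \<open>The core\<close>

lemma smooth_onI:
  assumes "open U" "T \<subseteq> U" "\<And>x. x \<in> T \<Longrightarrow> d 0 x = \<phi> x"
    "\<And>n x. x \<in> U \<Longrightarrow> (d n has_real_derivative d (Suc n) x) (at x)"
  shows "smooth_on T \<phi>"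
  unfolding smooth_on_def using assms by blast

lemma smooth_on_exp: "smooth_on T exp"
  by (rule smooth_onI[of UNIV _ "\<lambda>_. exp"]) (auto intro!: derivative_eq_intros)

lemma smooth_on_const: "smooth_on T (\<lambda>_. c)"
  by (rule smooth_onI[of UNIV _ "\<lambda>n _. if n = 0 then c else 0"]) auto

lemma smooth_on_square: "smooth_on T (\<lambda>x. x\<^sup>2)"
proof (rule smooth_onI[of UNIV _ "\<lambda>n x. if n = 0 then x\<^sup>2 else if n = 1 then 2 * x else if n = 2 then 2 else 0"])
  fix n :: nat and x :: real
  consider "n = 0" | "n = 1" | "n = 2" | "n > 2" by linarith
  then show "((\<lambda>x. if n = 0 then x\<^sup>2 else if n = 1 then 2 * x else if n = 2 then 2 else 0) has_real_derivative
      (if Suc n = 0 then x\<^sup>2 else if Suc n = 1 then 2 * x else if Suc n = 2 then 2 else 0)) (at x)"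
    by cases (auto intro!: derivative_eq_intros)
qed auto

definition entropy :: "real \<Rightarrow> real" where "entropy y = (1 + y) * ln (1 + y)"

lemma smooth_on_entropy:
  assumes "T \<subseteq> {-1<..}" shows "smooth_on T entropy"
proof (rule smooth_onI[of "{-1<..}" _ "\<lambda>n. case n of 0 \<Rightarrow> entropy | Suc 0 \<Rightarrow> (\<lambda>y. ln (1 + y) + 1)
    | Suc (Suc k) \<Rightarrow> (\<lambda>y. (- 1) ^ k * fact k * inverse (1 + y) ^ Suc k)"])
  fix n and y :: real assume "y \<in> {-1<..}"
  then have y: "1 + y > 0" by simp
  consider "n = 0" | "n = 1" | k where "n = Suc (Suc k)" by (metis One_nat_def not0_implies_Suc)
  then show "((case n of 0 \<Rightarrow> entropy | Suc 0 \<Rightarrow> (\<lambda>y. ln (1 + y) + 1)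
      | Suc (Suc k) \<Rightarrow> (\<lambda>y. (- 1) ^ k * fact k * inverse (1 + y) ^ Suc k)) has_real_derivative
      (case Suc n of 0 \<Rightarrow> entropy | Suc 0 \<Rightarrow> (\<lambda>y. ln (1 + y) + 1)
      | Suc (Suc k) \<Rightarrow> (\<lambda>y. (- 1) ^ k * fact k * inverse (1 + y) ^ Suc k)) y) (at y)"
  proof cases
    case 1
    then show ?thesis using y unfolding entropy_def[abs_def]
      by (auto intro!: derivative_eq_intros)
  next
    case 2
    then show ?thesis using y by (auto intro!: derivative_eq_intros simp: field_simps)
  next
    case 3
    have inv: "((\<lambda>y. inverse (1 + y)) has_real_derivative - (inverse (1 + y))\<^sup>2) (at y)"
      using y by (auto intro!: derivative_eq_intros simp: power2_eq_square)
    have "real (Suc k) * (- (inverse (1 + y))\<^sup>2 * inverse (1 + y) ^ (Suc k - Suc 0)) * ((- 1) ^ k * fact k)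
        = (- 1) ^ Suc k * fact (Suc k) * inverse (1 + y) ^ Suc (Suc k)"
      by (simp add: power2_eq_square mult_ac del: of_nat_Suc)
    then show ?thesis
      using DERIV_cmult[OF DERIV_power[OF inv, of "Suc k"], of "(- 1) ^ k * fact k"] 3
      by (simp only: nat.case mult.commute)
  qed
qed (use assms in auto)

lemma continuous_map_add_lcs:
  assumes "locally_convex_space D \<tau>" "continuous_map X \<tau> f" "continuous_map X \<tau> g"
  shows "continuous_map X \<tau> (\<lambda>x. f x + g x)"
proof -
  have "continuous_map X (prod_topology \<tau> \<tau>) (\<lambda>x. (f x, g x))"
    by (intro continuous_map_pairedI assms)
  from continuous_map_compose[OF this] assms(1) show ?thesis
    by (fastforce simp: locally_convex_space_def o_def)
qed

lemma continuous_map_scale_lcs: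
  assumes "locally_convex_space D \<tau>" "continuous_map X euclideanreal c" "continuous_map X \<tau> f"
  shows "continuous_map X \<tau> (\<lambda>x. c x *\<^sub>R f x)"
proof -
  have "continuous_map X (prod_topology euclideanreal \<tau>) (\<lambda>x. (c x, f x))"
    by (intro continuous_map_pairedI assms)
  from continuous_map_compose[OF this] assms(1) show ?thesis
    by (fastforce simp: locally_convex_space_def o_def)
qed

locale core_semigroup = markov_semigroup S
  for S :: "real \<Rightarrow> 'a::metric_space cfun \<Rightarrow> 'a cfun" +
  fixes D :: "'a cfun set" and \<tau> :: "'a cfun topology"
  assumes compact_E: "compact (UNIV :: 'a set)" and core: "core_conditions S D \<tau>"
begin

lemma D_gdom: "f \<in> D \<Longrightarrow> f \<in> gdom"
  and D_dense: "closure D = UNIV"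
  and D_graph: "f \<in> gdom \<Longrightarrow> \<exists>F. (\<forall>n. F n \<in> D) \<and> F \<longlonglongrightarrow> f \<and> (\<lambda>n. A (F n)) \<longlonglongrightarrow> A f"
  and D_mult: "f \<in> D \<Longrightarrow> g \<in> D \<Longrightarrow> bmult f g \<in> D"
  and D_comp: "f \<in> D \<Longrightarrow> smooth_on (range (apply_bcontfun f)) \<phi> \<Longrightarrow> bcomp \<phi> f \<in> D"
  and lcs: "locally_convex_space D \<tau>"
  and separable: "separable_space \<tau>"
  and finer: "openin (top_of_set D) U \<Longrightarrow> openin \<tau> U"
  and comp_continuous: "a \<le> 0 \<Longrightarrow> 0 \<le> b \<Longrightarrow> smooth_on {a..b} \<phi> \<Longrightarrow> \<phi> 0 = 0 \<Longrightarrow>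
    continuous_map (subtopology \<tau> {f \<in> D. range (apply_bcontfun f) \<subseteq> {a..b}}) \<tau> (bcomp \<phi>)"
  and A_continuous: "continuous_map \<tau> euclidean A"
proof -
  note c1 = core[unfolded core_conditions_def]
  note c2 = conjunct2[OF c1] note c3 = conjunct2[OF c2] note c4 = conjunct2[OF c3]
  note c5 = conjunct2[OF c4] note c6 = conjunct2[OF c5] note c8 = conjunct2[OF conjunct2[OF c6]]
  note c10 = conjunct2[OF conjunct2[OF c8]] note c11 = conjunct2[OF c10] note c12 = conjunct2[OF c11]
  show "f \<in> D \<Longrightarrow> f \<in> gdom" using conjunct1[OF c1] by (rule subsetD)
  show "closure D = UNIV" by (rule conjunct1[OF c2])
  show "f \<in> gdom \<Longrightarrow> \<exists>F. (\<forall>n. F n \<in> D) \<and> F \<longlonglongrightarrow> f \<and> (\<lambda>n. A (F n)) \<longlonglongrightarrow> A f"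
    by (rule conjunct1[OF c3, rule_format])
  show "f \<in> D \<Longrightarrow> g \<in> D \<Longrightarrow> bmult f g \<in> D" by (rule conjunct1[OF c4, rule_format])
  show "f \<in> D \<Longrightarrow> smooth_on (range (apply_bcontfun f)) \<phi> \<Longrightarrow> bcomp \<phi> f \<in> D"
    by (rule conjunct1[OF c5, rule_format])
  show "locally_convex_space D \<tau>" by (rule conjunct1[OF c6])
  show "separable_space \<tau>" by (rule conjunct1[OF c8])
  show "openin (top_of_set D) U \<Longrightarrow> openin \<tau> U" by (rule conjunct1[OF c10, rule_format])
  show "a \<le> 0 \<Longrightarrow> 0 \<le> b \<Longrightarrow> smooth_on {a..b} \<phi> \<Longrightarrow> \<phi> 0 = 0 \<Longrightarrow>
      continuous_map (subtopology \<tau> {f \<in> D. range (apply_bcontfun f) \<subseteq> {a..b}}) \<tau> (bcomp \<phi>)"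
    by (rule conjunct1[OF c11, rule_format]) simp
  show "continuous_map \<tau> euclidean A" by (rule conjunct1[OF c12])
qed

lemma D_subspace: "subspace D" and topspace_\<tau> [simp]: "topspace \<tau> = D"
  using lcs by (auto simp: locally_convex_space_def)

lemmas D_add = subspace_add[OF D_subspace]
  and D_diff = subspace_diff[OF D_subspace]
  and D_scale = subspace_scale[OF D_subspace]
  and D_zero = subspace_0[OF D_subspace]
  and D_sum = subspace_sum[OF D_subspace]

lemmas continuous_map_add' = continuous_map_add_lcs[OF lcs]
  and continuous_map_scale' = continuous_map_scale_lcs[OF lcs]

lemma bcomp_apply':
  fixes f :: "'a cfun"
  shows "continuous_on (range (apply_bcontfun f)) \<phi> \<Longrightarrow> bcomp \<phi> f x = \<phi> (f x)"
  by (rule bcomp_apply[OF compact_E])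

lemma bcomp_exp:
  fixes f :: "'a cfun"
  shows "bcomp exp f x = exp (f x)"
  by (rule bcomp_apply') (intro continuous_intros)

lemma D_const: "const_bcontfun c \<in> D"
proof -
  have "bcomp (\<lambda>_. c) 0 = (const_bcontfun c :: 'a cfun)"
    by (rule bcontfun_eqI) (simp add: bcomp_apply')
  then show ?thesis using D_comp[OF D_zero smooth_on_const, of c] by simp
qed

section \<open>Continuity of products and of the velocity functional in the topology of D\<close>

lemma continuous_map_id_norm: "continuous_map \<tau> euclidean (\<lambda>f. f)"
  unfolding continuous_map_def
proof (intro conjI allI impI)
  fix U :: "'a cfun set" assume "openin euclidean U"
  then have "openin (top_of_set D) {f \<in> D. f \<in> U}"
    by (auto simp: openin_open intro!: exI[of _ U])
  then show "openin \<tau> {f \<in> topspace \<tau>. f \<in> U}" by (simp add: finer)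
qed auto

text \<open>The composition condition treats only functions with values in a fixed interval. The
  sets of functions of norm below R are open, because the topology of D is finer than the norm
  topology, and they cover D, so the pieces can be pasted.\<close>

lemma square_continuous: "continuous_map \<tau> \<tau> (\<lambda>f. bmult f f)"
proof (rule pasting_lemma[where I = "{0<..}" and T = "\<lambda>R. {f \<in> D. norm f < R}" and f = "\<lambda>R f. bmult f f"])
  fix R :: real assume R: "R \<in> {0<..}"
  have "openin (top_of_set D) {f \<in> D. norm f < R}"
    by (auto simp: openin_open intro!: exI[of _ "ball 0 R"])
  then show "openin \<tau> {f \<in> D. norm f < R}" by (rule finer)
  have sub: "{f \<in> D. norm f < R} \<subseteq> {f \<in> D. range (apply_bcontfun f) \<subseteq> {-R..R}}"
  proof safe
    fix f :: "'a cfun" and x assume "norm f < R"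
    then show "f x \<in> {-R..R}" using norm_bounded[of f x] by auto
  qed
  have "continuous_map (subtopology \<tau> {f \<in> D. norm f < R}) \<tau> (bcomp (\<lambda>x. x\<^sup>2))"
    by (rule continuous_map_from_subtopology_mono[OF comp_continuous sub])
      (use R smooth_on_square in auto)
  moreover have "bcomp (\<lambda>x. x\<^sup>2) f = bmult f f" for f :: "'a cfun"
    by (rule bcontfun_eqI) (simp add: bcomp_apply' continuous_intros bmult_apply power2_eq_square)
  ultimately show "continuous_map (subtopology \<tau> {f \<in> D. norm f < R}) \<tau> (\<lambda>f. bmult f f)"
    by (auto intro: continuous_map_eq)
next
  fix f assume "f \<in> topspace \<tau>"
  then show "\<exists>R. R \<in> {0<..} \<and> f \<in> {f \<in> D. norm f < R} \<and> bmult f f = bmult f f"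
    by (intro exI[of _ "norm f + 1"]) (auto simp: add_nonneg_pos)
qed auto

text \<open>Polarisation: 4Gf = (f + G)^2 - (f - G)^2 reduces the product to squares.\<close>

lemma mult_continuous:
  assumes G: "G \<in> D" shows "continuous_map \<tau> \<tau> (bmult G)"
proof -
  have 1: "continuous_map \<tau> \<tau> (\<lambda>f. bmult (f + c *\<^sub>R G) (f + c *\<^sub>R G))" for c
  proof -
    have "continuous_map \<tau> \<tau> (\<lambda>f. f + c *\<^sub>R G)"
      by (intro continuous_map_add' continuous_map_id[unfolded id_def]) (simp add: D_scale G)
    from continuous_map_compose[OF this square_continuous] show ?thesis by (simp add: o_def)
  qed
  have "continuous_map \<tau> \<tau> (\<lambda>f. (1/4) *\<^sub>R bmult (f + 1 *\<^sub>R G) (f + 1 *\<^sub>R G)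
      + (-1/4) *\<^sub>R bmult (f + (-1) *\<^sub>R G) (f + (-1) *\<^sub>R G))"
    by (intro continuous_map_add' continuous_map_scale' 1) auto
  moreover have "(1/4) *\<^sub>R bmult (f + 1 *\<^sub>R G) (f + 1 *\<^sub>R G)
      + (-1/4) *\<^sub>R bmult (f + (-1) *\<^sub>R G) (f + (-1) *\<^sub>R G) = bmult G f" for f
    by (rule bcontfun_eqI) (simp add: bmult_apply algebra_simps)
  ultimately show ?thesis by simp
qed

text \<open>With \<open>L\<close> taken as the evolution \<Lambda>_s, this is the velocity of the
  tilted path. Its continuity combines that of multiplication by G, of the generator on D, and of
  the inclusion of D into C(E).\<close>

lemma functional_in_dual:
  assumes G: "G \<in> D" and L: "bounded_linear L"
  shows "(\<lambda>f\<in>D. L (A (bmult G f) - bmult (A G) f)) \<in> dual_space D \<tau>"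
  unfolding dual_space_def mem_Collect_eq
proof (intro conjI ballI allI)
  interpret L: bounded_linear L by fact
  have GD: "f \<in> D \<Longrightarrow> bmult G f \<in> gdom" for f by (intro D_gdom D_mult G)
  fix f g assume f: "f \<in> D" and g: "g \<in> D"
  show "(\<lambda>f\<in>D. L (A (bmult G f) - bmult (A G) f)) (f + g)
      = (\<lambda>f\<in>D. L (A (bmult G f) - bmult (A G) f)) f + (\<lambda>f\<in>D. L (A (bmult G f) - bmult (A G) f)) g"
    using f g by (simp add: D_add bmult_add_right generator_add GD L.add L.diff)
next
  interpret L: bounded_linear L by fact
  have GD: "f \<in> D \<Longrightarrow> bmult G f \<in> gdom" for f by (intro D_gdom D_mult G)
  fix c f assume f: "f \<in> D"
  show "(\<lambda>f\<in>D. L (A (bmult G f) - bmult (A G) f)) (c *\<^sub>R f)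
      = c * (\<lambda>f\<in>D. L (A (bmult G f) - bmult (A G) f)) f"
    using f by (simp add: D_scale bmult_scale_right generator_scale GD L.diff L.scaleR right_diff_distrib)
next
  have 1: "continuous_map \<tau> euclidean (\<lambda>f. A (bmult G f))"
    using continuous_map_compose[OF mult_continuous[OF G] A_continuous] by (simp add: o_def)
  have "continuous_map euclidean euclidean (bmult (A G))"
    by (simp add: continuous_map_iff_continuous2 continuous_on_bmult)
  from continuous_map_compose[OF continuous_map_id_norm this]
  have 2: "continuous_map \<tau> euclidean (\<lambda>f. bmult (A G) f)" by (simp add: o_def)
  have 3: "continuous_map \<tau> euclidean (\<lambda>f. A (bmult G f) - bmult (A G) f)"
    by (intro continuous_map_diff 1 2)
  have "continuous_map euclidean euclideanreal L"
    using linear_continuous_on[OF L] by (simp add: continuous_map_iff_continuous2)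
  from continuous_map_compose[OF 3 this]
  have "continuous_map \<tau> euclideanreal (\<lambda>f. L (A (bmult G f) - bmult (A G) f))" by (simp add: o_def)
  then show "continuous_map \<tau> euclideanreal (\<lambda>f\<in>D. L (A (bmult G f) - bmult (A G) f))"
    by (rule continuous_map_eq) simp
qed auto

lemma zero_in_dual: "(\<lambda>f\<in>D. 0) \<in> dual_space D \<tau>"
  by (auto simp: dual_space_def D_add D_scale intro!: continuous_map_eq[OF continuous_map_const[THEN iffD2]])

lemma hamiltonian_apply: "hamiltonian S f x = exp (- f x) * A (bcomp exp f) x"
  by (simp add: hamiltonian_def bmult_apply bcomp_exp)

lemma hamiltonian_zero: "hamiltonian S 0 = 0"
proof -
  have "bcomp exp 0 = (const_bcontfun 1 :: 'a cfun)"
    by (rule bcontfun_eqI) (simp add: bcomp_exp)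
  moreover have "A (const_bcontfun 1) = 0"
  proof (rule generatorI)
    have "\<forall>\<^sub>F r in at_right 0. 0 = (S r (const_bcontfun 1) - const_bcontfun 1) /\<^sub>R r"
      by (rule eventually_right_0_nonneg) (simp add: S_one)
    then show "((\<lambda>r. (S r (const_bcontfun 1) - const_bcontfun 1) /\<^sub>R r) \<longlongrightarrow> 0) (at_right 0)"
      by (rule Lim_transform_eventually[OF tendsto_const])
  qed
  ultimately show ?thesis
    by (intro bcontfun_eqI) (simp add: hamiltonian_apply)
qed

text \<open>\<open>G ln G\<close>; the shift by \<open>1\<close> makes the outer function vanish at \<open>0\<close>.\<close>
definition xlogx :: "'a cfun \<Rightarrow> 'a cfun"
  where "xlogx G = bcomp entropy (G - const_bcontfun 1)"

lemma
  assumes G: "\<And>x. 0 < apply_bcontfun G x"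
  shows xlogx_apply: "xlogx G x = G x * ln (G x)"
    and xlogx_D: "G \<in> D \<Longrightarrow> xlogx G \<in> D"
proof -
  have range: "range (apply_bcontfun (G - const_bcontfun 1)) \<subseteq> {-1<..}" using G by auto
  have "continuous_on (range (apply_bcontfun (G - const_bcontfun 1))) entropy"
    unfolding entropy_def using G by (intro continuous_intros) (auto simp: less_imp_neq[symmetric])
  then show "xlogx G x = G x * ln (G x)"
    by (simp add: xlogx_def bcomp_apply' entropy_def)
  show "G \<in> D \<Longrightarrow> xlogx G \<in> D" unfolding xlogx_def
    by (intro D_comp D_diff D_const smooth_on_entropy range)
qed

text \<open>
  The function \<open>W \<ge> 0\<close> below vanishes at \<open>x\<close>, hence \<open>AW(x) \<ge> 0\<close>. With \<open>a = f - f(x)\<close> and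
  \<open>b = ln (G/G(x))\<close> it is \<open>b e\<^sup>b - e\<^sup>b - a e\<^sup>b + e\<^sup>a\<close>.
\<close>
lemma tilted_generator_le:
  assumes G: "G \<in> D" "\<And>x. 0 < apply_bcontfun G x" and f: "f \<in> D"
  shows "A (bmult G f) x - f x * A G x - G x * hamiltonian S f x
    \<le> A (xlogx G) x - ln (G x) * A G x - A G x"
proof -
  define W where "W = (1 / G x) *\<^sub>R (xlogx G - (ln (G x) + 1 - f x) *\<^sub>R G - bmult G f)
    + exp (- f x) *\<^sub>R bcomp exp f"
  have in_D: "xlogx G \<in> gdom" "G \<in> gdom" "bmult G f \<in> gdom" "bcomp exp f \<in> gdom"
    by (intro D_gdom xlogx_D G D_mult f D_comp smooth_on_exp)+
  have W_dom: "W \<in> gdom" unfolding W_def by (intro dom_add dom_scale dom_diff in_D)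
  have AW: "A W = (1 / G x) *\<^sub>R (A (xlogx G) - (ln (G x) + 1 - f x) *\<^sub>R A G - A (bmult G f))
    + exp (- f x) *\<^sub>R A (bcomp exp f)"
    unfolding W_def by (simp add: generator_add generator_scale generator_diff dom_scale dom_diff in_D)
  have W: "W y = (G y / G x) * (ln (G y / G x) - 1 - (f y - f x)) + exp (f y - f x)" for y
    using G(2)[of x] G(2)[of y]
    by (simp add: W_def xlogx_apply[OF G(2)] bmult_apply bcomp_exp ln_div exp_diff exp_minus field_simps)
  have "0 \<le> W y" for y
  proof -
    define p where "p = G y / G x"
    have p: "p > 0" using G(2) by (simp add: p_def)
    \<comment> \<open>Young's inequality a p \<le> exp a + p ln p - p for the exponential and its
      convex conjugate, obtained from 1 + z \<le> exp z at z = a - ln p; \<open>W\<close> is its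
      defect.\<close>
    have "p * (1 + ((f y - f x) - ln p)) \<le> p * exp ((f y - f x) - ln p)"
      using p by (intro mult_left_mono exp_ge_add_one_self) auto
    also have "\<dots> = exp (f y - f x)" using p by (simp add: exp_diff)
    finally show ?thesis unfolding W p_def[symmetric] by (simp add: algebra_simps)
  qed
  moreover have "W x = 0" using G(2)[of x] by (simp add: W)
  ultimately have "0 \<le> A W x" by (rule generator_at_minimum[OF W_dom])
  then have "0 \<le> G x * A W x" using G(2)[of x] by simp
  also have "G x * A W x = A (xlogx G) x - (ln (G x) + 1 - f x) * A G x - A (bmult G f) x
      + G x * hamiltonian S f x"
    using G(2)[of x] by (simp add: AW hamiltonian_apply algebra_simps)
  finally show ?thesis by (simp add: algebra_simps)
qed

lemma curve_continuous:
  assumes "finite I" "\<And>i. i \<in> I \<Longrightarrow> Z i \<in> D" "\<And>i. i \<in> I \<Longrightarrow> continuous_on T (a i)"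
  shows "continuous_map (top_of_set T) \<tau> (\<lambda>s. \<Sum>i\<in>I. a i s *\<^sub>R Z i)"
  using assms
proof (induction I rule: finite_induct)
  case empty then show ?case by (simp add: D_zero)
next
  case (insert i I)
  then show ?case
    by (simp del: continuous_map_iff_continuous2 continuous_map_iff_continuous)
      (intro continuous_map_add' continuous_map_scale', auto)
qed

text \<open>A compact time set confines all values of G_s - 1 to one interval on which
  \<open>entropy\<close> is smooth, so one instance of the composition condition serves all
  times.\<close>

lemma xlogx_continuous:
  fixes T :: "real set"
  assumes G: "continuous_map (top_of_set T) \<tau> G" and "compact T"
    and pos: "\<And>s x. s \<in> T \<Longrightarrow> c \<le> apply_bcontfun (G s) x" "0 < c"
  shows "continuous_map (top_of_set T) \<tau> (\<lambda>s. xlogx (G s))"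
proof -
  have "continuous_map (top_of_set T) euclidean G"
    using continuous_map_compose[OF G continuous_map_id_norm] by (simp add: o_def)
  then have "continuous_on T G" by simp
  then have "bounded (G ` T)" by (intro compact_imp_bounded compact_continuous_image \<open>compact T\<close>)
  then obtain K where K: "\<And>s. s \<in> T \<Longrightarrow> norm (G s) \<le> K" "K > 0" by (auto simp: bounded_pos)
  \<comment> \<open>The composition condition is stated for intervals containing 0;
    \<open>c > 0\<close> keeps \<open>a\<close> above the singularity at -1.\<close>
  define a where "a = min (c - 1) 0"
  have in_D: "s \<in> T \<Longrightarrow> G s \<in> D" for s
    using continuous_map_image_subset_topspace[OF G] by auto
  have "continuous_map (top_of_set T) \<tau> (\<lambda>s. G s + (-1) *\<^sub>R const_bcontfun 1)"
    by (intro continuous_map_add' G) (use D_scale[OF D_const, of "-1"] in simp)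
  then have shifted: "continuous_map (top_of_set T) \<tau> (\<lambda>s. G s - const_bcontfun 1)" by simp
  have "continuous_map (top_of_set T)
      (subtopology \<tau> {f \<in> D. range (apply_bcontfun f) \<subseteq> {a..K}}) (\<lambda>s. G s - const_bcontfun 1)"
  proof (rule continuous_map_into_subtopology[OF shifted])
    have "G s x - 1 \<in> {a..K}" if "s \<in> T" for s x
      using pos(1)[OF that, of x] norm_bounded[of "G s" x] K(1)[OF that] by (auto simp: a_def)
    then show "(\<lambda>s. G s - const_bcontfun 1) \<in> topspace (top_of_set T)
        \<rightarrow> {f \<in> D. range (apply_bcontfun f) \<subseteq> {a..K}}"
      using in_D by (auto intro!: D_diff D_const)
  qed
  moreover have "continuous_map (subtopology \<tau> {f \<in> D. range (apply_bcontfun f) \<subseteq> {a..K}}) \<tau> (bcomp entropy)"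
  proof (rule comp_continuous)
    show "smooth_on {a..K} entropy"
      using \<open>0 < c\<close> by (intro smooth_on_entropy) (auto simp: a_def)
  qed (use K(2) in \<open>auto simp: a_def entropy_def\<close>)
  ultimately show ?thesis
    unfolding xlogx_def by (rule continuous_map_compose[unfolded o_def])
qed

end

section \<open>The tilted path\<close>

text \<open>For each single f the two velocities agree at almost every time. A countable dense set
  of f has a common null set, and outside it continuity of the functionals forces equality on D.
  This frees the action from the choice made in \<open>path_derivative\<close>.\<close>

lemma path_derivative_unique:
  assumes sep: "separable_space \<tau>" and top: "topspace \<tau> = D"
    and u: "has_path_derivative D \<tau> \<nu> u" and u': "has_path_derivative D \<tau> \<nu> u'" and t: "0 \<le> t"
  shows "AE s in lborel. s \<in> {0..t} \<longrightarrow> u s = u' s"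
proof -
  have int: "set_integrable lborel {0..t} (\<lambda>s. v s f)"
    if v: "has_path_derivative D \<tau> \<nu> v" and f: "f \<in> D" for v f
  proof -
    have "(\<lambda>s. v s f) \<in> borel_measurable (restrict_space borel {0..})"
      using v f by (simp add: has_path_derivative_def)
    then have "(\<lambda>s. indicator {0..} s *\<^sub>R v s f) \<in> borel_measurable borel"
      by (subst (asm) borel_measurable_restrict_space_iff) auto
    then have "(\<lambda>s. indicator {0..t} s *\<^sub>R (indicator {0..} s *\<^sub>R v s f)) \<in> borel_measurable borel"
      by measurable
    also have "(\<lambda>s. indicator {0..t} s *\<^sub>R (indicator {0..} s *\<^sub>R v s f)) = (\<lambda>s. indicator {0..t} s *\<^sub>R v s f)"
      by (auto simp: fun_eq_iff indicator_def)
    finally have meas: "(\<lambda>s. indicator {0..t} s *\<^sub>R v s f) \<in> borel_measurable lborel" by simp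
    have "(\<integral>\<^sup>+s. ennreal (norm (indicator {0..t} s *\<^sub>R v s f)) \<partial>lborel)
        = (\<integral>\<^sup>+s\<in>{0..t}. ennreal \<bar>v s f\<bar> \<partial>lborel)"
      by (intro nn_integral_cong) (simp add: indicator_def)
    also have "\<dots> < \<infinity>" using v f t by (simp add: has_path_derivative_def)
    finally show ?thesis using meas by (simp add: set_integrable_def integrable_iff_bounded)
  qed
  obtain Q where Q: "countable Q" "Q \<subseteq> D" "\<tau> closure_of Q = D"
    using sep top by (auto simp: separable_space_def)
  have "AE s in lborel. s \<in> {0..t} \<longrightarrow> u s f = u' s f" if f: "f \<in> D" for f
  proof (rule AE_eq_of_integrals_eq[OF int[OF u f] int[OF u' f]])
    fix s :: real assume "0 \<le> s"
    then have "(\<integral>x. f x \<partial>\<nu> s) - (\<integral>x. f x \<partial>\<nu> 0) = (LINT q:{0..s}|lborel. u q f)"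
      "(\<integral>x. f x \<partial>\<nu> s) - (\<integral>x. f x \<partial>\<nu> 0) = (LINT q:{0..s}|lborel. u' q f)"
      using u u' f by (auto simp: has_path_derivative_def)
    then show "(LINT q:{0..s}|lborel. u q f) = (LINT q:{0..s}|lborel. u' q f)" by simp
  qed
  then have "AE s in lborel. \<forall>f\<in>Q. s \<in> {0..t} \<longrightarrow> u s f = u' s f"
    using Q by (subst AE_ball_countable) auto
  then show ?thesis
  proof eventually_elim
    case (elim s)
    show ?case
    proof
      assume s: "s \<in> {0..t}"
      then have us: "u s \<in> dual_space D \<tau>" "u' s \<in> dual_space D \<tau>"
        using u u' by (auto simp: has_path_derivative_def)
      show "u s = u' s"
      proof (rule extensionalityI[of _ D])
        show "u s \<in> extensional D" "u' s \<in> extensional D" using us by (auto simp: dual_space_def)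
        fix f assume "f \<in> D"
        then have "f \<in> \<tau> closure_of Q" using Q by simp
        then show "u s f = u' s f"
          by (rule forall_in_closure_of_eq[where Y = euclideanreal])
            (use us elim s in \<open>auto simp: dual_space_def\<close>)
      qed
    qed
  qed
qed

section \<open>Estimates for logarithm, inverse and u ln u away from zero\<close>

lemma continuous_on_bcomp_lipschitz:
  fixes G :: "real \<Rightarrow> 'a::metric_space cfun"
  assumes E: "compact (UNIV :: 'a set)" and G: "continuous_on J G"
    and low: "\<And>s x. s \<in> J \<Longrightarrow> c \<le> apply_bcontfun (G s) x"
    and \<phi>: "continuous_on {c..} \<phi>" "\<And>u v. c \<le> u \<Longrightarrow> c \<le> v \<Longrightarrow> \<bar>\<phi> u - \<phi> v\<bar> \<le> L * \<bar>u - v\<bar>" and L: "0 \<le> L"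
  shows "continuous_on J (\<lambda>s. bcomp \<phi> (G s))"
  unfolding continuous_on_def
proof
  fix p assume p: "p \<in> J"
  have app: "bcomp \<phi> (G s) x = \<phi> (G s x)" if "s \<in> J" for s x
    by (rule bcomp_apply[OF E continuous_on_subset[OF \<phi>(1)]]) (use low that in auto)
  have "((\<lambda>s. bcomp \<phi> (G s) - bcomp \<phi> (G p)) \<longlongrightarrow> 0) (at p within J)"
  proof (rule Lim_null_comparison)
    have "norm (bcomp \<phi> (G s) - bcomp \<phi> (G p)) \<le> L * norm (G s - G p)" if s: "s \<in> J" for s
    proof (rule norm_bound)
      fix x
      have "\<bar>\<phi> (G s x) - \<phi> (G p x)\<bar> \<le> L * \<bar>G s x - G p x\<bar>" by (intro \<phi> low s p)
      also have "\<dots> \<le> L * norm (G s - G p)"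
        using norm_bounded[of "G s - G p" x] L by (intro mult_left_mono) auto
      finally show "norm ((bcomp \<phi> (G s) - bcomp \<phi> (G p)) x) \<le> L * norm (G s - G p)"
        by (simp add: app s p)
    qed
    then show "\<forall>\<^sub>F s in at p within J. norm (bcomp \<phi> (G s) - bcomp \<phi> (G p)) \<le> L * norm (G s - G p)"
      by (auto simp: eventually_at_filter)
    have "(G \<longlongrightarrow> G p) (at p within J)" using G p by (auto simp: continuous_on_def)
    then show "((\<lambda>s. L * norm (G s - G p)) \<longlongrightarrow> 0) (at p within J)"
      by (intro tendsto_mult_right_zero tendsto_norm_zero LIM_zero)
  qed
  then show "((\<lambda>s. bcomp \<phi> (G s)) \<longlongrightarrow> bcomp \<phi> (G p)) (at p within J)" by (rule LIM_zero_cancel)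
qed

lemma abs_ln_diff_le:
  fixes u v :: real
  assumes "0 < c" "c \<le> u" "c \<le> v" shows "\<bar>ln u - ln v\<bar> \<le> 1 / c * \<bar>u - v\<bar>"
proof -
  have *: "ln u - ln v \<le> 1 / c * \<bar>u - v\<bar>" if "c \<le> u" "c \<le> v" for u v :: real
  proof -
    have "ln u - ln v = ln (u / v)" using that assms by (simp add: ln_div)
    also have "\<dots> \<le> u / v - 1" using that assms by (intro ln_le_minus_one) auto
    also have "\<dots> = (u - v) / v" using that assms by (simp add: field_simps)
    also have "\<dots> \<le> \<bar>u - v\<bar> / v" using that assms by (intro divide_right_mono) auto
    also have "\<dots> \<le> \<bar>u - v\<bar> / c" using that assms by (intro divide_left_mono) auto
    finally show ?thesis by simp
  qed
  from *[of u v] *[of v u] assms show ?thesis by (simp add: abs_le_iff abs_minus_commute)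
qed

lemma abs_inverse_diff_le:
  fixes u v :: real
  assumes "0 < c" "c \<le> u" "c \<le> v" shows "\<bar>inverse u - inverse v\<bar> \<le> 1 / c\<^sup>2 * \<bar>u - v\<bar>"
proof -
  have "inverse u - inverse v = (v - u) / (u * v)" using assms by (simp add: field_simps)
  then have "\<bar>inverse u - inverse v\<bar> = \<bar>u - v\<bar> / (u * v)" using assms by (simp add: abs_mult abs_minus_commute)
  also have "\<dots> \<le> \<bar>u - v\<bar> / c\<^sup>2"
    using assms by (intro divide_left_mono) (auto simp: power2_eq_square intro!: mult_mono)
  finally show ?thesis by simp
qed

text \<open>The remainder equals v ln(v/u) - (v - u). The inequality ln z \<le> z - 1 at u/v makes
  it nonnegative, and at v/u bounds it by (v - u)^2 / u.\<close>

lemma xlogx_taylor: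
  fixes u v :: real
  assumes "0 < c" "c \<le> u" "c \<le> v"
  shows "\<bar>v * ln v - u * ln u - (1 + ln u) * (v - u)\<bar> \<le> 1 / c * \<bar>v - u\<bar>\<^sup>2"
proof -
  have "ln v - ln u = ln (v / u)" using assms by (simp add: ln_div)
  also have "\<dots> \<le> v / u - 1" using assms by (intro ln_le_minus_one) auto
  finally have 1: "ln v - ln u \<le> (v - u) / u" using assms by (simp add: field_simps)
  have "ln u - ln v = ln (u / v)" using assms by (simp add: ln_div)
  also have "\<dots> \<le> u / v - 1" using assms by (intro ln_le_minus_one) auto
  finally have 2: "ln u - ln v \<le> (u - v) / v" using assms by (simp add: field_simps)
  have eq: "v * ln v - u * ln u - (1 + ln u) * (v - u) = v * (ln v - ln u) - (v - u)"
    by (simp add: algebra_simps)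
  have "v * (ln v - ln u) \<le> v * ((v - u) / u)" using 1 assms by (intro mult_left_mono) auto
  also have "v * ((v - u) / u) = (v - u) + (v - u)\<^sup>2 / u"
    using assms by (simp add: field_simps power2_eq_square)
  also have "(v - u)\<^sup>2 / u \<le> (v - u)\<^sup>2 / c" using assms by (intro divide_left_mono) auto
  finally have upper: "v * (ln v - ln u) - (v - u) \<le> (v - u)\<^sup>2 / c" by simp
  have "v * (ln u - ln v) \<le> v * ((u - v) / v)" using 2 assms by (intro mult_left_mono) auto
  also have "v * ((u - v) / v) = u - v" using assms by simp
  finally have lower: "0 \<le> v * (ln v - ln u) - (v - u)" by (simp add: algebra_simps)
  show ?thesis unfolding eq using upper lower by simp
qed

text \<open>The lower bound \<open>c\<close> makes the logarithm and the inverse of G continuous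
  curves in C(E). \<open>super_le\<close> gives the sign of the potential, \<open>super_ge\<close>
  its size, and \<open>kernel\<close> the dominating measures.\<close>

locale control = core_semigroup S D \<tau>
  for S :: "real \<Rightarrow> 'a::metric_space cfun \<Rightarrow> 'a cfun" and D \<tau> +
  fixes I :: "'i set" and Z :: "'i \<Rightarrow> 'a cfun" and a a' :: "'i \<Rightarrow> real \<Rightarrow> real"
    and G G' :: "real \<Rightarrow> 'a cfun" and c \<beta> T :: real and \<mu> :: "'a measure"
  assumes T: "0 \<le> T" and I: "finite I" and Z: "\<And>i. i \<in> I \<Longrightarrow> Z i \<in> D"
    and a_deriv: "\<And>i s. i \<in> I \<Longrightarrow> s \<in> {0..T} \<Longrightarrow> (a i has_real_derivative a' i s) (at s within {0..T})"
    and a'_cont: "\<And>i. i \<in> I \<Longrightarrow> continuous_on {0..T} (a' i)"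
    and G: "\<And>s. G s = (\<Sum>i\<in>I. a i s *\<^sub>R Z i)" and G': "\<And>s. G' s = (\<Sum>i\<in>I. a' i s *\<^sub>R Z i)"
    and c: "0 < c" and G_ge: "\<And>s x. s \<in> {0..T} \<Longrightarrow> c \<le> apply_bcontfun (G s) x"
    and super_le: "\<And>s x. s \<in> {0..T} \<Longrightarrow> A (G s) x + G' s x \<le> 0"
    and super_ge: "\<And>s x. s \<in> {0..T} \<Longrightarrow> - (\<beta> * G s x) \<le> A (G s) x + G' s x"
    and \<mu>: "\<mu> \<in> space (prob_algebra borel)"
    and kernel: "\<And>s. 0 \<le> s \<Longrightarrow> \<exists>m. propagates \<mu> s m"
begin

lemma prob_\<mu>: "prob_space \<mu>" and sets_\<mu>: "sets \<mu> = sets borel"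
  using \<mu> by (auto simp: space_prob_algebra)

lemma finite_\<mu>: "finite_measure \<mu>"
  using prob_\<mu> by (simp add: prob_space.finite_measure)

lemma integrable_\<mu> [simp]:
  fixes v :: "'a cfun"
  shows "integrable \<mu> (apply_bcontfun v)"
  by (rule integrable_bcontfun[OF finite_\<mu> sets_\<mu>])

lemma G_pos: "s \<in> {0..T} \<Longrightarrow> 0 < G s x"
  using G_ge[of s x] c by linarith

lemma G_nonzero: "s \<in> {0..T} \<Longrightarrow> G s x \<noteq> 0"
  using G_pos[of s x] by simp

lemma a_cont: "i \<in> I \<Longrightarrow> continuous_on {0..T} (a i)"
  using a_deriv by (meson DERIV_continuous continuous_on_eq_continuous_within)

lemma G_D: "G s \<in> D"
  unfolding G by (intro D_sum D_scale Z)

lemma G_continuous: "continuous_on {0..T} G"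
  unfolding G[abs_def] by (intro continuous_intros a_cont)

lemma G'_continuous: "continuous_on {0..T} G'"
  unfolding G'[abs_def] by (intro continuous_intros a'_cont)

lemma A_G_mult:
  assumes "f \<in> D" shows "A (bmult (G s) f) = (\<Sum>i\<in>I. a i s *\<^sub>R A (bmult (Z i) f))"
proof -
  have Zf: "i \<in> I \<Longrightarrow> bmult (Z i) f \<in> gdom" for i by (intro D_gdom D_mult Z assms)
  have "bmult (G s) f = (\<Sum>i\<in>I. a i s *\<^sub>R bmult (Z i) f)"
    by (simp add: G bmult_sum_left bmult_scale_left)
  then show ?thesis using dom_sum[of I "\<lambda>i. a i s *\<^sub>R bmult (Z i) f"]
    by (simp add: dom_scale generator_scale Zf)
qed

lemma A_G_mult_continuous: "f \<in> D \<Longrightarrow> continuous_on {0..T} (\<lambda>s. A (bmult (G s) f))"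
  by (subst A_G_mult) (auto intro!: continuous_intros a_cont)

lemma A_G_continuous: "continuous_on {0..T} (\<lambda>s. A (G s))"
proof -
  have "bmult v (const_bcontfun 1) = v" for v :: "'a cfun"
    by (rule bcontfun_eqI) (simp add: bmult_apply)
  then show ?thesis using A_G_mult_continuous[OF D_const[of 1]] by simp
qed

lemma G_deriv:
  assumes "0 \<le> s" "s < T" shows "((\<lambda>r. (G (s + r) - G s) /\<^sub>R r) \<longlongrightarrow> G' s) (at_right 0)"
proof -
  have eq: "(G (s + r) - G s) /\<^sub>R r = (\<Sum>i\<in>I. ((a i (s + r) - a i s) / r) *\<^sub>R Z i)" for r
    by (simp add: G sum_subtractf[symmetric] scaleR_sum_right scaleR_diff_left[symmetric] divide_inverse_commute)
  have "((\<lambda>r. \<Sum>i\<in>I. ((a i (s + r) - a i s) / r) *\<^sub>R Z i) \<longlongrightarrow> (\<Sum>i\<in>I. a' i s *\<^sub>R Z i)) (at_right 0)"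
    by (intro tendsto_sum tendsto_scaleR tendsto_const right_quotient_of_derivative[OF a_deriv])
      (use assms in auto)
  then show ?thesis by (simp only: eq G')
qed

definition invG :: "real \<Rightarrow> 'a cfun" where "invG s = bcomp inverse (G s)"
definition lnG :: "real \<Rightarrow> 'a cfun" where "lnG s = bcomp ln (G s)"

lemma invG_apply: "s \<in> {0..T} \<Longrightarrow> invG s x = inverse (G s x)"
  unfolding invG_def by (intro bcomp_apply' continuous_intros) (auto simp: G_nonzero[simplified])

lemma lnG_apply: "s \<in> {0..T} \<Longrightarrow> lnG s x = ln (G s x)"
  unfolding lnG_def by (intro bcomp_apply' continuous_intros) (auto simp: G_nonzero[simplified])

lemma invG_continuous: "continuous_on {0..T} invG"
  unfolding invG_def
  by (rule continuous_on_bcomp_lipschitz[OF compact_E G_continuous, of c _ "1 / c\<^sup>2"])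
    (use c G_ge abs_inverse_diff_le in \<open>auto intro!: continuous_intros\<close>)

lemma lnG_continuous: "continuous_on {0..T} lnG"
  unfolding lnG_def
  by (rule continuous_on_bcomp_lipschitz[OF compact_E G_continuous, of c _ "1 / c"])
    (use c G_ge abs_ln_diff_le in \<open>auto intro!: continuous_intros\<close>)

definition B :: "real \<Rightarrow> 'a cfun" where "B s = bmult (invG s) (- (A (G s) + G' s))"

lemma B_G: "s \<in> {0..T} \<Longrightarrow> B s x * G s x = - (A (G s) x + G' s x)"
  using G_pos[of s x] by (simp add: B_def bmult_apply invG_apply)

lemma B_bounds: assumes "s \<in> {0..T}" shows "0 \<le> B s x" "B s x \<le> \<beta>"
proof -
  have *: "0 \<le> B s x * G s x" "B s x * G s x \<le> \<beta> * G s x"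
    using super_le[OF assms, of x] super_ge[OF assms, of x] by (simp_all add: B_G[OF assms])
  show "0 \<le> B s x" "B s x \<le> \<beta>"
    using * G_pos[OF assms, of x] by (simp_all add: zero_le_mult_iff)
qed

definition \<Lambda>0 :: "'a cfun \<Rightarrow> real" where "\<Lambda>0 v = (\<integral>x. bmult v (invG 0) x \<partial>\<mu>)"

lemma B_continuous: "continuous_on {0..T} B"
  unfolding B_def
  by (intro continuous_on_bmult invG_continuous continuous_intros A_G_continuous G'_continuous)

text \<open>The potential is frozen after time \<open>T\<close>: the perturbed evolution is set up
  on all of {0..}, whereas G is controlled on {0..T} only.\<close>

sublocale perturbed_semigroup S "\<lambda>s. B (min s T)" \<beta> \<Lambda>0
proof
  show "continuous_on {0..} (\<lambda>s. B (min s T))"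
    by (rule continuous_on_compose2[OF B_continuous]) (use T in \<open>auto intro!: continuous_intros\<close>)
  show "0 \<le> B (min s T) x" "B (min s T) x \<le> \<beta>" if "0 \<le> s" for s x
    by (rule B_bounds; use that T in simp)+
  show "\<Lambda>0 (v + w) = \<Lambda>0 v + \<Lambda>0 w" for v w by (simp add: \<Lambda>0_def bmult_add_left)
  show "\<Lambda>0 (r *\<^sub>R v) = r * \<Lambda>0 v" for r v by (simp add: \<Lambda>0_def bmult_scale_left)
  show "0 \<le> \<Lambda>0 v" if "\<forall>x. 0 \<le> apply_bcontfun v x" for v
    unfolding \<Lambda>0_def
    by (rule integral_nonneg_AE) (use that T G_pos[of 0] in \<open>auto simp: bmult_apply invG_apply less_imp_le\<close>)
qed

lemma \<Lambda>_mono: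
  assumes "0 \<le> s" "\<And>x. apply_bcontfun v x \<le> apply_bcontfun w x" shows "\<Lambda> s v \<le> \<Lambda> s w"
  using \<Lambda>_pos[OF assms(1), of "w - v"] assms by (simp add: \<Lambda>_diff)

text \<open>\<open>e\<close> stands for whatever the integrand simplifies to once B G = -(AG + G')
  is inserted; up to time \<open>T\<close> the freezing of B is invisible.\<close>

lemma forward:
  assumes t: "t \<in> {0..T}" and w_dom: "\<And>s. s \<in> {0..T} \<Longrightarrow> w s \<in> gdom"
    and w: "continuous_on {0..T} w" and Aw: "continuous_on {0..T} (\<lambda>s. A (w s))"
    and w': "continuous_on {0..T} w'"
    and deriv: "\<And>s. 0 \<le> s \<Longrightarrow> s < T \<Longrightarrow> ((\<lambda>r. (w (s + r) - w s) /\<^sub>R r) \<longlongrightarrow> w' s) (at_right 0)"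
    and e: "\<And>s x. s \<in> {0..T} \<Longrightarrow> A (w s) x + w' s x + B s x * w s x = apply_bcontfun (e s) x"
  shows "\<Lambda> t (w t) - \<Lambda> 0 (w 0) = integral {0..t} (\<lambda>s. \<Lambda> s (e s))"
proof -
  have "\<Lambda> t (w t) - \<Lambda> 0 (w 0) = integral {0..t} (\<lambda>s. \<Lambda> s (A (w s) + w' s + bmult (B (min s T)) (w s)))"
    by (rule forward_equation)
      (use t in \<open>auto intro!: w_dom continuous_on_subset[OF w] continuous_on_subset[OF Aw]
          continuous_on_subset[OF w'] deriv\<close>)
  also have "\<dots> = integral {0..t} (\<lambda>s. \<Lambda> s (e s))"
  proof (intro integral_cong arg_cong[of _ _ "\<Lambda> _"] bcontfun_eqI)
    fix s x assume "s \<in> {0..t}"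
    then show "(A (w s) + w' s + bmult (B (min s T)) (w s)) x = e s x"
      using e[of s x] t by (simp add: bmult_apply min_def)
  qed
  finally show ?thesis .
qed

text \<open>The term B G f equals -(AG + G') f and so cancels the time derivative G' f, leaving
  A(Gf) - f AG.\<close>

lemma tilted_forward:
  assumes t: "t \<in> {0..T}" and f: "f \<in> D"
  shows "\<Lambda> t (bmult (G t) f) - \<Lambda> 0 (bmult (G 0) f)
    = integral {0..t} (\<lambda>s. \<Lambda> s (A (bmult (G s) f) - bmult (A (G s)) f))"
proof (rule forward[OF t])
  show "bmult (G s) f \<in> gdom" for s by (intro D_gdom D_mult G_D f)
  show "continuous_on {0..T} (\<lambda>s. bmult (G s) f)"
    by (intro continuous_on_bmult G_continuous continuous_intros)
  show "continuous_on {0..T} (\<lambda>s. A (bmult (G s) f))" by (rule A_G_mult_continuous[OF f])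
  show "continuous_on {0..T} (\<lambda>s. bmult (G' s) f)"
    by (intro continuous_on_bmult G'_continuous continuous_intros)
  fix s assume s: "0 \<le> s" "s < T"
  have "((\<lambda>r. bmult ((G (s + r) - G s) /\<^sub>R r) f) \<longlongrightarrow> bmult (G' s) f) (at_right 0)"
    by (intro bounded_bilinear.tendsto[OF bounded_bilinear_bmult] G_deriv s tendsto_const)
  then show "((\<lambda>r. (bmult (G (s + r)) f - bmult (G s) f) /\<^sub>R r) \<longlongrightarrow> bmult (G' s) f) (at_right 0)"
    by (simp add: bmult_scale_left bmult_diff_left)
next
  fix s x assume "s \<in> {0..T}"
  then have "B s x * (G s x * f x) = - (A (G s) x + G' s x) * f x"
    using B_G[of s x] by (simp only: mult.assoc[symmetric])
  then show "A (bmult (G s) f) x + bmult (G' s) f x + B s x * bmult (G s) f x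
      = (A (bmult (G s) f) - bmult (A (G s)) f) x"
    by (simp add: bmult_apply algebra_simps)
qed

lemma bmult_one: "bmult v (const_bcontfun 1) = v"
  by (rule bcontfun_eqI) (simp add: bmult_apply)

lemma mass: assumes "s \<in> {0..T}" shows "\<Lambda> s (G s) = 1"
proof -
  have "\<Lambda> s (G s) - \<Lambda> 0 (G 0) = integral {0..s} (\<lambda>q. \<Lambda> q 0)"
    using tilted_forward[OF assms D_const[of 1]] by (simp add: bmult_one)
  also have "\<dots> = integral {0..s} (\<lambda>q. 0)"
    by (intro integral_cong) (use \<Lambda>_scale[of _ 0 0] in simp)
  finally have "\<Lambda> s (G s) = \<Lambda>0 (G 0)" by (simp add: \<Lambda>_0)
  also have "\<dots> = (\<integral>x. 1 \<partial>\<mu>)"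
    unfolding \<Lambda>0_def
    using G_nonzero[of 0] T by (intro Bochner_Integration.integral_cong) (auto simp: bmult_apply invG_apply G_nonzero)
  also have "\<dots> = 1" using prob_\<mu> by (simp add: prob_space.prob_space)
  finally show ?thesis .
qed

lemma initial: "\<Lambda> 0 (bmult (G 0) v) = (\<integral>x. v x \<partial>\<mu>)"
  unfolding \<Lambda>_0 \<Lambda>0_def
  using G_nonzero[of 0] T by (intro Bochner_Integration.integral_cong) (auto simp: bmult_apply invG_apply G_nonzero)

text \<open>Domination by the law of the original process: \<Lambda>_s is at most exp(\<beta> s)
  times \<open>\<Lambda>0\<close> after S_s, G_s is at most its norm, and 1/G_0 is at most 1/c.
  These are the three factors of \<open>C\<close>.\<close>

lemma path_measure_exists:
  assumes s: "s \<in> {0..T}"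
  shows "\<exists>\<nu>\<in>space (prob_algebra borel). \<forall>v. (\<integral>x. apply_bcontfun v x \<partial>\<nu>) = \<Lambda> s (bmult (G s) v)"
proof -
  have s0: "0 \<le> s" using s by simp
  obtain m where m: "sets m = sets borel" "finite_measure m"
    "\<And>v. (\<integral>x. apply_bcontfun v x \<partial>m) = (\<integral>x. apply_bcontfun (S s v) x \<partial>\<mu>)"
    using kernel[OF s0] unfolding propagates_def by blast
  define C where "C = exp (\<beta> * s) * (norm (G s) * (1 / c))"
  have "dominated_functional m (\<lambda>v. \<Lambda> s (bmult (G s) v)) C"
  proof (rule dominated_functional.intro)
    show "finite_measure m" "sets m = sets borel" by fact+
    show "\<Lambda> s (bmult (G s) (v + w)) = \<Lambda> s (bmult (G s) v) + \<Lambda> s (bmult (G s) w)" for v w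
      by (simp add: bmult_add_right \<Lambda>_add s0)
    show "\<Lambda> s (bmult (G s) (r *\<^sub>R v)) = r * \<Lambda> s (bmult (G s) v)" for r v
      by (simp add: bmult_scale_right \<Lambda>_scale s0)
    show "0 \<le> C" using c by (simp add: C_def)
    fix v :: "'a cfun" assume v: "\<forall>x. 0 \<le> v x"
    have Gv: "0 \<le> bmult (G s) v x" for x using v G_pos[OF s, of x] by (simp add: bmult_apply less_imp_le)
    show "0 \<le> \<Lambda> s (bmult (G s) v)" by (intro \<Lambda>_pos s0 Gv)
    have "\<Lambda> s (bmult (G s) v) \<le> exp (\<beta> * s) * \<Lambda>0 (S s (bmult (G s) v))" by (intro \<Lambda>_le s0 Gv)
    also have "\<Lambda>0 (S s (bmult (G s) v)) \<le> \<Lambda>0 (S s (norm (G s) *\<^sub>R v))"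
    proof (intro \<Lambda>0_mono S_mono s0)
      fix x show "bmult (G s) v x \<le> (norm (G s) *\<^sub>R v) x"
        using norm_bounded[of "G s" x] v by (auto simp: bmult_apply intro!: mult_right_mono)
    qed
    also have "\<dots> = norm (G s) * \<Lambda>0 (S s v)" by (simp add: S_scale s0 \<Lambda>0_scale)
    also have "\<Lambda>0 (S s v) \<le> (\<integral>x. (1 / c) * S s v x \<partial>\<mu>)"
      unfolding \<Lambda>0_def
    proof (rule integral_mono)
      fix x
      have "inverse (G 0 x) \<le> 1 / c" using G_ge[of 0 x] c T by (simp add: field_simps)
      then show "bmult (S s v) (invG 0) x \<le> 1 / c * S s v x"
        using mult_left_mono[of "inverse (G 0 x)" "1 / c" "S s v x"] S_pos[OF s0 v, of x] T
        by (simp add: bmult_apply invG_apply)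
    qed auto
    also have "\<dots> = (1 / c) * (\<integral>x. v x \<partial>m)" by (simp add: m(3))
    finally show "\<Lambda> s (bmult (G s) v) \<le> C * (\<integral>x. v x \<partial>m)" by (simp add: C_def mult.assoc mult_left_mono)
  qed
  from dominated_functional.representation[OF this] obtain \<nu> where \<nu>: "sets \<nu> = sets borel"
    "finite_measure \<nu>" "\<And>v. (\<integral>x. apply_bcontfun v x \<partial>\<nu>) = \<Lambda> s (bmult (G s) v)" by blast
  have "measure \<nu> (space \<nu>) = 1" using \<nu>(3)[of "const_bcontfun 1"] mass[OF s] by (simp add: bmult_one)
  then have "prob_space \<nu>"
    using \<nu>(2) by (intro prob_spaceI) (simp add: finite_measure.emeasure_eq_measure)
  with \<nu> show ?thesis by (auto simp: space_prob_algebra)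
qed

end

section \<open>The path of measures, its velocity and its action\<close>

context control
begin

definition N :: "real \<Rightarrow> 'a measure"
  where "N s = (SOME \<rho>. \<rho> \<in> space (prob_algebra borel) \<and>
    (\<forall>v. (\<integral>x. apply_bcontfun v x \<partial>\<rho>) = \<Lambda> s (bmult (G s) v)))"

lemma N:
  assumes "s \<in> {0..T}"
  shows "N s \<in> space (prob_algebra borel)" "(\<integral>x. apply_bcontfun v x \<partial>N s) = \<Lambda> s (bmult (G s) v)"
  using someI_ex[of "\<lambda>\<rho>. \<rho> \<in> space (prob_algebra borel) \<and>
      (\<forall>v. (\<integral>x. apply_bcontfun v x \<partial>\<rho>) = \<Lambda> s (bmult (G s) v))"] path_measure_exists[OF assms]
  unfolding N_def[symmetric] by blast+

text \<open>\<open>AC_paths\<close> asks for the initial value \<mu> itself, whereas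
  \<open>N 0\<close> is known only through integrals of continuous functions; hence the case
  distinction. After \<open>T\<close> the path stands still.\<close>

definition \<nu> :: "real \<Rightarrow> 'a measure"
  where "\<nu> s = (if s \<le> 0 then \<mu> else N (min s T))"

lemma \<nu>_space: "0 \<le> s \<Longrightarrow> \<nu> s \<in> space (prob_algebra borel)"
  using \<mu> N(1) T by (simp add: \<nu>_def)

lemma \<nu>_integral:
  assumes "0 \<le> s"
  shows "(\<integral>x. apply_bcontfun v x \<partial>\<nu> s) = \<Lambda> (min s T) (bmult (G (min s T)) v)"
  using assms N(2)[of "min s T" v] T initial[of v] by (cases "s = 0") (auto simp: \<nu>_def)

lemma \<nu>_integral':
  assumes "s \<in> {0..T}" shows "(\<integral>x. apply_bcontfun v x \<partial>\<nu> s) = \<Lambda> s (bmult (G s) v)"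
  using \<nu>_integral[of s v] assms by (simp add: min_def)

lemma \<nu>_continuous: "continuous_map (top_of_set {0..}) weak_topology \<nu>"
  unfolding weak_topology_def
proof (rule continuous_on_generated_topo)
  fix W :: "'a measure set"
  assume "W \<in> {{\<mu> \<in> space (prob_algebra borel). (\<integral>x. apply_bcontfun f x \<partial>\<mu>) \<in> U} | (f :: 'a cfun) U. open U}"
  then obtain f :: "'a cfun" and U where W: "W = {\<mu> \<in> space (prob_algebra borel). (\<integral>x. f x \<partial>\<mu>) \<in> U}" "open U"
    unfolding mem_Collect_eq by (elim exE conjE) (erule (1) that)
  have "continuous_on {0..T} (\<lambda>s. \<Lambda> s (bmult (G s) f))"
    by (rule \<Lambda>_continuous[OF order_refl]) (intro continuous_on_bmult G_continuous continuous_intros)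
  then have "continuous_on {0..} (\<lambda>s. \<Lambda> (min s T) (bmult (G (min s T)) f))"
    by (rule continuous_on_compose2[where g = "\<lambda>s. \<Lambda> s (bmult (G s) f)"])
      (use T in \<open>auto intro!: continuous_intros\<close>)
  then have "openin (top_of_set {0..}) ({0..} \<inter> (\<lambda>s. \<Lambda> (min s T) (bmult (G (min s T)) f)) -` U)"
    using W(2) by (simp add: continuous_openin_preimage_gen)
  also have "{0..} \<inter> (\<lambda>s. \<Lambda> (min s T) (bmult (G (min s T)) f)) -` U = \<nu> -` W \<inter> topspace (top_of_set {0..})"
    using \<nu>_space by (auto simp: W \<nu>_integral)
  finally show "openin (top_of_set {0..}) (\<nu> -` W \<inter> topspace (top_of_set {0..}))" .
next
  \<comment> \<open>The set of all probability measures is itself subbasic, which puts the path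
    inside the space of the generated topology.\<close>
  have "space (prob_algebra borel) \<in> {{\<mu> \<in> space (prob_algebra borel). (\<integral>x. apply_bcontfun f x \<partial>\<mu>) \<in> U} | (f :: 'a cfun) U. open U}"
    by (intro CollectI exI[of _ 0] exI[of _ UNIV]) auto
  then show "\<nu> ` topspace (top_of_set {0..}) \<subseteq>
      \<Union> {{\<mu> \<in> space (prob_algebra borel). (\<integral>x. apply_bcontfun f x \<partial>\<mu>) \<in> U} | (f :: 'a cfun) U. open U}"
    using \<nu>_space by (intro order_trans[OF _ Union_upper]) auto
qed

abbreviation "v_field f s \<equiv> \<Lambda> s (A (bmult (G s) f) - bmult (A (G s)) f)"

text \<open>Zero after \<open>T\<close>, where the path is constant; the restriction to D meets the
  extensionality convention of \<open>dual_space\<close>.\<close>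

definition u :: "real \<Rightarrow> 'a cfun \<Rightarrow> real"
  where "u s = (if s \<le> T then (\<lambda>f\<in>D. v_field f s) else (\<lambda>f\<in>D. 0))"

lemma \<Lambda>_bounded_linear: "0 \<le> s \<Longrightarrow> bounded_linear (\<Lambda> s)"
  by (rule bounded_linear_intro[of _ "exp (\<beta> * s) * \<Lambda>0 (const_bcontfun 1)"])
    (use \<Lambda>_abs[of s s] in \<open>auto simp: \<Lambda>_add \<Lambda>_scale mult.commute\<close>)

lemma v_field_continuous: "f \<in> D \<Longrightarrow> continuous_on {0..T} (v_field f)"
  by (rule \<Lambda>_continuous[OF order_refl])
    (intro continuous_intros continuous_on_bmult A_G_mult_continuous A_G_continuous)

lemma has_derivative_\<nu>: "has_path_derivative D \<tau> \<nu> u"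
  unfolding has_path_derivative_def
proof (intro conjI allI impI ballI)
  fix s :: real assume "0 \<le> s"
  then show "u s \<in> dual_space D \<tau>"
    by (simp add: u_def functional_in_dual G_D \<Lambda>_bounded_linear zero_in_dual)
next
  fix f assume f: "f \<in> D"
  have "(\<lambda>s. indicator {0..T} s *\<^sub>R v_field f s) \<in> borel_measurable borel"
    by (rule borel_measurable_continuous_on_indicator[OF _ v_field_continuous[OF f]]) simp
  then have "(\<lambda>s. indicator {0..T} s *\<^sub>R v_field f s) \<in> borel_measurable (restrict_space borel {0..})"
    by (rule measurable_restrict_space1)
  then show "(\<lambda>s. u s f) \<in> borel_measurable (restrict_space borel {0..})"
    by (rule measurable_cong[THEN iffD1, rotated]) (auto simp: space_restrict_space u_def f indicator_def)
next
  fix f and t :: real assume f: "f \<in> D" and t: "0 \<le> t"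
  define b where "b = min t T"
  have b: "b \<in> {0..T}" using t T by (simp add: b_def)
  have eq: "indicator {0..t} s *\<^sub>R u s f = indicator {0..b} s *\<^sub>R v_field f s" for s
    by (auto simp: indicator_def u_def f b_def)
  have int: "set_integrable lborel {0..b} (v_field f)"
    unfolding set_integrable_def
    by (rule borel_integrable_compact)
      (use b in \<open>auto intro!: continuous_on_subset[OF v_field_continuous[OF f]]\<close>)
  have "(\<integral>\<^sup>+s\<in>{0..t}. ennreal \<bar>u s f\<bar> \<partial>lborel)
      = (\<integral>\<^sup>+s. ennreal (norm (indicator {0..t} s *\<^sub>R u s f)) \<partial>lborel)"
    by (intro nn_integral_cong) (simp add: indicator_def)
  also have "\<dots> < \<infinity>"
    unfolding eq using int by (simp add: set_integrable_def integrable_iff_bounded)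
  finally show "(\<integral>\<^sup>+s\<in>{0..t}. ennreal \<bar>u s f\<bar> \<partial>lborel) < \<infinity>" .
  have "(LINT s:{0..t}|lborel. u s f) = (LINT s:{0..b}|lborel. v_field f s)"
    unfolding set_lebesgue_integral_def eq ..
  also have "\<dots> = integral {0..b} (v_field f)" by (rule set_borel_integral_eq_integral(2)[OF int])
  also have "\<dots> = \<Lambda> b (bmult (G b) f) - \<Lambda> 0 (bmult (G 0) f)" by (rule tilted_forward[OF b f, symmetric])
  also have "\<dots> = (\<integral>x. f x \<partial>\<nu> t) - (\<integral>x. f x \<partial>\<nu> 0)"
    using \<nu>_integral[OF t, of f] \<nu>_integral[of 0 f] T by (simp add: b_def)
  finally show "(\<integral>x. f x \<partial>\<nu> t) - (\<integral>x. f x \<partial>\<nu> 0) = (LINT s:{0..t}|lborel. u s f)" by simp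
qed

lemma \<nu>_AC: "\<nu> \<in> AC_paths D \<tau> \<mu>"
  unfolding AC_paths_def using \<nu>_continuous has_derivative_\<nu> by (auto simp: \<nu>_def)

text \<open>The Lagrangian's supremum evaluated at its formal maximiser f = ln G: the pairing
  contributes A(G ln G) - ln G AG, and G H(ln G) = AG.\<close>

definition cost_field :: "real \<Rightarrow> 'a cfun"
  where "cost_field s = A (xlogx (G s)) - bmult (lnG s) (A (G s)) - A (G s)"

lemma lagrangian_le:
  assumes s: "s \<in> {0..T}" shows "lagrangian S D (\<nu> s) (u s) \<le> ereal (\<Lambda> s (cost_field s))"
  unfolding lagrangian_def
proof (rule SUP_least)
  fix f assume f: "f \<in> D"
  have "u s f - (\<integral>x. hamiltonian S f x \<partial>\<nu> s)
      = \<Lambda> s (A (bmult (G s) f) - bmult (A (G s)) f - bmult (G s) (hamiltonian S f))"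
    using s f by (simp add: u_def \<nu>_integral' \<Lambda>_diff)
  also have "\<dots> \<le> \<Lambda> s (cost_field s)"
  proof (rule \<Lambda>_mono)
    fix x
    show "(A (bmult (G s) f) - bmult (A (G s)) f - bmult (G s) (hamiltonian S f)) x \<le> cost_field s x"
      using tilted_generator_le[OF G_D G_pos[OF s] f, of x]
      by (simp add: cost_field_def bmult_apply lnG_apply[OF s] mult.commute)
  qed (use s in simp)
  finally show "ereal (u s f - (\<integral>x. hamiltonian S f x \<partial>\<nu> s)) \<le> ereal (\<Lambda> s (cost_field s))" by simp
qed

lemma cost_nonneg: assumes "s \<in> {0..T}" shows "0 \<le> \<Lambda> s (cost_field s)"
proof -
  have "u s 0 = 0"
    using assms generator_zero \<Lambda>_scale[of s 0 0]
    by (simp add: u_def D_zero bounded_bilinear.zero_right[OF bounded_bilinear_bmult])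
  then have "ereal 0 \<le> lagrangian S D (\<nu> s) (u s)"
    unfolding lagrangian_def by (intro SUP_upper2[OF D_zero]) (simp add: hamiltonian_zero)
  also have "\<dots> \<le> ereal (\<Lambda> s (cost_field s))" by (rule lagrangian_le[OF assms])
  finally show ?thesis by simp
qed

lemma G_map: "continuous_map (top_of_set {0..T}) \<tau> G"
  unfolding G[abs_def] by (rule curve_continuous[OF I Z a_cont])

lemma
  shows xlogx_norm_continuous: "continuous_on {0..T} (\<lambda>s. xlogx (G s))"
    and A_xlogx_continuous: "continuous_on {0..T} (\<lambda>s. A (xlogx (G s)))"
proof -
  have 1: "continuous_map (top_of_set {0..T}) \<tau> (\<lambda>s. xlogx (G s))"
    by (rule xlogx_continuous[OF G_map _ G_ge c]) auto
  show "continuous_on {0..T} (\<lambda>s. xlogx (G s))"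
    using continuous_map_compose[OF 1 continuous_map_id_norm] by (simp add: o_def)
  show "continuous_on {0..T} (\<lambda>s. A (xlogx (G s)))"
    using continuous_map_compose[OF 1 A_continuous] by (simp add: o_def)
qed

text \<open>The chain rule in sup norm: the Taylor remainder is quadratic uniformly in x, because G
  stays above \<open>c\<close>, so after division by r it is of order r.\<close>

lemma xlogx_deriv:
  assumes s: "0 \<le> s" "s < T"
  shows "((\<lambda>r. (xlogx (G (s + r)) - xlogx (G s)) /\<^sub>R r)
    \<longlongrightarrow> bmult (const_bcontfun 1 + lnG s) (G' s)) (at_right 0)"
proof -
  define q where "q r = (G (s + r) - G s) /\<^sub>R r" for r
  define R where "R r = (xlogx (G (s + r)) - xlogx (G s)) /\<^sub>R r - bmult (const_bcontfun 1 + lnG s) (q r)" for r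
  have q: "(q \<longlongrightarrow> G' s) (at_right 0)" unfolding q_def by (rule G_deriv[OF s])
  have R_le: "norm (R r) \<le> 1 / c * (r * (norm (q r))\<^sup>2)" if r: "0 < r" "s + r \<in> {0..T}" for r
  proof (rule norm_bound)
    fix x
    have s': "s \<in> {0..T}" using s by simp
    define y y' where "y = G s x" and "y' = G (s + r) x"
    have "R r x = (xlogx (G (s + r)) x - xlogx (G s) x - (1 + lnG s x) * (G (s + r) x - G s x)) / r"
      using r by (simp add: R_def q_def bmult_apply divide_inverse algebra_simps)
    then have "R r x = (y' * ln y' - y * ln y - (1 + ln y) * (y' - y)) / r"
      by (simp only: xlogx_apply[OF G_pos[OF s']] xlogx_apply[OF G_pos[OF r(2)]] lnG_apply[OF s']
        y_def y'_def)
    moreover have "\<bar>y' * ln y' - y * ln y - (1 + ln y) * (y' - y)\<bar> \<le> 1 / c * \<bar>y' - y\<bar>\<^sup>2"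
      unfolding y_def y'_def by (intro xlogx_taylor c G_ge s' r(2))
    ultimately have "\<bar>R r x\<bar> \<le> (1 / c * \<bar>y' - y\<bar>\<^sup>2) / r"
      using r by (simp only: abs_divide abs_of_pos) (intro divide_right_mono, auto)
    also have "y' - y = r * q r x" using r by (simp add: q_def y_def y'_def)
    also have "\<bar>r * q r x\<bar>\<^sup>2 = r\<^sup>2 * \<bar>q r x\<bar>\<^sup>2" by (simp add: power_mult_distrib)
    also have "(1 / c * (r\<^sup>2 * \<bar>q r x\<bar>\<^sup>2)) / r = 1 / c * (r * \<bar>q r x\<bar>\<^sup>2)"
      using r by (simp add: power2_eq_square)
    also have "\<dots> \<le> 1 / c * (r * (norm (q r))\<^sup>2)"
      using norm_bounded[of "q r" x] r c by (intro mult_left_mono power_mono) auto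
    finally show "norm (R r x) \<le> 1 / c * (r * (norm (q r))\<^sup>2)" by simp
  qed
  have "(R \<longlongrightarrow> 0) (at_right 0)"
  proof (rule Lim_null_comparison)
    show "\<forall>\<^sub>F r in at_right 0. norm (R r) \<le> 1 / c * (r * (norm (q r))\<^sup>2)"
      using eventually_at_right_real[of 0 "T - s"] s R_le by (auto elim!: eventually_mono)
    have "((\<lambda>r. 1 / c * (r * (norm (q r))\<^sup>2)) \<longlongrightarrow> 1 / c * (0 * (norm (G' s))\<^sup>2)) (at_right 0)"
      by (intro tendsto_intros q)
    then show "((\<lambda>r. 1 / c * (r * (norm (q r))\<^sup>2)) \<longlongrightarrow> 0) (at_right 0)" by simp
  qed
  then have "((\<lambda>r. R r + bmult (const_bcontfun 1 + lnG s) (q r))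
      \<longlongrightarrow> 0 + bmult (const_bcontfun 1 + lnG s) (G' s)) (at_right 0)"
    by (intro tendsto_add bounded_bilinear.tendsto[OF bounded_bilinear_bmult] q tendsto_const)
  then show ?thesis by (simp add: R_def)
qed

lemma cost_continuous: "continuous_on {0..T} (\<lambda>s. \<Lambda> s (cost_field s))"
  unfolding cost_field_def
  by (rule \<Lambda>_continuous[OF order_refl])
    (intro continuous_intros continuous_on_bmult A_xlogx_continuous lnG_continuous A_G_continuous)

text \<open>In the forward equation for w = G ln G the term B G ln G cancels the terms carrying ln G
  G' and, with G' = -AG - BG, the integrand becomes \<open>cost_field\<close> minus B G. The
  correction is at most \<beta> \<Lambda>_s(G_s) = \<beta>.\<close>

lemma total_cost:
  "integral {0..T} (\<lambda>s. \<Lambda> s (cost_field s))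
    \<le> (\<integral>x. ln (G T x) \<partial>\<nu> T) - (\<integral>x. ln (G 0 x) \<partial>\<mu>) + \<beta> * T"
proof -
  define e where "e s = cost_field s - bmult (B s) (G s)" for s
  have BG_cont: "continuous_on {0..T} (\<lambda>s. \<Lambda> s (bmult (B s) (G s)))"
    by (rule \<Lambda>_continuous[OF order_refl]) (intro continuous_on_bmult B_continuous G_continuous)
  have "\<Lambda> T (xlogx (G T)) - \<Lambda> 0 (xlogx (G 0)) = integral {0..T} (\<lambda>s. \<Lambda> s (e s))"
  proof (rule forward[of _ _ "\<lambda>s. bmult (const_bcontfun 1 + lnG s) (G' s)"])
    show "xlogx (G s) \<in> gdom" if "s \<in> {0..T}" for s by (intro D_gdom xlogx_D G_pos[OF that] G_D)
    show "continuous_on {0..T} (\<lambda>s. bmult (const_bcontfun 1 + lnG s) (G' s))"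
      by (intro continuous_on_bmult continuous_intros lnG_continuous G'_continuous)
    fix s x assume s: "s \<in> {0..T}"
    have "B s x * (G s x * ln (G s x)) = - (A (G s) x + G' s x) * ln (G s x)"
      using B_G[OF s, of x] by (simp only: mult.assoc[symmetric])
    then show "A (xlogx (G s)) x + bmult (const_bcontfun 1 + lnG s) (G' s) x + B s x * xlogx (G s) x = e s x"
      using B_G[OF s, of x]
      by (simp add: e_def cost_field_def bmult_apply xlogx_apply[OF G_pos[OF s]] lnG_apply[OF s] algebra_simps)
  qed (use T in \<open>auto intro: xlogx_norm_continuous A_xlogx_continuous xlogx_deriv\<close>)
  also have "\<dots> = integral {0..T} (\<lambda>s. \<Lambda> s (cost_field s) - \<Lambda> s (bmult (B s) (G s)))"
    unfolding e_def by (intro integral_cong) (simp add: \<Lambda>_diff)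
  also have "\<dots> = integral {0..T} (\<lambda>s. \<Lambda> s (cost_field s)) - integral {0..T} (\<lambda>s. \<Lambda> s (bmult (B s) (G s)))"
    by (intro integral_diff integrable_continuous_real cost_continuous BG_cont)
  finally have "integral {0..T} (\<lambda>s. \<Lambda> s (cost_field s))
      = \<Lambda> T (xlogx (G T)) - \<Lambda> 0 (xlogx (G 0)) + integral {0..T} (\<lambda>s. \<Lambda> s (bmult (B s) (G s)))" by simp
  moreover have "integral {0..T} (\<lambda>s. \<Lambda> s (bmult (B s) (G s))) \<le> integral {0..T} (\<lambda>s. \<beta>)"
  proof (rule integral_le)
    fix s assume s: "s \<in> {0..T}"
    have "\<Lambda> s (bmult (B s) (G s)) \<le> \<Lambda> s (\<beta> *\<^sub>R G s)"
      using s B_bounds[OF s] G_pos[OF s]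
      by (intro \<Lambda>_mono) (auto simp: bmult_apply less_imp_le intro!: mult_right_mono)
    then show "\<Lambda> s (bmult (B s) (G s)) \<le> \<beta>" using s by (simp add: \<Lambda>_scale mass)
  qed (auto intro!: integrable_continuous_real BG_cont)
  moreover have "\<Lambda> s (xlogx (G s)) = (\<integral>x. ln (G s x) \<partial>\<nu> s)" if s: "s \<in> {0..T}" for s
  proof -
    have "xlogx (G s) = bmult (G s) (lnG s)"
      by (rule bcontfun_eqI) (simp add: xlogx_apply[OF G_pos[OF s]] bmult_apply lnG_apply[OF s])
    then show ?thesis using \<nu>_integral'[OF s, of "lnG s"] by (simp add: lnG_apply[OF s])
  qed
  moreover have "\<nu> 0 = \<mu>" by (simp add: \<nu>_def)
  ultimately show ?thesis using T by (simp add: mult.commute)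
qed

text \<open>The chosen derivative agrees with \<open>u\<close> at almost every time, so
  \<open>lagrangian_le\<close> applies under the integral.\<close>

theorem action_le:
  "(\<integral>\<^sup>+s\<in>{0..T}. e2ennreal (lagrangian S D (\<nu> s) (path_derivative D \<tau> \<nu> s)) \<partial>lborel)
    \<le> ennreal ((\<integral>x. ln (G T x) \<partial>\<nu> T) - (\<integral>x. ln (G 0 x) \<partial>\<mu>) + \<beta> * T)"
proof -
  have pd: "has_path_derivative D \<tau> \<nu> (path_derivative D \<tau> \<nu>)"
    unfolding path_derivative_def by (rule someI[of _ u]) (rule has_derivative_\<nu>)
  have int: "set_integrable lborel {0..T} (\<lambda>s. \<Lambda> s (cost_field s))"
    unfolding set_integrable_def by (rule borel_integrable_compact) (auto intro: cost_continuous)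
  have "(\<integral>\<^sup>+s\<in>{0..T}. e2ennreal (lagrangian S D (\<nu> s) (path_derivative D \<tau> \<nu> s)) \<partial>lborel)
      \<le> (\<integral>\<^sup>+s. ennreal (indicator {0..T} s *\<^sub>R \<Lambda> s (cost_field s)) \<partial>lborel)"
  proof (rule nn_integral_mono_AE)
    show "AE s in lborel. e2ennreal (lagrangian S D (\<nu> s) (path_derivative D \<tau> \<nu> s)) * indicator {0..T} s
        \<le> ennreal (indicator {0..T} s *\<^sub>R \<Lambda> s (cost_field s))"
      using path_derivative_unique[OF separable topspace_\<tau> pd has_derivative_\<nu> T]
    proof eventually_elim
      case (elim s)
      show ?case
      proof (cases "s \<in> {0..T}")
        case True
        then have "e2ennreal (lagrangian S D (\<nu> s) (path_derivative D \<tau> \<nu> s)) \<le> e2ennreal (ereal (\<Lambda> s (cost_field s)))"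
          using elim lagrangian_le[OF True] by (intro e2ennreal_mono) simp
        then show ?thesis using True by (simp add: e2ennreal_ereal)
      next
        case False
        then show ?thesis by (auto simp: indicator_def)
      qed
    qed
  qed
  also have "\<dots> = ennreal (LINT s:{0..T}|lborel. \<Lambda> s (cost_field s))"
    unfolding set_lebesgue_integral_def
    by (rule nn_integral_eq_integral)
      (use int cost_nonneg in \<open>auto simp: set_integrable_def indicator_def\<close>)
  also have "(LINT s:{0..T}|lborel. \<Lambda> s (cost_field s)) = integral {0..T} (\<lambda>s. \<Lambda> s (cost_field s))"
    by (rule set_borel_integral_eq_integral(2)[OF int])
  also have "ennreal \<dots> \<le> ennreal ((\<integral>x. ln (G T x) \<partial>\<nu> T) - (\<integral>x. ln (G 0 x) \<partial>\<mu>) + \<beta> * T)"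
    by (intro ennreal_leI total_cost)
  finally show ?thesis .
qed

end

section \<open>Approximate solutions of the backward equation\<close>

context core_semigroup
begin

lemma D_approx:
  assumes "f \<in> gdom" "0 < e" shows "\<exists>z\<in>D. norm (z - f) < e \<and> norm (A z - A f) < e"
proof -
  obtain F where F: "\<And>n. F n \<in> D" "F \<longlonglongrightarrow> f" "(\<lambda>n. A (F n)) \<longlonglongrightarrow> A f"
    using D_graph[OF assms(1)] by blast
  have "\<forall>\<^sub>F n in sequentially. dist (F n) f < e \<and> dist (A (F n)) (A f) < e"
    by (intro eventually_conj tendstoD F assms(2))
  then obtain n where "dist (F n) f < e \<and> dist (A (F n)) (A f) < e"
    using eventually_happens'[OF sequentially_bot] by blast
  then show ?thesis using F(1) by (auto simp: dist_norm)
qed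

text \<open>Averages (1/r) times the integral of S_q v over {0..r}, with v in D: their image under A
  is (S_r v - v)/r, again in the domain. Having Ag in the domain makes the orbit of Ag continuous in
  graph norm.\<close>

lemma twice_differentiable_dense:
  assumes "0 < e" shows "\<exists>g. g \<in> gdom \<and> A g \<in> gdom \<and> norm (g - f) < e"
proof -
  have "f \<in> closure D" by (simp add: D_dense)
  then obtain v where v: "v \<in> D" "dist v f < e / 2"
    using assms unfolding closure_approachable by (meson half_gt_zero)
  note v_dom = D_gdom[OF v(1)]
  have "((\<lambda>r. r * norm (A v)) \<longlongrightarrow> 0) (at_right 0)" by (auto intro!: tendsto_eq_intros)
  then have "\<forall>\<^sub>F r in at_right 0. r * norm (A v) < e / 2" using assms by (intro order_tendstoD) auto
  moreover have "\<forall>\<^sub>F r in at_right (0::real). 0 < r" by (rule eventually_right_0_nonneg)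
  ultimately have "\<forall>\<^sub>F r in at_right 0. 0 < r \<and> r * norm (A v) < e / 2" by eventually_elim simp
  then obtain r where r: "0 < r" "r * norm (A v) < e / 2"
    using eventually_happens'[OF trivial_limit_at_right_real] by blast
  define g where "g = (1 / r) *\<^sub>R integral {0..r} (\<lambda>q. S q v)"
  have int: "integral {0..r} (\<lambda>q. S q v) \<in> gdom" "A (integral {0..r} (\<lambda>q. S q v)) = S r v - v"
    using dom_integral[OF v_dom] generator_integral[OF v_dom] r by auto
  have "g \<in> gdom" "A g = (1 / r) *\<^sub>R (S r v - v)"
    unfolding g_def by (simp_all add: dom_scale generator_scale int)
  moreover have "(1 / r) *\<^sub>R (S r v - v) \<in> gdom"
    using r by (intro dom_scale dom_diff dom_S v_dom) auto
  moreover have "norm (g - f) < e"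
  proof -
    have "integral {0..r} (\<lambda>q. S q v - v) = integral {0..r} (\<lambda>q. S q v) - r *\<^sub>R v"
      using r by (subst integral_diff) (auto intro!: integrable_continuous_real continuous_intros)
    then have "g - v = (1 / r) *\<^sub>R integral {0..r} (\<lambda>q. S q v - v)"
      using r by (simp add: g_def scaleR_diff_right)
    moreover have "norm (integral {0..r} (\<lambda>q. S q v - v)) \<le> (r * norm (A v)) * (r - 0)"
    proof (rule integral_bound)
      show "continuous_on {0..r} (\<lambda>q. S q v - v)" by (intro continuous_intros) auto
      fix q assume q: "q \<in> {0..r}"
      then have "norm (S q v - v) \<le> q * norm (A v)" by (intro norm_S_diff_le[OF v_dom]) auto
      also have "\<dots> \<le> r * norm (A v)" using q by (intro mult_right_mono) auto
      finally show "norm (S q v - v) \<le> r * norm (A v)" .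
    qed (use r in simp)
    ultimately have "norm (g - v) \<le> (1 / r) * ((r * norm (A v)) * r)"
      using r by (simp add: pos_divide_le_eq)
    also have "\<dots> = r * norm (A v)" using r by simp
    finally have "norm (g - v) < e / 2" using r by simp
    moreover have "norm (v - f) < e / 2" using v by (simp add: dist_norm)
    ultimately show ?thesis using norm_triangle_ineq[of "g - v" "v - f"] by simp
  qed
  ultimately show ?thesis by metis
qed

text \<open>
  \<open>H\<close> is an approximate solution in \<open>D\<close> of the backward equation \<open>AH + H' = 0\<close>: since \<open>D\<close> need not be
  invariant under \<open>S\<close>, the curve \<open>r \<mapsto> S(r)Ag\<close> is replaced by a Bernstein polynomial with
  coefficients in \<open>D\<close>, close to it in graph norm, and integrated in time.
\<close>
lemma approximate_backward_solution:
  fixes t e :: real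
  assumes t: "0 \<le> t" and e: "0 < e" and g: "g \<in> gdom" "A g \<in> gdom"
  shows "\<exists>(I :: nat set) Z a a'. finite I \<and> (\<forall>i\<in>I. Z i \<in> D) \<and>
    (\<forall>i\<in>I. \<forall>s\<in>{0..t}. (a i has_real_derivative a' i s) (at s within {0..t})) \<and>
    (\<forall>i\<in>I. continuous_on {0..t} (a' i)) \<and>
    (\<forall>s\<in>{0..t}. norm ((\<Sum>i\<in>I. a i s *\<^sub>R Z i) - S (t - s) g) \<le> e \<and>
      norm (A (\<Sum>i\<in>I. a i s *\<^sub>R Z i) + (\<Sum>i\<in>I. a' i s *\<^sub>R Z i)) \<le> e)"
proof -
  \<comment> \<open>Times are rescaled to {0..1} by division by \<open>T\<close>, which must be
    positive also when \<open>t = 0\<close>.\<close>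
  define T where "T = t + 1"
  have T: "0 < T" "t < T" using t by (auto simp: T_def)
  \<comment> \<open>Error budget of the residual: \<eta> from replacing g by z,
    \<open>2 * \<eta> * t\<close> from the time integral of A Q, and \<open>2 * \<eta>\<close> from
    Q itself.\<close>
  define \<eta> where "\<eta> = e / (2 * t + 3)"
  have \<eta>: "0 < \<eta>" "\<eta> + 2 * \<eta> * t + 2 * \<eta> = e" "\<eta> + 2 * \<eta> * t \<le> e"
  proof -
    show pos: "0 < \<eta>" using e t by (simp add: \<eta>_def)
    have "\<eta> * (2 * t + 3) = e" using t by (simp add: \<eta>_def)
    then show sum: "\<eta> + 2 * \<eta> * t + 2 * \<eta> = e" by (simp add: algebra_simps)
    show "\<eta> + 2 * \<eta> * t \<le> e" using pos sum by linarith
  qed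
  \<comment> \<open>Approximating the pair gives one polynomial good for both components; since A
    S_r Ag = S_r AAg, this is approximation in graph norm.\<close>
  define y where "y x = (S (T * x) (A g), S (T * x) (A (A g)))" for x
  have "continuous_on {0..1} y"
    unfolding y_def using T by (intro continuous_intros) auto
  from Bernstein_uniform_approximation[OF this \<eta>(1)] obtain N where N: "0 < N"
    "\<And>x. x \<in> {0..1} \<Longrightarrow> norm (y x - (\<Sum>k\<le>N. Bernstein N k x *\<^sub>R y (k / N))) < \<eta>" by blast
  define p where "p k = T * (real k / real N)" for k
  have p: "0 \<le> p k" for k using T by (simp add: p_def)
  have "\<forall>k. \<exists>z\<in>D. norm (z - S (p k) (A g)) < \<eta> \<and> norm (A z - S (p k) (A (A g))) < \<eta>"
    using D_approx[OF dom_S[OF g(2) p] \<eta>(1)] by (simp add: generator_S[OF g(2) p])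
  then obtain Y where Y: "\<And>k. Y k \<in> D" "\<And>k. norm (Y k - S (p k) (A g)) < \<eta>"
    "\<And>k. norm (A (Y k) - S (p k) (A (A g))) < \<eta>" by metis
  obtain z where z: "z \<in> D" "norm (z - g) < \<eta>" "norm (A z - A g) < \<eta>"
    using D_approx[OF g(1) \<eta>(1)] by blast
  define b where "b k r = Bernstein N k (r / T)" for k r
  have b_cont: "continuous_on J (b k)" for J k
    unfolding b_def Bernstein_def using T by (intro continuous_intros) auto
  have b_nonneg: "0 \<le> b k r" if "r \<in> {0..t}" for k r
    unfolding b_def using that T by (intro Bernstein_nonneg) auto
  have b_sum: "(\<Sum>k\<le>N. b k r) = 1" for r by (simp add: b_def)
  define Q where "Q r = (\<Sum>k\<le>N. b k r *\<^sub>R Y k)" for r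
  have Y_dom: "Y k \<in> gdom" for k by (intro D_gdom Y)
  have AQ: "A (Q r) = (\<Sum>k\<le>N. b k r *\<^sub>R A (Y k))" for r
    using dom_sum[of "{..N}" "\<lambda>k. b k r *\<^sub>R Y k"] by (simp add: Q_def dom_scale generator_scale Y_dom)
  \<comment> \<open>The Bernstein weights are convex: \<eta> for replacing the nodes by elements of
    D, another \<eta> for the polynomial.\<close>
  have mix: "norm ((\<Sum>k\<le>N. b k r *\<^sub>R U k) - V) \<le> 2 * \<eta>"
    if r: "r \<in> {0..t}" and U: "\<And>k. norm (U k - W k) < \<eta>"
      and W: "norm (V - (\<Sum>k\<le>N. b k r *\<^sub>R W k)) \<le> \<eta>" for r V and U W :: "nat \<Rightarrow> 'a cfun"
  proof -
    have "norm (\<Sum>k\<le>N. b k r *\<^sub>R (U k - W k)) \<le> (\<Sum>k\<le>N. b k r * \<eta>)"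
      by (rule sum_norm_le) (simp add: b_nonneg[OF r] mult_left_mono less_imp_le[OF U])
    also have "\<dots> = \<eta>" by (simp only: sum_distrib_right[symmetric] b_sum mult_1)
    finally have "norm ((\<Sum>k\<le>N. b k r *\<^sub>R U k) - (\<Sum>k\<le>N. b k r *\<^sub>R W k)) \<le> \<eta>"
      by (simp add: scaleR_diff_right sum_subtractf)
    moreover have "norm ((\<Sum>k\<le>N. b k r *\<^sub>R W k) - V) \<le> \<eta>" using W by (simp add: norm_minus_commute)
    ultimately show ?thesis
      using norm_triangle_ineq[of "(\<Sum>k\<le>N. b k r *\<^sub>R U k) - (\<Sum>k\<le>N. b k r *\<^sub>R W k)"
          "(\<Sum>k\<le>N. b k r *\<^sub>R W k) - V"] by simp
  qed
  have close: "norm (S r (A g) - (\<Sum>k\<le>N. b k r *\<^sub>R S (p k) (A g))) \<le> \<eta>"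
    "norm (S r (A (A g)) - (\<Sum>k\<le>N. b k r *\<^sub>R S (p k) (A (A g)))) \<le> \<eta>" if r: "r \<in> {0..t}" for r
  proof -
    let ?d = "y (r / T) - (\<Sum>k\<le>N. Bernstein N k (r / T) *\<^sub>R y (k / N))"
    have "norm ?d < \<eta>" using r T by (intro N) auto
    moreover have "norm (fst ?d) \<le> norm ?d" "norm (snd ?d) \<le> norm ?d"
      using norm_fst_le[of "fst ?d" "snd ?d"] norm_snd_le[of "snd ?d" "fst ?d"]
      by (simp_all only: prod.collapse)
    moreover have d1: "fst ?d = S r (A g) - (\<Sum>k\<le>N. b k r *\<^sub>R S (p k) (A g))"
      using T by (simp add: y_def b_def p_def fst_sum)
    moreover have d2: "snd ?d = S r (A (A g)) - (\<Sum>k\<le>N. b k r *\<^sub>R S (p k) (A (A g)))"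
      using T by (simp add: y_def b_def p_def snd_sum)
    ultimately show "norm (S r (A g) - (\<Sum>k\<le>N. b k r *\<^sub>R S (p k) (A g))) \<le> \<eta>"
      "norm (S r (A (A g)) - (\<Sum>k\<le>N. b k r *\<^sub>R S (p k) (A (A g)))) \<le> \<eta>"
      unfolding d1[symmetric] d2[symmetric] by linarith+
  qed
  have Q_close: "norm (Q r - S r (A g)) \<le> 2 * \<eta>" "norm (A (Q r) - S r (A (A g))) \<le> 2 * \<eta>"
    if r: "r \<in> {0..t}" for r
    unfolding AQ unfolding Q_def by (rule mix[OF r Y(2) close(1)[OF r]] mix[OF r Y(3) close(2)[OF r]])+
  \<comment> \<open>Index 0 carries z, index \<open>Suc k\<close> carries \<open>Y k\<close>. Thus
    H_s = z + the integral of Q over {0..t - s}, modelled on S_r g = g + the integral of S_q Ag, and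
    H' = -Q(t - s).\<close>
  define a where "a i s = (case i of 0 \<Rightarrow> 1 | Suc k \<Rightarrow> integral {0..t - s} (b k))" for i s
  define a' where "a' i s = (case i of 0 \<Rightarrow> 0 | Suc k \<Rightarrow> - b k (t - s))" for i s
  define Z where "Z i = (case i of 0 \<Rightarrow> z | Suc k \<Rightarrow> Y k)" for i
  have sums: "(\<Sum>i\<le>Suc N. c i *\<^sub>R Z i) = c 0 *\<^sub>R z + (\<Sum>k\<le>N. c (Suc k) *\<^sub>R Y k)" for c :: "nat \<Rightarrow> real"
    by (simp add: sum.atMost_Suc_shift Z_def del: sum.atMost_Suc)
  have b_int: "b k integrable_on {0..r}" for k r by (intro integrable_continuous_real b_cont)
  define H where "H s = (\<Sum>i\<le>Suc N. a i s *\<^sub>R Z i)" for s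
  define H' where "H' s = (\<Sum>i\<le>Suc N. a' i s *\<^sub>R Z i)" for s
  have H: "H s = z + integral {0..t - s} Q" for s
  proof -
    have "integral {0..t - s} Q = (\<Sum>k\<le>N. integral {0..t - s} (\<lambda>r. b k r *\<^sub>R Y k))"
      unfolding Q_def by (intro integral_sum) (auto intro!: integrable_continuous_real continuous_intros b_cont)
    also have "\<dots> = (\<Sum>k\<le>N. integral {0..t - s} (b k) *\<^sub>R Y k)"
      using b_int by (intro sum.cong refl)
        (rule integral_unique, rule has_integral_scaleR_left, auto simp: integrable_integral)
    finally show ?thesis unfolding H_def sums by (simp add: a_def)
  qed
  have H': "H' s = - Q (t - s)" for s
    unfolding H'_def sums by (simp add: a'_def Q_def sum_negf)
  have AH: "A (H s) = A z + integral {0..t - s} (\<lambda>r. A (Q r))" for s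
  proof -
    have "integral {0..t - s} (\<lambda>r. A (Q r)) = (\<Sum>k\<le>N. integral {0..t - s} (\<lambda>r. b k r *\<^sub>R A (Y k)))"
      unfolding AQ by (intro integral_sum) (auto intro!: integrable_continuous_real continuous_intros b_cont)
    also have "\<dots> = (\<Sum>k\<le>N. integral {0..t - s} (b k) *\<^sub>R A (Y k))"
      using b_int by (intro sum.cong refl)
        (rule integral_unique, rule has_integral_scaleR_left, auto simp: integrable_integral)
    also have "A z + \<dots> = (\<Sum>i\<le>Suc N. a i s *\<^sub>R A (Z i))"
      by (simp add: sum.atMost_Suc_shift Z_def a_def del: sum.atMost_Suc)
    also have "\<dots> = A (H s)"
    proof -
      have "Z i \<in> gdom" for i using z Y by (auto simp: Z_def D_gdom split: nat.split)
      then show ?thesis unfolding H_def using dom_sum[of "{..Suc N}" "\<lambda>i. a i s *\<^sub>R Z i"] by (simp add: dom_scale generator_scale)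
    qed
    finally show ?thesis by simp
  qed
  have int_close: "norm (integral {0..r} F - integral {0..r} (\<lambda>q. S q v)) \<le> 2 * \<eta> * t"
    if r: "r \<in> {0..t}" and F: "continuous_on {0..r} F" "\<And>q. q \<in> {0..t} \<Longrightarrow> norm (F q - S q v) \<le> 2 * \<eta>"
    for r v and F :: "real \<Rightarrow> 'a cfun"
  proof -
    have "norm (integral {0..r} (\<lambda>q. F q - S q v)) \<le> 2 * \<eta> * (r - 0)"
      by (rule integral_bound) (use r F in \<open>auto intro!: continuous_intros\<close>)
    also have "\<dots> \<le> 2 * \<eta> * t" using r \<eta>(1) by (intro mult_left_mono) auto
    finally show ?thesis
      using F by (subst (asm) integral_diff) (auto intro!: integrable_continuous_real continuous_intros)
  qed
  have Q_cont: "continuous_on J Q" "continuous_on J (\<lambda>r. A (Q r))" for J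
    unfolding AQ unfolding Q_def by (intro continuous_intros b_cont)+
  have est: "norm (H s - S (t - s) g) \<le> e \<and>
      norm (A (H s) + H' s) \<le> e" if s: "s \<in> {0..t}" for s
  proof
    have r: "t - s \<in> {0..t}" "0 \<le> t - s" using s by auto
    have ic: "norm (integral {0..t - s} Q - integral {0..t - s} (\<lambda>q. S q (A g))) \<le> 2 * \<eta> * t"
      "norm (integral {0..t - s} (\<lambda>r. A (Q r)) - integral {0..t - s} (\<lambda>q. S q (A (A g)))) \<le> 2 * \<eta> * t"
      by (rule int_close[OF r(1) Q_cont(1) Q_close(1)], assumption,
          rule int_close[OF r(1) Q_cont(2) Q_close(2)], assumption)
    have eq: "(z + integral {0..t - s} Q) - S (t - s) g
        = (z - g) + (integral {0..t - s} Q - integral {0..t - s} (\<lambda>q. S q (A g)))"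
      using S_integral[OF g(1) r(2)] by (simp add: algebra_simps)
    have "norm ((z + integral {0..t - s} Q) - S (t - s) g) \<le> \<eta> + 2 * \<eta> * t"
      unfolding eq by (rule order_trans[OF norm_triangle_ineq add_mono[OF less_imp_le[OF z(2)] ic(1)]])
    then show "norm (H s - S (t - s) g) \<le> e" unfolding H using \<eta>(3) by linarith
    \<comment> \<open>The identity S_r Ag = Ag + the integral of S_q AAg is subtracted, so only
      approximation errors remain.\<close>
    have eq': "A z + integral {0..t - s} (\<lambda>r. A (Q r)) - Q (t - s)
        = ((A z - A g) + (integral {0..t - s} (\<lambda>r. A (Q r)) - integral {0..t - s} (\<lambda>q. S q (A (A g)))))
          - (Q (t - s) - S (t - s) (A g))"
      using S_integral[OF g(2) r(2)] by (simp add: algebra_simps)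
    have n: "norm ((A z - A g) + (integral {0..t - s} (\<lambda>r. A (Q r)) - integral {0..t - s} (\<lambda>q. S q (A (A g)))))
        \<le> \<eta> + 2 * \<eta> * t"
      by (rule order_trans[OF norm_triangle_ineq add_mono[OF less_imp_le[OF z(3)] ic(2)]])
    have "norm (A z + integral {0..t - s} (\<lambda>r. A (Q r)) - Q (t - s)) \<le> \<eta> + 2 * \<eta> * t + 2 * \<eta>"
      unfolding eq' by (rule order_trans[OF norm_triangle_ineq4 add_mono[OF n Q_close(1)[OF r(1)]]])
    then show "norm (A (H s) + H' s) \<le> e"
      unfolding AH H' using \<eta>(2) by simp
  qed
  have deriv: "(a i has_real_derivative a' i s) (at s within {0..t})" if s: "s \<in> {0..t}" for i s
  proof (cases i)
    case 0 then show ?thesis by (simp add: a_def[abs_def] a'_def)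
  next
    case (Suc k)
    have "((\<lambda>r. integral {0..r} (b k)) has_real_derivative b k (t - s)) (at (t - s) within {0..t})"
      by (rule integral_has_real_derivative[OF b_cont]) (use s in auto)
    moreover have "(\<lambda>s. t - s) ` {0..t} \<subseteq> {0..t}" by auto
    ultimately have "((\<lambda>r. integral {0..r} (b k)) has_real_derivative b k (t - s))
        (at (t - s) within (\<lambda>s. t - s) ` {0..t})"
      by (rule DERIV_subset)
    moreover have "((\<lambda>s. t - s) has_real_derivative - 1) (at s within {0..t})"
      by (auto intro!: derivative_eq_intros)
    ultimately have "((\<lambda>r. integral {0..r} (b k)) \<circ> (\<lambda>s. t - s) has_real_derivative b k (t - s) * - 1) (at s within {0..t})"
      by (rule DERIV_image_chain)
    then show ?thesis using Suc by (simp add: a_def[abs_def] a'_def o_def)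
  qed
  have a'_cont: "continuous_on {0..t} (a' i)" for i
    by (cases i) (auto simp: a'_def[abs_def] intro!: continuous_intros continuous_on_compose2[OF b_cont[of UNIV]])
  show ?thesis
    by (intro exI[of _ "{..Suc N}"] exI[of _ Z] exI[of _ a] exI[of _ a'] conjI ballI deriv a'_cont)
      (use z Y est[unfolded H_def H'_def] in \<open>auto simp: Z_def simp del: sum.atMost_Suc split: nat.split\<close>)
qed

end

section \<open>The lower bound\<close>

text \<open>\<open>ennreal\<close> sends negative numbers to 0, so \<open>action_le\<close> is a
  bound by the real number itself only once that number is known to be nonnegative.\<close>

lemma (in control) action_bound_nonneg:
  "0 \<le> (\<integral>x. ln (G T x) \<partial>\<nu> T) - (\<integral>x. ln (G 0 x) \<partial>\<mu>) + \<beta> * T"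
proof -
  have "0 \<le> integral {0..T} (\<lambda>s. \<Lambda> s (cost_field s))"
    by (rule Henstock_Kurzweil_Integration.integral_nonneg[OF integrable_continuous_real[OF cost_continuous] cost_nonneg])
  then show ?thesis using total_cost by linarith
qed

lemma (in control) variational_ge:
  "ereal ((\<integral>x. apply_bcontfun h x \<partial>\<nu> T) - ((\<integral>x. ln (G T x) \<partial>\<nu> T) - (\<integral>x. ln (G 0 x) \<partial>\<mu>) + \<beta> * T))
    \<le> variational_semigroup S D \<tau> T (\<lambda>\<rho>. \<integral>x. h x \<partial>\<rho>) \<mu>"
proof -
  define r where "r = (\<integral>x. ln (G T x) \<partial>\<nu> T) - (\<integral>x. ln (G 0 x) \<partial>\<mu>) + \<beta> * T"
  let ?c = "\<integral>\<^sup>+s\<in>{0..T}. e2ennreal (lagrangian S D (\<nu> s) (path_derivative D \<tau> \<nu> s)) \<partial>lborel"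
  have "?c \<le> ennreal r" using action_le by (simp add: r_def)
  then have "enn2ereal ?c \<le> ereal r"
    using action_bound_nonneg by (simp add: r_def less_eq_ennreal.rep_eq enn2ereal_ennreal)
  then have "ereal (\<integral>x. h x \<partial>\<nu> T) - ereal r \<le> ereal (\<integral>x. h x \<partial>\<nu> T) - enn2ereal ?c"
    by (intro ereal_minus_mono) auto
  also have "\<dots> \<le> variational_semigroup S D \<tau> T (\<lambda>\<rho>. \<integral>x. h x \<partial>\<rho>) \<mu>"
    unfolding variational_semigroup_def by (rule SUP_upper[OF \<nu>_AC])
  finally show ?thesis by (simp add: r_def)
qed

context core_semigroup
begin

text \<open>The loss is \<theta>(4 + t): 2\<theta> at each end for replacing ln S_(t-s) exp(h) by ln
  H_s, and 2\<theta>t from \<beta>, of which the decay factor exp(-\<theta>t) of the terminal value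
  gives \<theta>t back.\<close>

lemma variational_lower_bound:
  fixes h :: "'a cfun" and t \<epsilon> :: real
  assumes t: "0 \<le> t" and \<epsilon>: "0 < \<epsilon>" and \<mu>: "\<mu> \<in> space (prob_algebra borel)"
    and kernel: "\<And>s. 0 \<le> s \<Longrightarrow> \<exists>m. propagates \<mu> s m"
  shows "ereal ((\<integral>x. log_semigroup S t h x \<partial>\<mu>) - \<epsilon>)
    \<le> variational_semigroup S D \<tau> t (\<lambda>\<rho>. \<integral>x. h x \<partial>\<rho>) \<mu>"
proof -
  define m where "m = exp (- norm h)"
  have m: "0 < m" by (simp add: m_def)
  define E where "E = bcomp exp h"
  have E_ge: "m \<le> E x" for x
    using norm_bounded[of h x] by (simp add: E_def bcomp_exp m_def)
  have SE_ge: "m \<le> S s E x" if "0 \<le> s" for s x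
  proof -
    have "S s (m *\<^sub>R const_bcontfun 1) x \<le> S s E x" by (rule S_mono[OF that]) (simp add: E_ge)
    then show ?thesis using that by (simp add: S_scale S_one)
  qed
  \<comment> \<open>The first bound keeps H above m/2 despite an error of 2\<delta>; the second
    makes \<theta>(4 + t) at most \<epsilon>, where \<theta> = 2\<delta>/m.\<close>
  define \<delta> where "\<delta> = min (m / 4) (\<epsilon> * m / (2 * (4 + t)))"
  have "0 < \<delta>" using m \<epsilon> t by (simp add: \<delta>_def)
  moreover have "\<delta> \<le> m / 4" "\<delta> \<le> \<epsilon> * m / (2 * (4 + t))" unfolding \<delta>_def by (rule min.cobounded1 min.cobounded2)+
  ultimately have \<delta>: "0 < \<delta>" "\<delta> \<le> m / 4" "\<delta> \<le> \<epsilon> * m / (2 * (4 + t))" .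
  obtain g where g: "g \<in> gdom" "A g \<in> gdom" "norm (g - E) < \<delta>"
    using twice_differentiable_dense[OF \<delta>(1)] by blast
  obtain I :: "nat set" and Z a a' where I: "finite I" and *: "\<forall>i\<in>I. Z i \<in> D"
    "\<forall>i\<in>I. \<forall>s\<in>{0..t}. (a i has_real_derivative a' i s) (at s within {0..t})"
    "\<forall>i\<in>I. continuous_on {0..t} (a' i)"
    "\<forall>s\<in>{0..t}. norm ((\<Sum>i\<in>I. a i s *\<^sub>R Z i) - S (t - s) g) \<le> \<delta> \<and>
      norm (A (\<Sum>i\<in>I. a i s *\<^sub>R Z i) + (\<Sum>i\<in>I. a' i s *\<^sub>R Z i)) \<le> \<delta>"
    using approximate_backward_solution[OF t \<delta>(1) g(1,2)] by (elim exE conjE) (rule that)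
  note Z = *(1)[rule_format] and a = *(2)[rule_format] and a'_cont = *(3)[rule_format]
    and est = *(4)[rule_format]
  define H where "H s = (\<Sum>i\<in>I. a i s *\<^sub>R Z i)" for s
  define H' where "H' s = (\<Sum>i\<in>I. a' i s *\<^sub>R Z i)" for s
  define c0 where "c0 = m / 2"
  have c0: "0 < c0" using m by (simp add: c0_def)
  \<comment> \<open>One \<delta> for H against the orbit of g, one for g against exp(h), which the
    contraction S preserves.\<close>
  have H_close: "\<bar>H s x - S (t - s) E x\<bar> \<le> 2 * \<delta>" if s: "s \<in> {0..t}" for s x
  proof -
    have "norm (S (t - s) g - S (t - s) E) \<le> \<delta>"
      using S_contraction[of "t - s" "g - E"] s g(3) by (simp add: S_diff)
    then have "norm ((H s - S (t - s) g) + (S (t - s) g - S (t - s) E)) \<le> \<delta> + \<delta>"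
      using est[OF s] unfolding H_def by (intro norm_triangle_mono) auto
    then show ?thesis using norm_bounded[of "H s - S (t - s) E" x] by simp
  qed
  have H_ge: "c0 \<le> H s x" if s: "s \<in> {0..t}" for s x
    using H_close[OF s, of x] SE_ge[of "t - s" x] s \<delta>(2) by (simp add: c0_def)
  have resid: "\<bar>A (H s) x + H' s x\<bar> \<le> \<delta>" if s: "s \<in> {0..t}" for s x
    using est[OF s] norm_bounded[of "A (H s) + H' s" x] by (simp add: H_def H'_def)
  \<comment> \<open>The residual is at most \<delta> = \<theta> c0 \<le> \<theta> H. Damping by
    exp(-\<theta>s) adds -\<theta>H to it, so the sum lies between -2\<theta>H and 0.\<close>
  define \<theta> where "\<theta> = \<delta> / c0"
  have \<theta>: "0 \<le> \<theta>" "\<theta> * c0 = \<delta>" using \<delta>(1) c0 by (simp_all add: \<theta>_def)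
  define b where "b i s = exp (- \<theta> * s) * a i s" for i s
  define b' where "b' i s = exp (- \<theta> * s) * (a' i s - \<theta> * a i s)" for i s
  define G where "G s = (\<Sum>i\<in>I. b i s *\<^sub>R Z i)" for s
  define G' where "G' s = (\<Sum>i\<in>I. b' i s *\<^sub>R Z i)" for s
  have G: "G s = exp (- \<theta> * s) *\<^sub>R H s" for s
    by (simp add: G_def H_def b_def scaleR_sum_right)
  have G': "G' s = exp (- \<theta> * s) *\<^sub>R (H' s - \<theta> *\<^sub>R H s)" for s
    by (simp add: G'_def H_def H'_def b'_def scaleR_sum_right scaleR_diff_left scaleR_diff_right
        sum_subtractf right_diff_distrib)
  have H_dom: "H s \<in> gdom" for s unfolding H_def by (intro D_gdom D_sum D_scale Z)
  have AG: "A (G s) x + G' s x = exp (- \<theta> * s) * (A (H s) x + H' s x - \<theta> * H s x)" for s x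
    by (simp add: G G' generator_scale[OF H_dom] algebra_simps)
  have a_cont: "i \<in> I \<Longrightarrow> continuous_on {0..t} (a i)" for i
    using a by (meson DERIV_continuous continuous_on_eq_continuous_within)
  have \<theta>H: "\<delta> \<le> \<theta> * H s x" if s: "s \<in> {0..t}" for s x
    using mult_left_mono[OF H_ge[OF s, of x] \<theta>(1)] \<theta>(2) by simp
  interpret C: control S D \<tau> I Z b b' G G' "exp (- \<theta> * t) * c0" "2 * \<theta>" t \<mu>
  proof
    show "0 \<le> t" "finite I" "\<And>i. i \<in> I \<Longrightarrow> Z i \<in> D" "\<mu> \<in> space (prob_algebra borel)"
      by (fact t I Z \<mu>)+
    show "G s = (\<Sum>i\<in>I. b i s *\<^sub>R Z i)" "G' s = (\<Sum>i\<in>I. b' i s *\<^sub>R Z i)" for s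
      by (simp_all add: G_def G'_def)
    show "0 < exp (- \<theta> * t) * c0" using c0 by simp
    show "(b i has_real_derivative b' i s) (at s within {0..t})" if "i \<in> I" "s \<in> {0..t}" for i s
      unfolding b_def[abs_def] b'_def
      by (auto intro!: derivative_eq_intros a that simp: algebra_simps)
    show "continuous_on {0..t} (b' i)" if "i \<in> I" for i
      unfolding b'_def[abs_def] by (intro continuous_intros a'_cont a_cont that)
    show "exp (- \<theta> * t) * c0 \<le> G s x" if s: "s \<in> {0..t}" for s x
    proof -
      have "exp (- \<theta> * t) * c0 \<le> exp (- \<theta> * s) * H s x"
        using s \<theta>(1) c0 H_ge[OF s, of x] by (intro mult_mono) (auto intro: mult_left_mono)
      then show ?thesis by (simp add: G)
    qed
    show "A (G s) x + G' s x \<le> 0" if s: "s \<in> {0..t}" for s x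
      unfolding AG using resid[OF s, of x] \<theta>H[OF s, of x] by (intro mult_nonneg_nonpos) auto
    show "- (2 * \<theta> * G s x) \<le> A (G s) x + G' s x" if s: "s \<in> {0..t}" for s x
    proof -
      have "0 \<le> exp (- \<theta> * s) * (A (H s) x + H' s x + \<theta> * H s x)"
        using resid[OF s, of x] \<theta>H[OF s, of x] by (intro mult_nonneg_nonneg) auto
      then show ?thesis unfolding AG by (simp add: G algebra_simps)
    qed
    show "\<exists>m. propagates \<mu> s m" if "0 \<le> s" for s
      by (rule kernel[OF that])
  qed
  have t': "t \<in> {0..t}" "0 \<in> {0..t}" using t by auto
  have lnG: "ln (G s x) = ln (H s x) - \<theta> * s" if "s \<in> {0..t}" for s x
    using H_ge[OF that, of x] c0 by (simp add: G ln_mult)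
  \<comment> \<open>Above c0 the logarithm has Lipschitz constant 1/c0, and 2\<delta>/c0 =
    2\<theta>.\<close>
  have ln_close: "\<bar>ln (H s x) - ln (S (t - s) E x)\<bar> \<le> 2 * \<theta>" if s: "s \<in> {0..t}" for s x
  proof -
    have "c0 \<le> S (t - s) E x" using SE_ge[of "t - s" x] s m by (simp add: c0_def)
    then have "\<bar>ln (H s x) - ln (S (t - s) E x)\<bar> \<le> 1 / c0 * \<bar>H s x - S (t - s) E x\<bar>"
      by (intro abs_ln_diff_le c0 H_ge s)
    also have "\<dots> \<le> 1 / c0 * (2 * \<delta>)" using H_close[OF s] c0 by (intro mult_left_mono) auto
    finally show ?thesis by (simp add: \<theta>_def)
  qed
  interpret \<nu>: prob_space "C.\<nu> t" using C.\<nu>_space[OF t] by (simp add: space_prob_algebra)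
  interpret \<mu>: prob_space \<mu> by (rule C.prob_\<mu>)
  have sets_\<nu>: "sets (C.\<nu> t) = sets borel" using C.\<nu>_space[OF t] by (simp add: space_prob_algebra)
  have int_\<nu>: "integrable (C.\<nu> t) (apply_bcontfun v)" for v :: "'a cfun"
    by (rule integrable_bcontfun[OF \<nu>.finite_measure_axioms sets_\<nu>])
  have "\<theta> * t - 2 * \<theta> \<le> (\<integral>x. (h - C.lnG t) x \<partial>C.\<nu> t)"
  proof (rule \<nu>.integral_ge_const[OF int_\<nu>], rule AE_I2)
    fix x
    have "ln (S (t - t) E x) = h x" by (simp add: E_def bcomp_exp)
    then show "\<theta> * t - 2 * \<theta> \<le> (h - C.lnG t) x"
      using ln_close[OF t'(1), of x] by (simp add: C.lnG_apply[OF t'(1)] lnG[OF t'(1)])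
  qed
  then have 1: "\<theta> * t - 2 * \<theta> \<le> (\<integral>x. h x \<partial>C.\<nu> t) - (\<integral>x. ln (G t x) \<partial>C.\<nu> t)"
    by (simp add: int_\<nu> C.lnG_apply[OF t'(1)] flip: C.lnG_apply[OF t'(1)])
  have log_apply: "log_semigroup S t h x = ln (S t E x)" for x
    unfolding log_semigroup_def E_def[symmetric]
  proof (rule bcomp_apply')
    have "S t E x \<noteq> 0" for x using SE_ge[OF t, of x] m by linarith
    then show "continuous_on (range (apply_bcontfun (S t E))) ln" by (intro continuous_intros) auto
  qed
  have "- 2 * \<theta> \<le> (\<integral>x. (C.lnG 0 - log_semigroup S t h) x \<partial>\<mu>)"
  proof (rule \<mu>.integral_ge_const[OF C.integrable_\<mu>], rule AE_I2)
    fix x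
    show "- 2 * \<theta> \<le> (C.lnG 0 - log_semigroup S t h) x"
      using ln_close[OF t'(2), of x] by (simp add: C.lnG_apply[OF t'(2)] lnG[OF t'(2)] log_apply)
  qed
  then have 2: "- 2 * \<theta> \<le> (\<integral>x. ln (G 0 x) \<partial>\<mu>) - (\<integral>x. log_semigroup S t h x \<partial>\<mu>)"
    by (simp flip: C.lnG_apply[OF t'(2)])
  have "\<theta> * (4 + t) \<le> \<epsilon>"
  proof -
    have "\<theta> * (4 + t) = \<delta> * (2 * (4 + t)) / m" by (simp add: \<theta>_def c0_def)
    also have "\<dots> \<le> (\<epsilon> * m / (2 * (4 + t)) * (2 * (4 + t))) / m"
      using \<delta>(3) t m by (intro divide_right_mono mult_right_mono) auto
    also have "\<dots> = \<epsilon>" using t m by simp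
    finally show ?thesis .
  qed
  then have "(\<integral>x. log_semigroup S t h x \<partial>\<mu>) - \<epsilon> \<le> (\<integral>x. h x \<partial>C.\<nu> t)
      - ((\<integral>x. ln (G t x) \<partial>C.\<nu> t) - (\<integral>x. ln (G 0 x) \<partial>\<mu>) + 2 * \<theta> * t)"
    using 1 2 by (simp add: algebra_simps)
  then show ?thesis using C.variational_ge[of h] by (meson ereal_less_eq(3) order_trans)
qed

theorem variational_semigroup_ge:
  fixes h :: "'a cfun" and t :: real
  assumes "0 \<le> t" and "\<mu> \<in> space (prob_algebra borel)"
    and "\<And>s. 0 \<le> s \<Longrightarrow> \<exists>m. propagates \<mu> s m"
  shows "ereal (\<integral>x. log_semigroup S t h x \<partial>\<mu>)
    \<le> variational_semigroup S D \<tau> t (\<lambda>\<rho>. \<integral>x. h x \<partial>\<rho>) \<mu>"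
proof (rule ereal_le_epsilon2)
  fix \<epsilon> :: real assume "0 < \<epsilon>"
  from variational_lower_bound[OF assms(1) this assms(2,3)]
  have "ereal ((\<integral>x. log_semigroup S t h x \<partial>\<mu>) - \<epsilon>) + ereal \<epsilon>
      \<le> variational_semigroup S D \<tau> t (\<lambda>\<rho>. \<integral>x. h x \<partial>\<rho>) \<mu> + ereal \<epsilon>"
    by (intro add_right_mono) blast
  then show "ereal (\<integral>x. log_semigroup S t h x \<partial>\<mu>)
      \<le> variational_semigroup S D \<tau> t (\<lambda>\<rho>. \<integral>x. h x \<partial>\<rho>) \<mu> + ereal \<epsilon>" by simp
qed

end

theorem proposition4p20:
  fixes M :: "'w measure"
    and P :: "'a::metric_space \<Rightarrow> 'w measure"
    and X :: "real \<Rightarrow> 'w \<Rightarrow> 'a"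
    and S :: "real \<Rightarrow> ('a \<Rightarrow>\<^sub>C real) \<Rightarrow> ('a \<Rightarrow>\<^sub>C real)"
    and D :: "('a \<Rightarrow>\<^sub>C real) set"
    and \<tau> :: "('a \<Rightarrow>\<^sub>C real) topology"
    and h :: "'a \<Rightarrow>\<^sub>C real"
    and \<mu> :: "'a measure"
    and t :: real
  assumes "compact (UNIV :: 'a set)"
    and "markov_process M P X"
    and "transition_semigroup P X S"
    and "strongly_continuous_semigroup S"
    and "core_conditions S D \<tau>"
    and "0 \<le> t"
    and "\<mu> \<in> space (prob_algebra borel)"
  shows "variational_semigroup S D \<tau> t (\<lambda>\<rho>. \<integral>x. h x \<partial>\<rho>) \<mu>
    \<ge> ereal (\<integral>x. log_semigroup S t h x \<partial>\<mu>)"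
proof -
  have S_eq: "S s f x = (\<integral>\<omega>. f (X s \<omega>) \<partial>P x)" if "0 \<le> s" for s f x
    using assms(3) that by (simp add: transition_semigroup_def)
  have P: "prob_space (P x)" "sets (P x) = sets M" for x
    using assms(2) by (auto simp: markov_process_def space_prob_algebra)
  have X: "X s \<in> P x \<rightarrow>\<^sub>M borel" if "0 \<le> s" for s x
  proof -
    have "X s \<in> M \<rightarrow>\<^sub>M borel" using assms(2) that by (simp add: markov_process_def)
    then show ?thesis by (simp only: measurable_cong_sets[OF P(2) refl])
  qed
  have kernel_meas: "(\<lambda>x. distr (P x) borel (X s)) \<in> borel \<rightarrow>\<^sub>M prob_algebra borel" if "0 \<le> s" for s
    using assms(2) that by (auto simp: markov_process_def)
  interpret core_semigroup S D \<tau>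
  proof
    show "strongly_continuous_semigroup S" "compact (UNIV :: 'a set)" "core_conditions S D \<tau>" by fact+
    show "0 \<le> S s v x" if "0 \<le> s" "\<forall>x. 0 \<le> apply_bcontfun v x" for s v x
      using that by (simp add: S_eq)
    show "S s (const_bcontfun 1) = const_bcontfun 1" if "0 \<le> s" for s
      using that P(1) by (intro bcontfun_eqI) (simp add: S_eq prob_space.prob_space)
  qed
  have kernel: "\<exists>m. propagates \<mu> s m" if s: "0 \<le> s" for s
  proof (unfold propagates_def, intro exI conjI allI)
    \<comment> \<open>The law at time s from initial law \<mu> is obtained by mixing the transition
      kernels.\<close>
    let ?K = "\<lambda>x. distr (P x) borel (X s)" and ?m = "\<mu> \<bind> (\<lambda>x. distr (P x) borel (X s))"
    have K: "?K \<in> \<mu> \<rightarrow>\<^sub>M prob_algebra borel"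
      using kernel_meas[OF s] assms(7) by (subst measurable_cong_sets[of _ borel]) (auto simp: space_prob_algebra)
    have prob_m: "prob_space ?m" by (rule prob_space_bind'[OF assms(7) kernel_meas[OF s]])
    then show fin_m: "finite_measure ?m" by (rule prob_space.finite_measure)
    show sets_m: "sets ?m = sets borel" by (rule sets_bind'[OF assms(7) kernel_meas[OF s]])
    have \<mu>: "prob_space \<mu>" "sets \<mu> = sets borel" using assms(7) by (auto simp: space_prob_algebra)
    note fin_\<mu> = prob_space.finite_measure[OF \<mu>(1)]
    have pos: "(\<integral>x. v x \<partial>?m) = (\<integral>x. S s v x \<partial>\<mu>)" if v: "\<And>x. 0 \<le> v x" for v :: "'a \<Rightarrow>\<^sub>C real"
    proof -
      have Sv: "(\<integral>\<^sup>+y. ennreal (v y) \<partial>?K x) = ennreal (S s v x)" for x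
      proof -
        interpret prob_space "P x" by (rule P)
        have "integrable (P x) (\<lambda>\<omega>. v (X s \<omega>))"
          by (rule integrable_const_bound[of _ "norm v"]) (use norm_bounded[of v] X[OF s] in auto)
        then show ?thesis using X[OF s] v by (simp add: nn_integral_distr nn_integral_eq_integral S_eq s)
      qed
      have "ennreal (\<integral>x. v x \<partial>?m) = (\<integral>\<^sup>+x. ennreal (v x) \<partial>?m)"
        using v by (intro nn_integral_eq_integral[symmetric] integrable_bcontfun fin_m sets_m) auto
      also have "\<dots> = (\<integral>\<^sup>+x. (\<integral>\<^sup>+y. ennreal (v y) \<partial>?K x) \<partial>\<mu>)"
        by (rule nn_integral_bind[OF _ measurable_prob_algebraD[OF K]]) measurable
      also have "\<dots> = ennreal (\<integral>x. S s v x \<partial>\<mu>)"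
        unfolding Sv using v s
        by (intro nn_integral_eq_integral integrable_bcontfun fin_\<mu> \<mu>(2)) (auto intro!: S_pos)
      finally show ?thesis
        using v s by (subst (asm) ennreal_inj) (auto intro!: integral_nonneg_AE S_pos)
    qed
    fix v :: "'a \<Rightarrow>\<^sub>C real"
    \<comment> \<open>Adding the constant norm v reduces to the nonnegative case, in which integrals
      against the mixture are computed as nonnegative integrals.\<close>
    have *: "(\<integral>x. (v + norm v *\<^sub>R const_bcontfun 1) x \<partial>?m)
        = (\<integral>x. S s (v + norm v *\<^sub>R const_bcontfun 1) x \<partial>\<mu>)"
    proof (rule pos)
      fix x show "0 \<le> (v + norm v *\<^sub>R const_bcontfun 1) x" using norm_bounded[of v x] by (simp add: abs_le_iff)
    qed
    have "(\<integral>x. (v + norm v *\<^sub>R const_bcontfun 1) x \<partial>?m) = (\<integral>x. v x \<partial>?m) + norm v"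
      using integrable_bcontfun[OF fin_m sets_m, of v] prob_m
      by (simp add: prob_space.prob_space finite_measure.integrable_const[OF fin_m])
    moreover have "(\<integral>x. S s (v + norm v *\<^sub>R const_bcontfun 1) x \<partial>\<mu>) = (\<integral>x. S s v x \<partial>\<mu>) + norm v"
      using integrable_bcontfun[OF fin_\<mu> \<mu>(2), of "S s v"] s \<mu>(1)
      by (simp add: S_add S_scale S_one prob_space.prob_space finite_measure.integrable_const[OF fin_\<mu>])
    ultimately show "(\<integral>x. v x \<partial>?m) = (\<integral>x. S s v x \<partial>\<mu>)" using * by simp
  qed
  show ?thesis by (rule variational_semigroup_ge[OF assms(6,7) kernel])
qed

end
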